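(* Let $\mathcal{F}\subseteq\mathcal{B}^{<\omega}(\mathbb{N})$ be a tree and let $\mathcal{D}$ be an infinite disjoint collection. Case 1: if $\mathcal{F}_h\cap\mathcal{B}^{<\omega}(\mathcal{D})$ is not pointwise closed, there exists an infinite disjoint collection $\mathcal{D}_1<\mathcal{D}$ with $\mathcal{B}^{<\omega}(\mathcal{D}_1)\subseteq\mathcal{F}$. Case 2: if $\mathcal{F}_h\cap\mathcal{B}^{<\omega}(\mathcal{D})$ is pointwise closed, then $\zeta^{\mathcal{F}}_{\mathcal{D}}:=\sup\{s_{\mathcal{D}_1}(\mathcal{F}_h):\mathcal{D}_1<\mathcal{D}\}$ is a countable ordinal and for every countable ordinal $\xi$: (i) if $\xi+1<\zeta^{\mathcal{F}}_{\mathcal{D}}$, there exists $\mathcal{D}_2<\mathcal{D}$ with $\mathcal{B}^\xi\cap\mathcal{B}^{<\omega}(\mathcal{D}_2)\subseteq\mathcal{F}$; (ii) if $\xi>\zeta^{\mathcal{F}}_{\mathcal{D}}$, then for every $\mathcal{D}_1<\mathcal{D}$ there exists $\mathcal{D}_2<\mathcal{D}_1$ with $\mathcal{B}^\xi\cap\mathcal{B}^{<\omega}(\mathcal{D}_2)\subseteq\mathcal{B}^{<\omega}(\mathbb{N})\setminus\mathcal{F}$ (equivalently $\mathcal{F}\cap\mathcal{B}^{<\omega}(\mathcal{D}_2)\subseteq(\mathcal{B}^\xi)^*\setminus\mathcal{B}^\xi$); (iii) if $\xi+1=\zeta^{\mathcal{F}}_{\mathcal{D}}$ or $\xi=\zeta^{\mathcal{F}}_{\mathcal{D}}$,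 there exists $\mathcal{D}_2<\mathcal{D}$ such that either $\mathcal{B}^\xi\cap\mathcal{B}^{<\omega}(\mathcal{D}_2)\subseteq\mathcal{F}$ or $\mathcal{B}^\xi\cap\mathcal{B}^{<\omega}(\mathcal{D}_2)\subseteq\mathcal{B}^{<\omega}(\mathbb{N})\setminus\mathcal{F}$.
   Context: $\mathbb{N}=\{1,2,\dots\}$. For nonempty $s,t\subseteq\mathbb{N}$ with $s$ finite, $s<t$ means $\max s<\min t$. A finite disjoint collection is a tuple $(s_1,\dots,s_k)$, $k\ge0$ ($\emptyset$ for $k=0$), of nonempty finite subsets of $\mathbb{N}$ with $s_1<\dots<s_k$; an infinite disjoint collection is a sequence $(s_n)_{n\in\mathbb{N}}$ of nonempty finite subsets with $s_n<s_{n+1}$; collections are identified with the set of their members. $\mathcal{B}^{<\omega}(\mathbb{N})$: all finite disjoint collections. $FU(\mathcal{D})$: unions of finitely many (at least one) members of $\mathcal{D}$. For infinite disjoint collections, $\mathcal{D}_1<\mathcal{D}$ means $\mathcal{D}_1\subseteq FU(\mathcal{D})$. $\mathcal{B}^{<\omega}(\mathcal{D})$: finite disjoint collections with all members in $FU(\mathcal{D})$ (including $\emptyset$). $\mathbf{t}\propto\mathbf{s}$: $\mathbf{t}$ is an initial segment of $\mathbf{s}$. For $\mathcal{G}\subseteq\mathcal{B}^{<\omega}(\mathbb{N})$: $\mathcal{G}^*=\{\mathbf{t}:\mathbf{t}\propto\mathbf{s}\text{ for some }\mathbf{s}\in\mathcal{G}\}\cup\{\emptyset\}$; $\mathcal{G}$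 is a tree if $\mathcal{G}^*=\mathcal{G}$; $\mathcal{G}_*=\{\mathbf{t}\in\mathcal{B}^{<\omega}(\mathbb{N}):\mathbf{t}\subseteq FU(\mathbf{s})\text{ for some }\mathbf{s}\in\mathcal{G}\}\cup\{\emptyset\}$; $\mathcal{G}$ hereditary if $\mathcal{G}_*=\mathcal{G}$. $\mathcal{F}_h=\{\mathbf{s}\in\mathcal{F}:$ every finite disjoint collection $\mathbf{t}\subseteq FU(\mathbf{s})$ belongs to $\mathcal{F}\}\cup\{\emptyset\}$, the largest hereditary subfamily of $\mathcal{F}$. Pointwise closed: identify each collection with its characteristic function in $\{0,1\}^{[\mathbb{N}]^{<\omega}}$; a family is pointwise closed if its image is closed in the product topology. Strong block Cantor–Bendixson index of hereditary $\mathcal{G}$ on infinite $\mathcal{D}$: $(\mathcal{G})^0_{\mathcal{D}}=\mathcal{G}\cap\mathcal{B}^{<\omega}(\mathcal{D})$; $(\mathcal{G})^1_{\mathcal{D}}=\{\mathbf{s}\in\mathcal{G}\cap\mathcal{B}^{<\omega}(\mathcal{D}):\{t\in FU(\mathcal{D}):\mathbf{s}\cup\{t\}\notin\mathcal{G}\}$ contains no infinite disjoint collection$\}$ ($\mathbf{s}\cup\{t\}$: adjoin $t$ as a member); $(\mathcal{G})^{\zeta+1}_{\mathcal{D}}=((\mathcal{G})^\zeta_{\mathcal{D}})^1_{\mathcal{D}}$; intersections at limits. $s_{\mathcal{D}}(\mathcal{G})$ is the least $\xi$ with $(\mathcal{G})^\xi_{\mathcal{D}}=\emptyset$. Schreier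 families: fix for each countable limit $\lambda>0$ a strictly increasing sequence $(\lambda_n)$ of successor ordinals $<\lambda$ with supremum $\lambda$. $\mathcal{A}_0=\{\emptyset\}$; $\mathcal{A}_{\zeta+1}=\{\{n\}\cup s_1:s_1\in\mathcal{A}_\zeta,\{n\}<s_1\}$ ($\{n\}<\emptyset$ vacuous); $\mathcal{A}_{\omega^{\beta+1}}=\{s_1\cup\dots\cup s_n:s_1<\dots<s_n\in\mathcal{A}_{\omega^\beta},n=\min s_1\}$; for limit $\lambda>0$, $\mathcal{A}_{\omega^\lambda}=\{s:s\in\mathcal{A}_{\omega^{\lambda_n}},n=\min s\}$; for limit $\xi$ with $\omega^a<\xi<\omega^{a+1}$, $\xi=p\omega^a+\sum_{i=1}^m p_i\omega^{a_i}$ ($m\ge0$, $p,p_i\ge1$, $a>a_1>\dots>a_m>0$, $p>1$ or $m\ge1$): $\mathcal{A}_\xi=\{s_0\cup\dots\cup s_m:s_m<\dots<s_0,\ s_0=s^0_1\cup\dots\cup s^0_p$ with $s^0_1<\dots<s^0_p\in\mathcal{A}_{\omega^a}$, $s_i=s^i_1\cup\dots\cup s^i_{p_i}$ with $s^i_1<\dots<s^i_{p_i}\in\mathcal{A}_{\omega^{a_i}}\}$. $\mathcal{B}^0=\{\emptyset\}$; for $\xi\ge1$, $\mathcal{B}^\xi=\{(s_1,\dots,s_k):k\ge1,\ s_1<\dots<s_k,\ \{\min s_1,\dots,\min s_k\}\in\mathcal{A}_\xi\}$. *)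

theory Defs
  imports "HOL-Analysis.Analysis" "HOL-Library.Countable_Set_Type" "HOL-Library.Sublist"
begin

section \<open>Countable ordinals\<close>

text \<open>The type of all countable ordinals: a well-order of type $\omega_1$.\<close>

unbundle cardinal_syntax

typedef omega1 = "Field (cardSuc natLeq)"
proof -
  have "Field (cardSuc natLeq) \<noteq> {}"
  proof
    assume "Field (cardSuc natLeq) = {}"
    then have "|{} :: nat set set| =o cardSuc natLeq"
      using card_of_Field_ordIso[OF cardSuc_Card_order[OF natLeq_Card_order]] by simp
    then have "cardSuc natLeq \<le>o |Field natLeq|"
      by (rule ordIso_ordLeq_trans[OF ordIso_symmetric card_of_empty])
    then have "cardSuc natLeq \<le>o natLeq"
      by (rule ordLeq_ordIso_trans) (rule card_of_Field_ordIso[OF natLeq_Card_order])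
    then show False
      using cardSuc_greater[OF natLeq_Card_order] not_ordLess_ordLeq by blast
  qed
  then show ?thesis by blast
qed

setup_lifting type_definition_omega1

instantiation omega1 :: linorder
begin

lift_definition less_eq_omega1 :: "omega1 \<Rightarrow> omega1 \<Rightarrow> bool"
  is "\<lambda>a b. (a, b) \<in> cardSuc natLeq" .

definition less_omega1 :: "omega1 \<Rightarrow> omega1 \<Rightarrow> bool"
  where "a < b \<longleftrightarrow> a \<le> b \<and> \<not> b \<le> (a::omega1)"

lemma Well_order_cardSuc_natLeq: "Well_order (cardSuc natLeq)"
  using cardSuc_Card_order[OF natLeq_Card_order] by (simp add: card_order_on_def)

instance
proof
  fix x y z :: omega1
  have W: "Linear_order (cardSuc natLeq)"
    using Well_order_cardSuc_natLeq by (simp add: well_order_on_def)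
  then have R: "Refl (cardSuc natLeq)" and T: "trans (cardSuc natLeq)"
    and A: "antisym (cardSuc natLeq)" and L: "Total (cardSuc natLeq)"
    by (auto simp: order_on_defs)
  show "x < y \<longleftrightarrow> x \<le> y \<and> \<not> y \<le> x" by (simp add: less_omega1_def)
  show "x \<le> x" using R by transfer (auto simp: refl_on_def)
  show "x \<le> y \<Longrightarrow> y \<le> z \<Longrightarrow> x \<le> z" using T by transfer (auto dest: transD)
  show "x \<le> y \<Longrightarrow> y \<le> x \<Longrightarrow> x = y" using A by transfer (auto dest: antisymD)
  show "x \<le> y \<or> y \<le> x" using L R unfolding total_on_def refl_on_def by transfer metis
qed

end

lemma wf_less_omega1: "wf {(x, y). x < (y::omega1)}"
proof -
  have wf: "wf (cardSuc natLeq - Id)"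
    using Well_order_cardSuc_natLeq by (simp add: well_order_on_def)
  have "{(x, y). x < (y::omega1)} \<subseteq> inv_image (cardSuc natLeq - Id) Rep_omega1"
    by (auto simp: less_le less_eq_omega1.rep_eq Rep_omega1_inject)
  then show ?thesis using wf_subset[OF wf_inv_image[OF wf]] by blast
qed

instance omega1 :: wellorder
  using wf_less_omega1 by intro_classes (auto simp: wf_def)

lemma countable_lessThan_omega1: "countable {..<a::omega1}"
proof -
  have "Rep_omega1 ` {..<a} \<subseteq> underS (cardSuc natLeq) (Rep_omega1 a)"
    by (auto simp: underS_def less_le less_eq_omega1.rep_eq Rep_omega1_inject)
  moreover have "|underS (cardSuc natLeq) (Rep_omega1 a)| \<le>o natLeq"
    using card_of_underS[OF cardSuc_Card_order[OF natLeq_Card_order] Rep_omega1]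
      cardSuc_ordLeq_ordLess[OF natLeq_Card_order card_of_Card_order] by blast
  ultimately have "countable (Rep_omega1 ` {..<a})"
    using countable_card_le_natLeq countable_subset by blast
  then show ?thesis
    by (rule countable_image_inj_on) (simp add: inj_on_def Rep_omega1_inject)
qed

lemma uncountable_omega1: "uncountable (UNIV :: omega1 set)"
proof
  assume "countable (UNIV :: omega1 set)"
  then have "countable (Rep_omega1 ` UNIV)" by (rule countable_image)
  then have "|Field (cardSuc natLeq)| \<le>o natLeq"
    using type_definition.Rep_range[OF type_definition_omega1] countable_card_le_natLeq by metis
  then have "cardSuc natLeq \<le>o natLeq"
    using cardSuc_Card_order[OF natLeq_Card_order] card_of_Field_ordIso
      ordIso_ordLeq_trans ordIso_symmetric by blast
  then show False
    using cardSuc_greater[OF natLeq_Card_order] not_ordLess_ordLeq by blast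
qed

unbundle no cardinal_syntax

text \<open>\<open>Sup\<close> is the least upper bound for sets bounded in \<^typ>\<open>omega1\<close>, that is, for sets whose
  supremum is a countable ordinal; for an unbounded set its value is meaningless.\<close>

instantiation omega1 :: conditionally_complete_linorder
begin

definition inf_omega1 :: "omega1 \<Rightarrow> omega1 \<Rightarrow> omega1" where "inf_omega1 = min"
definition sup_omega1 :: "omega1 \<Rightarrow> omega1 \<Rightarrow> omega1" where "sup_omega1 = max"
definition Inf_omega1 :: "omega1 set \<Rightarrow> omega1" where "Inf_omega1 A = (LEAST x. x \<in> A)"
definition Sup_omega1 :: "omega1 set \<Rightarrow> omega1" where "Sup_omega1 A = (LEAST z. \<forall>x\<in>A. x \<le> z)"

instance
proof
  fix x z :: omega1 and X :: "omega1 set"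
  show "x \<in> X \<Longrightarrow> Inf X \<le> x" by (simp add: Inf_omega1_def Least_le)
  show "X \<noteq> {} \<Longrightarrow> (\<And>x. x \<in> X \<Longrightarrow> z \<le> x) \<Longrightarrow> z \<le> Inf X"
    unfolding Inf_omega1_def by (rule LeastI2_ex) auto
  show "x \<in> X \<Longrightarrow> bdd_above X \<Longrightarrow> x \<le> Sup X"
    unfolding Sup_omega1_def bdd_above_def by (rule LeastI2_ex) auto
  show "X \<noteq> {} \<Longrightarrow> (\<And>x. x \<in> X \<Longrightarrow> x \<le> z) \<Longrightarrow> Sup X \<le> z"
    unfolding Sup_omega1_def by (simp add: Least_le)
qed (auto simp: inf_omega1_def sup_omega1_def)

end

lemma countable_bdd_above_omega1:
  assumes "countable (A :: omega1 set)"
  shows "bdd_above A"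
proof (rule ccontr)
  assume "\<not> bdd_above A"
  then have "UNIV = (\<Union>a\<in>A. {..<a})" by (auto simp: bdd_above_def not_le)
  moreover have "countable (\<Union>a\<in>A. {..<a})"
    using assms countable_lessThan_omega1 by blast
  ultimately show False using uncountable_omega1 by simp
qed

definition osucc :: "omega1 \<Rightarrow> omega1"
  where "osucc a = (LEAST b. a < b)"

lemma less_osucc_iff: "a < osucc b \<longleftrightarrow> a \<le> b"
proof -
  have "\<exists>c. b < c"
  proof (rule ccontr)
    assume "\<nexists>c. b < c"
    then have "UNIV = insert b {..<b}" by (auto simp: not_less le_less)
    then show False
      using uncountable_omega1 countable_insert[OF countable_lessThan_omega1[of b], of b] by simp
  qed
  then have "b < osucc b" unfolding osucc_def by (rule LeastI_ex)
  moreover have "osucc b \<le> a" if "b < a" using that by (simp add: osucc_def Least_le)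
  ultimately show ?thesis by (cases "b < a") (auto simp: not_less)
qed

lemma osucc_le_iff: "osucc a \<le> b \<longleftrightarrow> a < b"
  using less_osucc_iff[of b a] by (simp only: not_le[symmetric]) blast

lemma osucc_inject [simp]: "osucc a = osucc b \<longleftrightarrow> a = b"
proof
  assume *: "osucc a = osucc b"
  have "a \<le> b" using less_osucc_iff[of a a] less_osucc_iff[of a b] * by simp
  moreover have "b \<le> a" using less_osucc_iff[of b b] less_osucc_iff[of b a] * by simp
  ultimately show "a = b" by simp
qed simp

lemma less_osucc [simp]: "a < osucc a"
  by (simp add: less_osucc_iff)

definition opred :: "omega1 \<Rightarrow> omega1"
  where "opred a = (THE b. a = osucc b)"

lemma opred_osucc [simp]: "opred (osucc a) = a"
  by (simp add: opred_def)

instantiation omega1 :: "{zero, one}"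
begin
definition zero_omega1 :: omega1 where "zero_omega1 = (LEAST a. True)"
definition one_omega1 :: omega1 where "one_omega1 = osucc 0"
instance ..
end

lemma zero_le_omega1 [simp]: "0 \<le> (a::omega1)"
  by (simp add: zero_omega1_def Least_le)

lemma not_less_zero_omega1 [simp]: "\<not> (a::omega1) < 0"
  by (simp add: not_less)

lemma osucc_neq_zero [simp]: "osucc a \<noteq> 0" "0 \<noteq> osucc a"
  using less_osucc[of a] by (auto simp del: less_osucc)

text \<open>Limit ordinals are nonzero throughout.\<close>

definition is_succ :: "omega1 \<Rightarrow> bool"
  where "is_succ a \<longleftrightarrow> (\<exists>b. a = osucc b)"

definition is_limit :: "omega1 \<Rightarrow> bool"
  where "is_limit a \<longleftrightarrow> a \<noteq> 0 \<and> \<not> is_succ a"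

lemma is_limit_simps [simp]: "\<not> is_limit 0" "\<not> is_limit (osucc a)"
  by (auto simp: is_limit_def is_succ_def)

lemma is_limitD: "is_limit a \<Longrightarrow> b < a \<Longrightarrow> osucc b < a"
  using osucc_le_iff[of b a] by (auto simp: is_limit_def is_succ_def le_less)

lemma opred_less: "a \<noteq> 0 \<Longrightarrow> \<not> is_limit a \<Longrightarrow> opred a < a"
  by (auto simp: is_limit_def is_succ_def)

lemma omega1_cases [case_names zero succ limit]:
  obtains "a = 0" | b where "a = osucc b" | "is_limit a"
  by (auto simp: is_limit_def is_succ_def)

function oadd :: "omega1 \<Rightarrow> omega1 \<Rightarrow> omega1" where
  "oadd a b =
    (if b = 0 then a
     else if is_limit b then Sup (oadd a ` {..<b})
     else osucc (oadd a (opred b)))"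
  by auto
termination
  by (relation "inv_image {(x, y). x < y} snd") (auto simp: wf_less_omega1 opred_less)

declare oadd.simps [simp del]

instantiation omega1 :: plus
begin
definition plus_omega1 :: "omega1 \<Rightarrow> omega1 \<Rightarrow> omega1" where "plus_omega1 = oadd"
instance ..
end

lemma
  fixes a b :: omega1
  shows add_zero_omega1: "a + 0 = a"
    and add_osucc: "a + osucc b = osucc (a + b)"
    and add_limit: "is_limit b \<Longrightarrow> a + b = Sup ((+) a ` {..<b})"
  by (subst plus_omega1_def, subst oadd.simps, force simp: plus_omega1_def)+

lemma less_Sup_omega1_iff:
  fixes A :: "omega1 set"
  assumes "countable A" "A \<noteq> {}"
  shows "x < Sup A \<longleftrightarrow> (\<exists>a\<in>A. x < a)"
  using less_cSup_iff[OF assms(2) countable_bdd_above_omega1[OF assms(1)]] .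

lemma is_limit_lessThan_neq: "is_limit a \<Longrightarrow> {..<a} \<noteq> {}"
  using zero_le_omega1[of a] by (auto simp: is_limit_def le_less simp del: zero_le_omega1)

lemma less_add_omega1_iff:
  fixes a b x :: omega1
  shows "x < a + b \<longleftrightarrow> x < a \<or> (\<exists>c<b. x \<le> a + c)"
proof (induction b arbitrary: x rule: less_induct)
  case (less b)
  show ?case
  proof (cases b rule: omega1_cases)
    case zero
    then show ?thesis by (simp add: add_zero_omega1)
  next
    case (succ c)
    have "c < b" using succ by simp
    note IH = less.IH[OF this]
    have "a + d < a + c" if "d < c" for d
      using that IH[of "a + d"] by blast
    then have "a + d \<le> a + c" if "d \<le> c" for d
      using that by (cases "d = c") (auto simp: le_less)
    moreover have "a \<le> a + c"
      using IH[of "a + c"] by (cases "a \<le> a + c") (auto simp: not_le)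
    ultimately show ?thesis
      using succ by (auto simp: add_osucc less_osucc_iff intro: order_trans)
  next
    case limit
    have "x < a + b \<longleftrightarrow> (\<exists>c<b. x < a + c)"
      using less_Sup_omega1_iff[of "(+) a ` {..<b}" x] countable_lessThan_omega1
        is_limit_lessThan_neq[OF limit]
      by (simp add: add_limit[OF limit] Bex_def)
    moreover have "(\<exists>c<b. x < a + c) \<longleftrightarrow> x < a \<or> (\<exists>c<b. x \<le> a + c)"
    proof
      assume "\<exists>c<b. x < a + c"
      then show "x < a \<or> (\<exists>c<b. x \<le> a + c)" using less_imp_le by blast
    next
      assume "x < a \<or> (\<exists>c<b. x \<le> a + c)"
      then show "\<exists>c<b. x < a + c"
      proof
        assume "x < a"
        moreover have "0 < b" using limit by (simp add: is_limit_def le_neq_trans)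
        ultimately show ?thesis using add_zero_omega1[of a] by (intro exI[of _ 0]) simp
      next
        assume "\<exists>c<b. x \<le> a + c"
        then obtain c where "c < b" "x \<le> a + c" by blast
        then have "osucc c < b" "x < a + osucc c"
          using is_limitD[OF limit] by (simp_all add: add_osucc less_osucc_iff)
        then show ?thesis by blast
      qed
    qed
    ultimately show ?thesis by simp
  qed
qed

lemma add_left_strict_mono_omega1: "b < c \<Longrightarrow> a + b < a + (c::omega1)"
  unfolding less_add_omega1_iff[of "a + b" a c] by blast

lemma add_left_mono_omega1: "b \<le> c \<Longrightarrow> a + b \<le> a + (c::omega1)"
  using add_left_strict_mono_omega1 by (cases "b = c") (auto simp: le_less)

instance omega1 :: monoid_add
proof
  fix a b c :: omega1
  show "a + 0 = a" by (rule add_zero_omega1)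
  show "0 + a = a"
  proof (induction a rule: less_induct)
    case (less a)
    have "x < 0 + a \<longleftrightarrow> (\<exists>c<a. x \<le> 0 + c)" for x
      by (simp add: less_add_omega1_iff[of x 0 a])
    then have "x < 0 + a \<longleftrightarrow> x < a" for x
      using less by (auto intro: le_less_trans)
    then show ?case using less_irrefl neqE by blast
  qed
  show "a + b + c = a + (b + c)"
  proof (induction c rule: less_induct)
    case (less c)
    have "x < a + b + c \<longleftrightarrow> x < a + (b + c)" for x
    proof -
      have "x < a + (b + c) \<longleftrightarrow> x < a \<or> (\<exists>e. (e < b \<or> (\<exists>d<c. e \<le> b + d)) \<and> x \<le> a + e)"
        by (subst less_add_omega1_iff) (simp add: less_add_omega1_iff[of _ b c])
      also have "\<dots> \<longleftrightarrow> x < a \<or> (\<exists>e<b. x \<le> a + e) \<or> (\<exists>d<c. x \<le> a + (b + d))"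
        using order_trans[OF _ add_left_mono_omega1] by blast
      also have "\<dots> \<longleftrightarrow> x < a + b + c"
        using less by (simp add: less_add_omega1_iff[of x "a + b" c] less_add_omega1_iff[of x a b]
            cong: conj_cong)
      finally show ?thesis by simp
    qed
    then show ?case using less_irrefl neqE by blast
  qed
qed

lemma add_one_omega1: "a + 1 = osucc a"
  by (simp add: one_omega1_def add_osucc)

text \<open>\<open>nat_mult n a\<close> is $n \cdot a$ in the convention $n a = a + \dots + a$ ($n$ times).\<close>

definition nat_mult :: "nat \<Rightarrow> omega1 \<Rightarrow> omega1"
  where "nat_mult n a = sum_list (replicate n a)"

function omega_pow :: "omega1 \<Rightarrow> omega1" where
  "omega_pow a =
    (if a = 0 then 1
     else if is_limit a then Sup (omega_pow ` {..<a})
     else Sup (range (\<lambda>n. nat_mult n (omega_pow (opred a)))))"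
  by auto
termination
  by (relation "{(x, y). x < y}") (auto simp: wf_less_omega1 opred_less)

declare omega_pow.simps [simp del]

lemma
  shows omega_pow_zero: "omega_pow 0 = 1"
    and omega_pow_osucc: "omega_pow (osucc a) = (SUP n. nat_mult n (omega_pow a))"
    and omega_pow_limit: "is_limit a \<Longrightarrow> omega_pow a = (SUP b\<in>{..<a}. omega_pow b)"
  by (subst omega_pow.simps, force)+


section \<open>Block collections\<close>

text \<open>The natural numbers of the text start at 1, so \<open>0\<close> is excluded from all sets considered.\<close>

definition is_block :: "nat set \<Rightarrow> bool"
  where "is_block s \<longleftrightarrow> finite s \<and> s \<noteq> {} \<and> s \<subseteq> {1..}"

definition block_less :: "nat set \<Rightarrow> nat set \<Rightarrow> bool"  (infix \<open>\<lless>\<close> 50)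
  where "s \<lless> t \<longleftrightarrow> is_block s \<and> is_block t \<and> Max s < Min t"

definition block_seq :: "nat set list \<Rightarrow> bool"
  where "block_seq ss \<longleftrightarrow> list_all is_block ss \<and> sorted_wrt (\<lless>) ss"

text \<open>Collections are represented by the sets of their members.\<close>

definition fin_colls :: "nat set set set"
  where "fin_colls = {set ss | ss. block_seq ss}"

definition inf_colls :: "nat set set set"
  where "inf_colls = {range f | f. \<forall>n::nat. is_block (f n) \<and> f n \<lless> f (Suc n)}"

definition FU :: "nat set set \<Rightarrow> nat set set"
  where "FU D = {\<Union>C | C. C \<subseteq> D \<and> finite C \<and> C \<noteq> {}}"

definition coll_less :: "nat set set \<Rightarrow> nat set set \<Rightarrow> bool"  (infix \<open>\<sqsubset>\<close> 50)
  where "D1 \<sqsubset> D \<longleftrightarrow> D1 \<in> inf_colls \<and> D \<in> inf_colls \<and> D1 \<subseteq> FU D"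

definition fin_colls_in :: "nat set set \<Rightarrow> nat set set set"
  where "fin_colls_in D = {s \<in> fin_colls. s \<subseteq> FU D}"

definition init_seg :: "nat set set \<Rightarrow> nat set set \<Rightarrow> bool"  (infix \<open>\<propto>\<close> 50)
  where "t \<propto> s \<longleftrightarrow> (\<exists>ts ss. block_seq ss \<and> prefix ts ss \<and> t = set ts \<and> s = set ss)"

definition init_closure :: "nat set set set \<Rightarrow> nat set set set"
  where "init_closure G = {t. \<exists>s\<in>G. t \<propto> s} \<union> {{}}"

definition is_tree :: "nat set set set \<Rightarrow> bool"
  where "is_tree G \<longleftrightarrow> init_closure G = G"

definition hered_part :: "nat set set set \<Rightarrow> nat set set set"
  where "hered_part F = {s \<in> F. \<forall>t\<in>fin_colls. t \<subseteq> FU s \<longrightarrow> t \<in> F} \<union> {{}}"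

abbreviation fin_subsets :: "nat set set"
  where "fin_subsets \<equiv> {x. finite x \<and> x \<subseteq> {1..}}"

text \<open>Points of the product space are extensional functions, hence the restriction.\<close>

definition pointwise_closed :: "nat set set set \<Rightarrow> bool"
  where "pointwise_closed G \<longleftrightarrow>
    closedin (product_topology (\<lambda>_. discrete_topology {0, 1::nat}) fin_subsets)
      ((\<lambda>s. restrict (indicator s) fin_subsets) ` G)"


section \<open>The strong block Cantor--Bendixson index\<close>

definition sb_deriv1 :: "nat set set \<Rightarrow> nat set set set \<Rightarrow> nat set set set"
  where "sb_deriv1 D G = {s \<in> G \<inter> fin_colls_in D.
    \<not> (\<exists>E\<in>inf_colls. E \<subseteq> {t \<in> FU D. s \<union> {t} \<notin> G})}"

function sb_deriv :: "nat set set \<Rightarrow> nat set set set \<Rightarrow> omega1 \<Rightarrow> nat set set set" where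
  "sb_deriv D G a =
    (if a = 0 then G \<inter> fin_colls_in D
     else if is_limit a then (\<Inter>b\<in>{..<a}. sb_deriv D G b)
     else sb_deriv1 D (sb_deriv D G (opred a)))"
  by auto
termination
  by (relation "inv_image {(x, y). x < y} (snd \<circ> snd)") (auto simp: wf_less_omega1 opred_less)

declare sb_deriv.simps [simp del]

lemma
  shows sb_deriv_zero: "sb_deriv D G 0 = G \<inter> fin_colls_in D"
    and sb_deriv_osucc: "sb_deriv D G (osucc a) = sb_deriv1 D (sb_deriv D G a)"
    and sb_deriv_limit: "is_limit a \<Longrightarrow> sb_deriv D G a = (\<Inter>b<a. sb_deriv D G b)"
  by (subst sb_deriv.simps, force)+

text \<open>The derivatives decrease and there are only countably many finite collections, so they
  stabilise at a countable stage: if they vanish at some ordinal, they do so at a countable one.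
  If they never vanish, \<open>sb_index_exists\<close> fails and the value of \<open>sb_index\<close> is meaningless.\<close>

definition sb_index_exists :: "nat set set \<Rightarrow> nat set set set \<Rightarrow> bool"
  where "sb_index_exists D G \<longleftrightarrow> (\<exists>a. sb_deriv D G a = {})"

definition sb_index :: "nat set set \<Rightarrow> nat set set set \<Rightarrow> omega1"
  where "sb_index D G = (LEAST a. sb_deriv D G a = {})"


section \<open>Schreier families\<close>

definition limit_approx :: "(omega1 \<Rightarrow> nat \<Rightarrow> omega1) \<Rightarrow> bool"
  where "limit_approx L \<longleftrightarrow> (\<forall>l. is_limit l \<longrightarrow>
    strict_mono_on {1..} (L l) \<and> (\<forall>n\<ge>1. is_succ (L l n) \<and> L l n < l) \<and> Sup (L l ` {1..}) = l)"

text \<open>The recursion defining the families is rendered as a least fixed point: the family at an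
  ordinal refers only to families at smaller ordinals, and exactly one clause applies to each
  ordinal. In the last clause \<open>cs\<close> lists the pairs (exponent, coefficient) of the Cantor normal
  form $p \omega^a + \sum_i p_i \omega^{a_i}$ with leading term first; all exponents are positive
  because the ordinal is a limit, and \<open>cs \<noteq> [(a, 1)]\<close> is the condition $p > 1$ or $m \ge 1$.
  The parts \<open>bs\<close>, listed in the same order, are then decreasing as blocks.\<close>

inductive in_schreier :: "(omega1 \<Rightarrow> nat \<Rightarrow> omega1) \<Rightarrow> omega1 \<Rightarrow> nat set \<Rightarrow> bool"
  for L :: "omega1 \<Rightarrow> nat \<Rightarrow> omega1" where
  zero: "in_schreier L 0 {}"
| succ: "in_schreier L (z + 1) ({n} \<union> s)"
    if "in_schreier L z s" and "n \<ge> 1" and "s = {} \<or> {n} \<lless> s"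
| omega_pow_succ: "in_schreier L (omega_pow (b + 1)) (\<Union>(set ss))"
    if "ss \<noteq> []" and "list_all (in_schreier L (omega_pow b)) ss" and "block_seq ss"
      and "length ss = Min (hd ss)"
| omega_pow_limit: "in_schreier L (omega_pow l) s"
    if "is_limit l" and "s \<noteq> {}" and "in_schreier L (omega_pow (L l (Min s))) s"
| cantor: "in_schreier L (sum_list (map (\<lambda>(a, p). nat_mult p (omega_pow a)) cs)) (\<Union>(set bs))"
    if "cs \<noteq> []" and "sorted_wrt (>) (map fst cs)" and "\<forall>(a, p)\<in>set cs. a > 0 \<and> p \<ge> 1"
      and "\<nexists>a. cs = [(a, 1)]"
      and "sorted_wrt (\<lambda>s t. t \<lless> s) bs"
      and "list_all2 (\<lambda>c s. \<exists>ss. length ss = snd c \<and> block_seq ss \<and>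
             list_all (in_schreier L (omega_pow (fst c))) ss \<and> s = \<Union>(set ss)) cs bs"

definition schreier :: "(omega1 \<Rightarrow> nat \<Rightarrow> omega1) \<Rightarrow> omega1 \<Rightarrow> nat set set"
  where "schreier L a = {s. in_schreier L a s}"

definition block_schreier :: "(omega1 \<Rightarrow> nat \<Rightarrow> omega1) \<Rightarrow> omega1 \<Rightarrow> nat set set set"
  where "block_schreier L a =
    (if a = 0 then {{}} else {s \<in> fin_colls. s \<noteq> {} \<and> Min ` s \<in> schreier L a})"

end

theory Submission
  imports Defs
begin

text \<open>Removing the first block turns a member of $\mathcal{B}^\xi$ with first block $t$ into a member of
  $\mathcal{B}^{\xi_n}$, $n = \min t$, where $\xi_n < \xi$ and every ordinal below $\xi$ is eventually at
  most $\xi_n$; nothing else about the Schreier families matters. By induction on $\xi$, a fusion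
  argument and Hindman's theorem, every family contains or avoids
  $\mathcal{B}^\xi \cap \mathcal{B}^{<\omega}(\mathcal{D}_2)$ for some $\mathcal{D}_2$.
  By the same recursion, $\emptyset$ survives $\xi$ strong derivatives of a hereditary family that
  contains $\mathcal{B}^\xi$, and does not survive $\xi + 1$ of them if the family is disjoint from
  $\mathcal{B}^\xi$. So the index decides which alternative of the dichotomy holds. It is bounded by the
  rank of the tree $\mathcal{F}_h \cap \mathcal{B}^{<\omega}(\mathcal{D})$, which has an infinite branch
  exactly if it is not pointwise closed.\<close>

section \<open>Cantor normal forms\<close>

text \<open>The clauses defining the families do not show how to remove a least element. In the
  normal form of \<xi> the smallest exponent governs the first part of a set, so removing the
  minimum n only replaces the last power by a smaller ordinal depending on n. Uniqueness of normal
  forms makes the clauses invertible.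

  Two mismatches shape the rest. The dichotomy concerns F, the index concerns
  \<open>hered_part F\<close>, and a tree need not be hereditary; passing from F to its hereditary
  part takes one more application of the dichotomy. Moreover the two estimates of the index do not
  meet: containing B^\<xi> forces an index above \<xi>, avoiding it only an index of at most \<xi> +
  1. The gap arises at limit stages, where the ordinals \<xi>_n of the possible first blocks have no
  common bound below \<xi>.

  The supremum runs over uncountably many collections. It is countable because one tree over D,
  whose nodes have only countably many children, bounds all the indices at once.\<close>

lemma add_right_mono_omega1:
  fixes a b c :: omega1
  assumes "a \<le> b"
  shows "a + c \<le> b + c"
proof (induction c rule: less_induct)
  case (less c)
  show ?case
  proof (rule ccontr)
    assume "\<not> a + c \<le> b + c"
    then have lt: "b + c < a + c" by simp
    then consider "b + c < a" | d where "d < c" "b + c \<le> a + d"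
      unfolding less_add_omega1_iff[of "b + c" a c] by blast
    then show False
    proof cases
      case 1
      have "b + 0 \<le> b + c" by (rule add_left_mono_omega1) simp
      then show False using 1 assms by simp
    next
      case 2
      have "b + c \<le> b + d" using 2 less[of d] by (meson order_trans)
      then show False using add_left_strict_mono_omega1[OF 2(1), of b] by simp
    qed
  qed
qed

lemma add_mono_omega1: "a \<le> b \<Longrightarrow> c \<le> d \<Longrightarrow> a + c \<le> b + (d::omega1)"
  by (meson add_left_mono_omega1 add_right_mono_omega1 order_trans)

lemma le_add_left_omega1: "a \<le> a + (b::omega1)"
  using add_left_mono_omega1[of 0 b a] by simp

lemma le_add_right_omega1: "b \<le> a + (b::omega1)"
  using add_right_mono_omega1[of 0 a b] by simp

lemma add_left_cancel_omega1: "a + b = a + c \<longleftrightarrow> b = (c::omega1)"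
  by (metis add_left_strict_mono_omega1 less_irrefl neqE)

lemma le_imp_add_omega1:
  fixes a b :: omega1
  assumes "a \<le> b"
  obtains c where "b = a + c"
proof -
  define c where "c = (LEAST c. b \<le> a + c)"
  have "b \<le> a + c" unfolding c_def by (rule LeastI[of _ b]) (rule le_add_right_omega1)
  moreover have "\<not> b < a + c"
  proof
    assume "b < a + c"
    then obtain d where "d < c" "b \<le> a + d"
      using assms less_add_omega1_iff[of b a c] by force
    then show False using not_less_Least[of d "\<lambda>c. b \<le> a + c"] by (simp add: c_def)
  qed
  ultimately show ?thesis using that by force
qed

section \<open>Finite multiples and powers of \<omega>\<close>

lemma nat_mult_simps [simp]: "nat_mult 0 a = 0" "nat_mult (Suc n) a = a + nat_mult n a"
  by (simp_all add: nat_mult_def)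

lemma nat_mult_Suc_right: "nat_mult (Suc n) a = nat_mult n a + a"
  by (induction n) (simp_all flip: add.assoc)

lemma nat_mult_strict_mono:
  assumes "m < n" "a \<noteq> 0"
  shows "nat_mult m a < nat_mult n a"
  using assms(1)
proof (induction n)
  case (Suc n)
  have "0 < a" using assms(2) by (simp add: less_le)
  then have *: "nat_mult n a < nat_mult (Suc n) a"
    using add_left_strict_mono_omega1[of 0 a "nat_mult n a"]
    by (simp add: nat_mult_Suc_right del: nat_mult_simps(2))
  then show ?case using Suc by (cases "m = n") (auto intro: less_trans simp del: nat_mult_simps)
qed simp

text \<open>The name \<open>omega_pow_limit\<close> of the equation for $\omega^\lambda$ is hidden by the rule of
  \<^const>\<open>in_schreier\<close> with the same name.\<close>

lemma less_omega_pow_limit_iff: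
  assumes "is_limit a"
  shows "x < omega_pow a \<longleftrightarrow> (\<exists>b<a. x < omega_pow b)"
proof -
  have "omega_pow a = Sup (omega_pow ` {..<a})"
    using assms by (subst omega_pow.simps) auto
  then show ?thesis
    using less_Sup_omega1_iff[of "omega_pow ` {..<a}" x] countable_lessThan_omega1[of a]
      is_limit_lessThan_neq[OF assms]
    by (simp add: Bex_def)
qed

lemma less_omega_pow_osucc_iff:
  "x < omega_pow (osucc a) \<longleftrightarrow> (\<exists>n. x < nat_mult n (omega_pow a))"
  unfolding omega_pow_osucc
  using less_Sup_omega1_iff[of "range (\<lambda>n. nat_mult n (omega_pow a))" x] by simp

lemma omega_pow_pos: "0 < omega_pow a"
proof (induction a rule: less_induct)
  case (less a)
  show ?case
  proof (cases a rule: omega1_cases)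
    case zero
    then show ?thesis by (simp add: omega_pow_zero one_omega1_def less_le)
  next
    case (succ b)
    then have "0 < nat_mult 1 (omega_pow b)" using less by simp
    then show ?thesis unfolding succ less_omega_pow_osucc_iff by blast
  next
    case limit
    then show ?thesis unfolding less_omega_pow_limit_iff[OF limit]
      using less is_limit_lessThan_neq by blast
  qed
qed

lemma omega_pow_neq_zero [simp]: "omega_pow a \<noteq> 0" "0 \<noteq> omega_pow a"
  using omega_pow_pos[of a] by auto

text \<open>One more summand already exceeds the given multiple, and it still lies below the next
  power. The case \<open>n = 1\<close> gives strict monotonicity of the powers; general
  \<open>n\<close> bounds whole normal forms.\<close>

lemma nat_mult_omega_pow_less: "a < b \<Longrightarrow> nat_mult n (omega_pow a) < omega_pow b"
proof (induction b arbitrary: n rule: less_induct)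
  case (less b)
  have succ: "nat_mult m (omega_pow c) < omega_pow (osucc c)" for m c
    unfolding less_omega_pow_osucc_iff
    by (rule exI[of _ "Suc m"], rule nat_mult_strict_mono) simp_all
  show ?case
  proof (cases b rule: omega1_cases)
    case zero
    then show ?thesis using less.prems by simp
  next
    case b: (succ c)
    then have "a < c \<or> a = c" using less.prems by (simp add: less_osucc_iff le_less)
    then show ?thesis
    proof
      assume "a < c"
      then have "nat_mult n (omega_pow a) < omega_pow c" using less.IH[of c] b by simp
      also have "\<dots> < omega_pow b" using succ[of 1 c] b by simp
      finally show ?thesis .
    next
      assume "a = c"
      then show ?thesis using succ b by simp
    qed
  next
    case limit
    then have "osucc a < b" using less.prems by (rule is_limitD)
    then show ?thesis unfolding less_omega_pow_limit_iff[OF limit] using succ[of n a] by blast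
  qed
qed

lemma omega_pow_strict_mono: "a < b \<Longrightarrow> omega_pow a < omega_pow b"
  using nat_mult_omega_pow_less[of a b 1] by simp

lemma omega_pow_less_iff [simp]: "omega_pow a < omega_pow b \<longleftrightarrow> a < b"
  by (metis less_asym neqE omega_pow_strict_mono)

lemma omega_pow_le_iff [simp]: "omega_pow a \<le> omega_pow b \<longleftrightarrow> a \<le> b"
  by (simp flip: not_less)

lemma omega_pow_eq_iff [simp]: "omega_pow a = omega_pow b \<longleftrightarrow> a = b"
  by (simp add: order_eq_iff)

lemma le_omega_pow: "a \<le> omega_pow a"
proof (induction a rule: less_induct)
  case (less a)
  show ?case
  proof (rule ccontr)
    assume "\<not> a \<le> omega_pow a"
    then have "omega_pow a < a" by simp
    then show False using less omega_pow_less_iff[of "omega_pow a" a] by force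
  qed
qed

text \<open>The least exponent whose power exceeds \<open>x\<close> is a successor: it is not 0
  because \<open>x\<close> is nonzero, and not a limit by continuity. Its predecessor is the leading
  exponent of \<open>x\<close>.\<close>

lemma omega_pow_bracket:
  assumes "x \<noteq> 0"
  obtains a where "omega_pow a \<le> x" "x < omega_pow (osucc a)"
proof -
  define b where "b = (LEAST b. x < omega_pow b)"
  have "x < omega_pow (osucc x)"
    using le_omega_pow[of x] omega_pow_strict_mono[OF less_osucc[of x]] by (rule le_less_trans)
  then have b: "x < omega_pow b" unfolding b_def by (rule LeastI)
  have min: "omega_pow c \<le> x" if "c < b" for c
    using not_less_Least[of c "\<lambda>b. x < omega_pow b"] that by (simp add: b_def not_less)
  show ?thesis
  proof (cases b rule: omega1_cases)
    case zero
    then have "x < osucc 0" using b by (simp add: omega_pow_zero one_omega1_def)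
    then show ?thesis using assms by (simp add: less_osucc_iff antisym)
  next
    case (succ a)
    then show ?thesis using that[of a] b min[of a] by simp
  next
    case limit
    then show ?thesis using b min less_omega_pow_limit_iff by (meson not_less)
  qed
qed

section \<open>Existence and uniqueness of Cantor normal forms\<close>

text \<open>Cantor normal forms are given by the nonincreasing list of their exponents, without
  coefficients.\<close>

abbreviation cnf_val :: "omega1 list \<Rightarrow> omega1"
  where "cnf_val es \<equiv> sum_list (map omega_pow es)"

lemma cnf_val_le_nat_mult: "\<forall>e\<in>set es. e \<le> a \<Longrightarrow> cnf_val es \<le> nat_mult (length es) (omega_pow a)"
  by (induction es) (simp_all add: add_mono_omega1)

text \<open>Replacing every exponent by the first, which is the largest, turns the sum into a finite
  multiple of one power with exponent below \<open>a\<close>.\<close>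

lemma cnf_val_less:
  assumes "sorted_wrt (\<ge>) es" "\<forall>e\<in>set es. e < a"
  shows "cnf_val es < omega_pow a"
proof (cases es)
  case Nil
  then show ?thesis using omega_pow_pos by simp
next
  case (Cons e fs)
  have "cnf_val es \<le> nat_mult (length es) (omega_pow e)"
    using assms Cons by (intro cnf_val_le_nat_mult) auto
  also have "\<dots> < omega_pow a" using assms Cons by (intro nat_mult_omega_pow_less) auto
  finally show ?thesis .
qed

text \<open>The value lies between the power of the first exponent and the power of its successor,
  so it determines the first exponent; left cancellation then leaves the shorter lists.\<close>

lemma cnf_val_inject:
  assumes "sorted_wrt (\<ge>) es" "sorted_wrt (\<ge>) fs" "cnf_val es = cnf_val fs"
  shows "es = fs"
  using assms
proof (induction es arbitrary: fs)
  case Nil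
  then show ?case
    by (cases fs) (auto, metis le_add_left_omega1 not_le omega_pow_pos)
next
  case (Cons e es)
  have hd_le: "x \<le> y" if "sorted_wrt (\<ge>) (x # xs)" "sorted_wrt (\<ge>) (y # ys)"
    "cnf_val (x # xs) = cnf_val (y # ys)" for x y :: omega1 and xs ys
  proof -
    have "omega_pow x \<le> cnf_val (x # xs)" by (simp add: le_add_left_omega1)
    also have "\<dots> < omega_pow (osucc y)"
      unfolding that(3) using that(2) by (intro cnf_val_less) (auto simp: less_osucc_iff)
    finally show ?thesis by (simp add: less_osucc_iff)
  qed
  obtain f fs' where fs: "fs = f # fs'"
    using Cons.prems(3) by (cases fs) (auto, metis le_add_left_omega1 not_le omega_pow_pos)
  have "e = f" using hd_le[of e es f fs'] hd_le[of f fs' e es] Cons.prems fs by auto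
  then show ?case using Cons.IH[of fs'] Cons.prems fs by (simp add: add_left_cancel_omega1)
qed

lemma cnf_exists:
  obtains es where "sorted_wrt (\<ge>) es" "x = cnf_val es"
proof -
  have "\<exists>es. sorted_wrt (\<ge>) es \<and> x = cnf_val es"
  proof (induction x rule: less_induct)
    case (less x)
    show ?case
    proof (cases "x = 0")
      case True
      then show ?thesis by (intro exI[of _ "[]"]) simp
    next
      case False
      then obtain a where a: "omega_pow a \<le> x" "x < omega_pow (osucc a)"
        by (rule omega_pow_bracket)
      obtain y where y: "x = omega_pow a + y" using a(1) by (rule le_imp_add_omega1)
      \<comment> \<open>If the remainder were \<open>x\<close> again, \<open>x\<close> would absorb
        \<open>omega_pow a\<close> from the left, hence bound all its finite multiples and reach the
        next power.\<close>
      have "y \<noteq> x"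
      proof
        assume "y = x"
        then have eq: "omega_pow a + x = x" using y by simp
        have "nat_mult n (omega_pow a) \<le> x" for n
        proof (induction n)
          case (Suc n)
          then show ?case using add_left_mono_omega1[OF Suc, of "omega_pow a"] by (simp add: eq)
        qed simp
        then show False using a(2) less_omega_pow_osucc_iff[of x a] not_less by blast
      qed
      then have "y < x" using y le_add_right_omega1 by (simp add: less_le)
      then obtain es where es: "sorted_wrt (\<ge>) es" "y = cnf_val es" using less by blast
      have "e \<le> a" if "e \<in> set es" for e
      proof -
        have "omega_pow e \<le> y"
          using that unfolding es(2)
          by (induction es)
            (force intro: le_add_left_omega1 order_trans[OF _ le_add_right_omega1])+
        also have "\<dots> < omega_pow (osucc a)" using \<open>y < x\<close> a(2) by simp
        finally show ?thesis by (simp add: less_osucc_iff)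
      qed
      then show ?thesis using es y by (intro exI[of _ "a # es"]) simp
    qed
  qed
  then show ?thesis using that by blast
qed

lemma is_limitI:
  assumes "a \<noteq> 0" "\<And>x. x < a \<Longrightarrow> osucc x < a"
  shows "is_limit a"
proof -
  have "a \<noteq> osucc x" for x using assms(2)[of x] less_osucc[of x] by blast
  then show ?thesis using assms(1) by (auto simp: is_limit_def is_succ_def)
qed

text \<open>Every smaller ordinal is bounded by a finite multiple of a smaller power, and taking one
  more summand leaves room for its successor.\<close>

lemma omega_pow_is_limit:
  assumes "a \<noteq> 0"
  shows "is_limit (omega_pow a)"
proof -
  have "osucc x < omega_pow a" if x: "x < omega_pow a" for x
  proof -
    have "x = 0 \<or> (\<exists>c<a. \<exists>n. x < nat_mult n (omega_pow c))"
    proof (cases a rule: omega1_cases)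
      case (succ b)
      then obtain n where "x < nat_mult n (omega_pow b)"
        using x less_omega_pow_osucc_iff[of x b] by auto
      moreover have "b < a" using succ by simp
      ultimately show ?thesis by blast
    next
      case limit
      then obtain b where b: "b < a" "x < omega_pow b" using x less_omega_pow_limit_iff[OF limit] by blast
      then have "x < nat_mult 1 (omega_pow b)" by simp
      then show ?thesis using b(1) by blast
    qed (use assms in simp)
    then obtain c n where c: "c < a" "x \<le> nat_mult n (omega_pow c)"
    proof
      assume "x = 0"
      then show ?thesis using that[of 0 0] assms by (simp add: less_le)
    next
      assume "\<exists>c<a. \<exists>n. x < nat_mult n (omega_pow c)"
      then obtain c n where "c < a" "x < nat_mult n (omega_pow c)" by blast
      then show ?thesis using that[of c n] by simp
    qed
    have "nat_mult n (omega_pow c) < nat_mult (Suc n) (omega_pow c)"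
      by (rule nat_mult_strict_mono) auto
    then have "osucc x \<le> nat_mult (Suc n) (omega_pow c)" using c(2) by (simp only: osucc_le_iff)
    then show ?thesis using nat_mult_omega_pow_less[OF c(1)] le_less_trans by blast
  qed
  then show ?thesis by (intro is_limitI) auto
qed

lemma is_limit_add:
  assumes "is_limit b" shows "is_limit (a + b)"
proof -
  have "osucc x < a + b" if "x < a + b" for x
  proof -
    have "0 < b" using assms by (auto simp: is_limit_def less_le)
    then have "\<exists>c<b. x \<le> a + c"
      using that less_add_omega1_iff[of x a b] by (metis add_zero_omega1 less_imp_le)
    then obtain c where "c < b" "x \<le> a + c" by blast
    then have "osucc x \<le> a + osucc c"
      by (simp add: add_osucc osucc_le_iff less_osucc_iff)
    moreover have "a + osucc c < a + b"
      using is_limitD[OF assms \<open>c < b\<close>] by (rule add_left_strict_mono_omega1)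
    ultimately show ?thesis by simp
  qed
  moreover have "a + b \<noteq> 0"
  proof
    assume "a + b = 0"
    then have "b \<le> 0" using le_add_right_omega1[of b a] by simp
    then show False using assms by (simp add: is_limit_def antisym)
  qed
  ultimately show ?thesis by (intro is_limitI) auto
qed

section \<open>The recursion of the Schreier families\<close>

lemma is_block_singleton: "n \<ge> 1 \<Longrightarrow> is_block {n}"
  by (simp add: is_block_def)

lemma block_less_iff: "s \<lless> t \<longleftrightarrow> is_block s \<and> is_block t \<and> (\<forall>x\<in>s. \<forall>y\<in>t. x < y)"
proof
  assume *: "s \<lless> t"
  then have fin: "finite s" "s \<noteq> {}" "finite t" "t \<noteq> {}" "Max s < Min t"
    by (auto simp: block_less_def is_block_def)
  have "x < y" if "x \<in> s" "y \<in> t" for x y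
  proof -
    have "x \<le> Max s" "Min t \<le> y" using that fin by auto
    then show ?thesis using fin(5) by simp
  qed
  then show "is_block s \<and> is_block t \<and> (\<forall>x\<in>s. \<forall>y\<in>t. x < y)"
    using * by (auto simp: block_less_def)
next
  assume *: "is_block s \<and> is_block t \<and> (\<forall>x\<in>s. \<forall>y\<in>t. x < y)"
  then have "Max s \<in> s" "Min t \<in> t" by (auto simp: is_block_def)
  then show "s \<lless> t" using * by (auto simp: block_less_def)
qed

lemma block_less_trans: "s \<lless> t \<Longrightarrow> t \<lless> u \<Longrightarrow> s \<lless> u"
  unfolding block_less_iff is_block_def by (meson ex_in_conv less_trans)

lemma sum_list_last_limit:
  assumes "cs \<noteq> []" "\<forall>(a, p)\<in>set cs. a > 0 \<and> p \<ge> (1::nat)"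
  shows "is_limit (sum_list (map (\<lambda>(a, p). nat_mult p (omega_pow a)) cs))"
proof -
  obtain ds a p where cs: "cs = ds @ [(a, p)]"
    using assms(1) by (metis append_butlast_last_id surj_pair)
  then obtain q where q: "p = Suc q" "a \<noteq> 0" using assms(2) by (cases p) auto
  have "is_limit (nat_mult p (omega_pow a))"
    unfolding q(1) nat_mult_Suc_right using is_limit_add[OF omega_pow_is_limit[OF q(2)]] .
  then show ?thesis using is_limit_add by (simp add: cs)
qed

text \<open>Repeating exponents instead of counting them merges the two levels of unions in the
  clause \<open>cantor\<close>, over the exponents and over the coefficient of each, into
  one.\<close>

primrec expand_cnf :: "(omega1 \<times> nat) list \<Rightarrow> omega1 list" where
  "expand_cnf [] = []"
| "expand_cnf (c # cs) = replicate (snd c) (fst c) @ expand_cnf cs"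

lemma cnf_val_replicate: "cnf_val (replicate p a) = nat_mult p (omega_pow a)"
  by (induction p) simp_all

lemma cnf_val_expand:
  "cnf_val (expand_cnf cs) = sum_list (map (\<lambda>(a, p). nat_mult p (omega_pow a)) cs)"
  by (induction cs) (simp_all add: cnf_val_replicate case_prod_beta del: map_replicate)

lemma set_expand_cnf: "set (expand_cnf cs) \<subseteq> fst ` set cs"
  by (induction cs) auto

lemma sorted_expand_cnf: "sorted_wrt (>) (map fst cs) \<Longrightarrow> sorted_wrt (\<ge>) (expand_cnf cs)"
proof (induction cs)
  case (Cons c cs)
  have "sorted_wrt (\<ge>) (replicate n a)" for n and a :: omega1 by (induction n) auto
  then show ?case using Cons set_expand_cnf[of cs]
    by (auto simp: sorted_wrt_append dest!: subsetD intro: less_imp_le)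
qed simp

lemma expand_cnf_exists:
  assumes "sorted_wrt (\<ge>) es"
  obtains cs where "es = expand_cnf cs" "sorted_wrt (>) (map fst cs)" "\<forall>(a, p)\<in>set cs. p \<ge> 1"
    "fst ` set cs = set es"
proof -
  have "\<exists>cs. es = expand_cnf cs \<and> sorted_wrt (>) (map fst cs) \<and> (\<forall>(a, p)\<in>set cs. p \<ge> 1)
    \<and> fst ` set cs = set es"
    using assms
  proof (induction es)
    case Nil
    show ?case by (intro exI[of _ "[]"]) simp
  next
    case (Cons e es)
    then obtain cs where cs: "es = expand_cnf cs" "sorted_wrt (>) (map fst cs)"
      "\<forall>(a, p)\<in>set cs. p \<ge> 1" "fst ` set cs = set es" by auto
    show ?case
    proof (cases "e \<in> set es")
      case True
      obtain a p ds where ds: "cs = (a, p) # ds" using True cs(4) by (cases cs) auto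
      then have "a \<in> set es" using cs(4) by auto
      then have "a \<le> e" using Cons.prems by simp
      moreover have "e \<le> a" using True cs(2) unfolding cs(4)[symmetric] ds by (auto simp: less_imp_le)
      ultimately have "a = e" by simp
      then show ?thesis using cs unfolding ds
        by (intro exI[of _ "(e, Suc p) # ds"]) auto
    next
      case False
      have "x < e" if "x \<in> set es" for x
        using Cons.prems False that by (auto simp: less_le)
      then show ?thesis using cs
        by (intro exI[of _ "(e, 1) # cs"]) (auto simp flip: cs(4))
    qed
  qed
  then show ?thesis using that by blast
qed

text \<open>Exponents are listed in increasing order here, so that the first part of the set belongs to
  the head of the list.\<close>

primrec cnf_split :: "(omega1 \<Rightarrow> nat \<Rightarrow> omega1) \<Rightarrow> omega1 list \<Rightarrow> nat set \<Rightarrow> bool" where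
  "cnf_split L [] s \<longleftrightarrow> s = {}"
| "cnf_split L (e # es) s \<longleftrightarrow> (\<exists>t u. s = t \<union> u \<and> in_schreier L (omega_pow e) t \<and>
     cnf_split L es u \<and> (\<forall>x\<in>t. \<forall>y\<in>u. x < y))"

lemma cnf_split_ConsI:
  "in_schreier L (omega_pow e) t \<Longrightarrow> cnf_split L es u \<Longrightarrow> \<forall>x\<in>t. \<forall>y\<in>u. x < y \<Longrightarrow>
    cnf_split L (e # es) (t \<union> u)"
  by auto

lemma cnf_split_append:
  "cnf_split L (es @ fs) s \<longleftrightarrow>
    (\<exists>t u. s = t \<union> u \<and> cnf_split L es t \<and> cnf_split L fs u \<and> (\<forall>x\<in>t. \<forall>y\<in>u. x < y))"
proof (induction es arbitrary: s)
  case (Cons e es)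
  show ?case
  proof
    assume "cnf_split L ((e # es) @ fs) s"
    then obtain t u v w where "s = t \<union> u" "in_schreier L (omega_pow e) t" "\<forall>x\<in>t. \<forall>y\<in>u. x < y"
      "u = v \<union> w" "cnf_split L es v" "cnf_split L fs w" "\<forall>x\<in>v. \<forall>y\<in>w. x < y"
      using Cons.IH by auto
    then show "\<exists>t u. s = t \<union> u \<and> cnf_split L (e # es) t \<and> cnf_split L fs u \<and> (\<forall>x\<in>t. \<forall>y\<in>u. x < y)"
      by (intro exI[of _ "t \<union> v"] exI[of _ w]) auto
  next
    assume "\<exists>t u. s = t \<union> u \<and> cnf_split L (e # es) t \<and> cnf_split L fs u \<and> (\<forall>x\<in>t. \<forall>y\<in>u. x < y)"
    then obtain t u v w where *: "s = t \<union> u" "t = v \<union> w" "in_schreier L (omega_pow e) v"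
      "cnf_split L es w" "\<forall>x\<in>v. \<forall>y\<in>w. x < y" "cnf_split L fs u" "\<forall>x\<in>t. \<forall>y\<in>u. x < y"
      by auto
    then have "cnf_split L (es @ fs) (w \<union> u)"
      unfolding Cons.IH by (intro exI[of _ w] exI[of _ u]) auto
    then show "cnf_split L ((e # es) @ fs) s"
      using * cnf_split_ConsI[of L e v "es @ fs" "w \<union> u"] by (simp add: Un_assoc ball_Un)
  qed
qed auto

lemma in_schreier_block_or_zero:
  assumes "in_schreier L a s"
  shows "(a = 0 \<and> s = {}) \<or> (a \<noteq> 0 \<and> is_block s)"
  using assms
proof (induction rule: in_schreier.induct)
  case (succ z s n)
  then show ?case by (auto simp: is_block_def add_one_omega1)
next
  case (omega_pow_succ ss b)
  then have "\<forall>s\<in>set ss. is_block s" by (auto simp: list_all_iff)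
  then show ?case using omega_pow_succ(1) by (auto simp: is_block_def neq_Nil_conv)
next
  case (cantor cs bs)
  have "is_block s" if s: "s \<in> set bs" for s
  proof -
    obtain i where i: "i < length bs" "s = bs ! i" using s by (auto simp: in_set_conv_nth)
    then have "cs ! i \<in> set cs" using list_all2_lengthD[OF cantor(6)] by simp
    then obtain c ss where c: "c \<in> set cs" "length ss = snd c" "block_seq ss" "s = \<Union>(set ss)"
      using list_all2_nthD2[OF cantor(6) i(1)] i(2) by blast
    then have "ss \<noteq> []" using cantor(3) by fastforce
    then show ?thesis using c by (auto simp: block_seq_def list_all_iff is_block_def neq_Nil_conv)
  qed
  moreover have "bs \<noteq> []" using cantor(1,6) by auto
  moreover have "is_limit (sum_list (map (\<lambda>(a, p). nat_mult p (omega_pow a)) cs))"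
    using cantor by (intro sum_list_last_limit) auto
  then have "sum_list (map (\<lambda>(a, p). nat_mult p (omega_pow a)) cs) \<noteq> 0" by auto
  ultimately show ?case by (auto simp: is_block_def neq_Nil_conv)
qed simp_all

lemma in_schreier_omega_pow_block: "in_schreier L (omega_pow e) s \<Longrightarrow> is_block s"
  using in_schreier_block_or_zero by fastforce

lemma cnf_split_block: "cnf_split L es s \<Longrightarrow> finite s \<and> s \<subseteq> {1..} \<and> (es \<noteq> [] \<longrightarrow> s \<noteq> {})"
  by (induction es arbitrary: s) (fastforce simp: is_block_def dest: in_schreier_omega_pow_block)+

lemma cnf_split_replicate:
  "cnf_split L (replicate p a) s \<longleftrightarrow>
    (\<exists>ss. length ss = p \<and> block_seq ss \<and> list_all (in_schreier L (omega_pow a)) ss \<and> s = \<Union>(set ss))"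
proof (induction p arbitrary: s)
  case 0
  show ?case by (auto simp: block_seq_def)
next
  case (Suc p)
  show ?case
  proof
    assume "cnf_split L (replicate (Suc p) a) s"
    then obtain t ss where *: "s = t \<union> \<Union>(set ss)" "in_schreier L (omega_pow a) t"
      "length ss = p" "block_seq ss" "list_all (in_schreier L (omega_pow a)) ss"
      "\<forall>x\<in>t. \<forall>y\<in>\<Union>(set ss). x < y"
      using Suc by auto
    then have "block_seq (t # ss)" using in_schreier_omega_pow_block[OF *(2)]
      by (auto simp: block_seq_def block_less_iff list_all_iff)
    then show "\<exists>ss. length ss = Suc p \<and> block_seq ss \<and> list_all (in_schreier L (omega_pow a)) ss
        \<and> s = \<Union>(set ss)"
      using * by (intro exI[of _ "t # ss"]) simp
  next
    assume "\<exists>ss. length ss = Suc p \<and> block_seq ss \<and> list_all (in_schreier L (omega_pow a)) ss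
        \<and> s = \<Union>(set ss)"
    then obtain t ss where *: "length ss = p" "block_seq (t # ss)"
      "list_all (in_schreier L (omega_pow a)) (t # ss)" "s = \<Union>(set (t # ss))"
      by (auto simp: length_Suc_conv)
    then have "cnf_split L (replicate p a) (\<Union>(set ss))" using Suc
      by (auto simp: block_seq_def)
    moreover have "\<forall>x\<in>t. \<forall>y\<in>\<Union>(set ss). x < y"
      using *(2) by (auto simp: block_seq_def block_less_iff)
    ultimately show "cnf_split L (replicate (Suc p) a) s"
      using *(3,4) cnf_split_ConsI[of L a t "replicate p a" "\<Union>(set ss)"] by simp
  qed
qed

text \<open>The parts \<open>bs\<close> start with the leading exponent and decrease as blocks,
  hence the reversal. Coefficients are positive, so every part is a nonempty block, and elementwise
  comparison of the parts is the same as \<open>\<lless>\<close>.\<close>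

lemma cantor_parts_iff_cnf_split:
  assumes "\<forall>(a, p)\<in>set cs. p \<ge> 1"
  shows "(\<exists>bs. sorted_wrt (\<lambda>s t. t \<lless> s) bs \<and>
      list_all2 (\<lambda>c s. \<exists>ss. length ss = snd c \<and> block_seq ss \<and>
             list_all (in_schreier L (omega_pow (fst c))) ss \<and> s = \<Union>(set ss)) cs bs
      \<and> s = \<Union>(set bs)) \<longleftrightarrow> cnf_split L (rev (expand_cnf cs)) s"
  using assms unfolding cnf_split_replicate[symmetric]
proof (induction cs arbitrary: s)
  case (Cons c cs)
  let ?P = "\<lambda>c. cnf_split L (replicate (snd c) (fst c))"
  note IH = Cons.IH[unfolded list.set(2)]
  have blk: "is_block t" if "?P d t" "d \<in> set (c # cs)" for d t
  proof -
    have "replicate (snd d) (fst d) \<noteq> []" using that(2) Cons.prems by (cases "snd d") force+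
    then show ?thesis using cnf_split_block[OF that(1)] by (simp add: is_block_def)
  qed
  show ?case
  proof
    assume "\<exists>bs. sorted_wrt (\<lambda>s t. t \<lless> s) bs \<and> list_all2 ?P (c # cs) bs \<and> s = \<Union>(set bs)"
    then obtain b bs where b: "sorted_wrt (\<lambda>s t. t \<lless> s) (b # bs)" "list_all2 ?P (c # cs) (b # bs)"
      "s = b \<union> \<Union>(set bs)" by (auto simp: list_all2_Cons1)
    then have "cnf_split L (rev (expand_cnf cs)) (\<Union>(set bs))" using IH Cons.prems by auto
    moreover have "\<forall>x\<in>\<Union>(set bs). \<forall>y\<in>b. x < y" using b(1) by (auto simp: block_less_iff)
    ultimately show "cnf_split L (rev (expand_cnf (c # cs))) s"
      unfolding expand_cnf.simps rev_append rev_replicate cnf_split_append using b(2,3)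
      by (intro exI[of _ "\<Union>(set bs)"] exI[of _ b]) auto
  next
    assume "cnf_split L (rev (expand_cnf (c # cs))) s"
    then obtain t b where tb: "s = t \<union> b" "cnf_split L (rev (expand_cnf cs)) t" "?P c b"
      "\<forall>x\<in>t. \<forall>y\<in>b. x < y" by (auto simp: cnf_split_append)
    then obtain bs where bs: "sorted_wrt (\<lambda>s t. t \<lless> s) bs" "list_all2 ?P cs bs" "t = \<Union>(set bs)"

      using IH[of t] Cons.prems by (metis (no_types, lifting) list.set_intros(2))
    have "is_block d" if d: "d \<in> set bs" for d
    proof -
      obtain i where i: "i < length bs" "d = bs ! i" using d by (auto simp: in_set_conv_nth)
      then have "cs ! i \<in> set (c # cs)" using list_all2_lengthD[OF bs(2)] by simp
      then show ?thesis using list_all2_nthD2[OF bs(2) i(1)] i(2) blk by blast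
    qed
    moreover have "is_block b" using blk tb(3) by simp
    ultimately have "sorted_wrt (\<lambda>s t. t \<lless> s) (b # bs)"
      using bs(1,3) tb(4) by (auto simp: block_less_iff)
    then show "\<exists>bs. sorted_wrt (\<lambda>s t. t \<lless> s) bs \<and> list_all2 ?P (c # cs) bs \<and> s = \<Union>(set bs)"
      using bs tb by (intro exI[of _ "b # bs"]) auto
  qed
qed auto

section \<open>Inversion of the clauses for each kind of ordinal\<close>

lemma osucc_neq_omega_pow: "a \<noteq> 0 \<Longrightarrow> osucc z \<noteq> omega_pow a"
  using omega_pow_is_limit[of a] by (metis is_limit_simps(2))

text \<open>All clauses other than \<open>zero\<close> and \<open>succ\<close> yield limit ordinals:
  the powers there have exponents \<open>b + 1\<close> or a limit, never 0, and the last exponent in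
  \<open>cantor\<close> is positive.\<close>

lemma in_schreier_osucc_iff:
  "in_schreier L (osucc z) s \<longleftrightarrow>
    (\<exists>n t. s = insert n t \<and> n \<ge> 1 \<and> in_schreier L z t \<and> (\<forall>y\<in>t. n < y))"
proof
  assume "in_schreier L (osucc z) s"
  then show "\<exists>n t. s = insert n t \<and> n \<ge> 1 \<and> in_schreier L z t \<and> (\<forall>y\<in>t. n < y)"
  proof (cases rule: in_schreier.cases)
    case (succ y t n)
    then show ?thesis
      by (intro exI[of _ n] exI[of _ t]) (auto simp: add_one_omega1 block_less_iff)
  next
    case (omega_pow_succ ss b)
    then show ?thesis using osucc_neq_omega_pow[of "b + 1" z] by (simp add: add_one_omega1)
  next
    case (omega_pow_limit l)
    then show ?thesis using osucc_neq_omega_pow[of l z] by (auto simp: is_limit_def)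
  next
    case (cantor cs bs)
    have "is_limit (osucc z)" unfolding cantor(1) by (rule sum_list_last_limit[OF cantor(3,5)])
    then show ?thesis by simp
  qed simp
next
  assume "\<exists>n t. s = insert n t \<and> n \<ge> 1 \<and> in_schreier L z t \<and> (\<forall>y\<in>t. n < y)"
  then obtain n t where t: "s = insert n t" "n \<ge> 1" "in_schreier L z t" "\<forall>y\<in>t. n < y" by blast
  have "t = {} \<or> {n} \<lless> t"
    using in_schreier_block_or_zero[OF t(3)] t(2,4) by (auto simp: block_less_iff is_block_singleton)
  then show "in_schreier L (osucc z) s"
    using in_schreier.succ[OF t(3,2)] t(1) by (simp add: add_one_omega1)
qed

lemma in_schreier_zero_iff: "in_schreier L 0 s \<longleftrightarrow> s = {}"
  using in_schreier_block_or_zero[of L 0 s] in_schreier.zero by auto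

lemma in_schreier_one_iff: "in_schreier L (omega_pow 0) s \<longleftrightarrow> (\<exists>n\<ge>1. s = {n})"
  by (auto simp: omega_pow_zero one_omega1_def in_schreier_osucc_iff in_schreier_zero_iff)

text \<open>By uniqueness a power would have the one-element expansion \<open>[b]\<close>, which
  leaves only the list of pairs that the clause \<open>cantor\<close> excludes.\<close>

lemma cantor_neq_omega_pow:
  assumes "cs \<noteq> []" "sorted_wrt (>) (map fst cs)" "\<forall>(a, p)\<in>set cs. a > 0 \<and> p \<ge> 1"
    "\<nexists>a. cs = [(a, 1)]"
  shows "sum_list (map (\<lambda>(a, p). nat_mult p (omega_pow a)) cs) \<noteq> omega_pow b"
proof
  assume *: "sum_list (map (\<lambda>(a, p). nat_mult p (omega_pow a)) cs) = omega_pow b"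
  have "cnf_val (expand_cnf cs) = cnf_val [b]"
    unfolding cnf_val_expand * by simp
  then have eq: "expand_cnf cs = [b]"
    using sorted_expand_cnf[OF assms(2)] by (intro cnf_val_inject) auto
  obtain a p ds where cs: "cs = (a, p) # ds" using assms(1) by (cases cs) auto
  then obtain q where q: "p = Suc q" using assms(3) by (cases p) auto
  have "q = 0" "expand_cnf ds = []" using eq cs q by auto
  moreover have "ds = []"
    using \<open>expand_cnf ds = []\<close> assms(3) cs by (cases ds) auto
  ultimately show False using assms(4) cs q by simp
qed

text \<open>Serves to express the length condition of \<open>omega_pow_succ\<close>, which refers to
  the first block, through the union alone.\<close>

lemma Min_block_seq:
  assumes "block_seq (t # ts)"
  shows "\<Union>(set (t # ts)) \<noteq> {}" "Min (\<Union>(set (t # ts))) = Min t"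
proof -
  have t: "finite t" "t \<noteq> {}" "\<And>u. u \<in> set ts \<Longrightarrow> finite u"
    and less: "\<And>u x y. u \<in> set ts \<Longrightarrow> x \<in> t \<Longrightarrow> y \<in> u \<Longrightarrow> x < y"
    using assms by (auto simp: block_seq_def list_all_iff is_block_def block_less_iff)
  then have "Min t \<in> t" by simp
  then show "\<Union>(set (t # ts)) \<noteq> {}" by auto
  show "Min (\<Union>(set (t # ts))) = Min t"
  proof (rule Min_eqI)
    show "Min t \<le> x" if "x \<in> \<Union>(set (t # ts))" for x
      using that t(1) less[OF _ \<open>Min t \<in> t\<close>] by (auto simp: less_imp_le)
  qed (use t \<open>Min t \<in> t\<close> in auto)
qed

lemma in_schreier_omega_pow_osucc_iff:
  "in_schreier L (omega_pow (osucc b)) s \<longleftrightarrow> s \<noteq> {} \<and> cnf_split L (replicate (Min s) b) s"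
proof
  assume "in_schreier L (omega_pow (osucc b)) s"
  then show "s \<noteq> {} \<and> cnf_split L (replicate (Min s) b) s"
  proof (cases rule: in_schreier.cases)
    case zero
    then show ?thesis by simp
  next
    case (succ z t n)
    then show ?thesis using osucc_neq_omega_pow[of "osucc b" z] by (simp add: add_one_omega1)
  next
    case (omega_pow_succ ss c)
    then have "c = b" by (simp add: add_one_omega1)
    obtain t ts where ss: "ss = t # ts" using omega_pow_succ(3) by (cases ss) auto
    have "cnf_split L (replicate (length ss) c) s"
      unfolding cnf_split_replicate using omega_pow_succ by blast
    moreover have "s \<noteq> {}" "Min s = Min t"
      using Min_block_seq[of t ts] omega_pow_succ(2,5) ss by simp_all
    moreover have "length ss = Min t" using omega_pow_succ(6) ss by simp
    ultimately show ?thesis using \<open>c = b\<close> by simp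
  next
    case (omega_pow_limit l)
    then show ?thesis by (metis is_limit_simps(2) omega_pow_eq_iff)
  next
    case (cantor cs bs)
    show ?thesis using cantor_neq_omega_pow[OF cantor(3-6), of "osucc b"] cantor(1) by simp
  qed
next
  assume *: "s \<noteq> {} \<and> cnf_split L (replicate (Min s) b) s"
  then obtain ss where ss: "length ss = Min s" "block_seq ss"
    "list_all (in_schreier L (omega_pow b)) ss" "s = \<Union>(set ss)"
    by (auto simp: cnf_split_replicate)
  then obtain t ts where ts: "ss = t # ts" using * by (cases ss) auto
  have "Min s = Min t" using Min_block_seq[of t ts] ss ts by simp
  then show "in_schreier L (omega_pow (osucc b)) s"
    using in_schreier.omega_pow_succ[of ss L b] ss ts by (simp add: add_one_omega1)
qed

lemma in_schreier_omega_pow_limit_iff: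
  assumes "is_limit l"
  shows "in_schreier L (omega_pow l) s \<longleftrightarrow> s \<noteq> {} \<and> in_schreier L (omega_pow (L l (Min s))) s"
proof
  assume "in_schreier L (omega_pow l) s"
  then show "s \<noteq> {} \<and> in_schreier L (omega_pow (L l (Min s))) s"
  proof (cases rule: in_schreier.cases)
    case zero
    then show ?thesis by simp
  next
    case (succ z t n)
    then show ?thesis using osucc_neq_omega_pow[of l z] assms
      by (auto simp: add_one_omega1 is_limit_def)
  next
    case (omega_pow_succ ss c)
    then show ?thesis using assms by (auto simp: add_one_omega1)
  next
    case (omega_pow_limit l)
    then show ?thesis by simp
  next
    case (cantor cs bs)
    show ?thesis using cantor_neq_omega_pow[OF cantor(3-6), of l] cantor(1) by simp
  qed
qed (use assms in_schreier.omega_pow_limit in blast)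

text \<open>The smallest exponent decides which clause applies. If it is 0, the ordinal is a
  successor, and the point split off by \<open>succ\<close> is the part belonging to
  \<open>omega_pow 0\<close>. Otherwise all exponents are positive: a single power needs no
  splitting, and in the remaining case only \<open>cantor\<close> applies, where uniqueness
  identifies the list found by inversion with the given one.\<close>

lemma in_schreier_cnf_val_iff:
  assumes "sorted_wrt (\<ge>) es"
  shows "in_schreier L (cnf_val es) s \<longleftrightarrow> cnf_split L (rev es) s"
  using assms
proof (induction es arbitrary: s rule: rev_induct)
  case Nil
  show ?case by (simp add: in_schreier_zero_iff)
next
  case (snoc e es)
  show ?case
  proof (cases "e = 0")
    case True
    have "cnf_val (es @ [e]) = osucc (cnf_val es)"
      using True by (simp add: omega_pow_zero add_one_omega1)
    then have "in_schreier L (cnf_val (es @ [e])) s \<longleftrightarrow>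
        (\<exists>n t. s = insert n t \<and> n \<ge> 1 \<and> cnf_split L (rev es) t \<and> (\<forall>y\<in>t. n < y))"
      using snoc by (simp add: in_schreier_osucc_iff sorted_wrt_append)
    also have "\<dots> \<longleftrightarrow> cnf_split L (rev (es @ [e])) s"
      using True by (auto simp: in_schreier_one_iff)
    finally show ?thesis .
  next
    case False
    then have "0 < e" by (simp add: less_le)
    then have pos: "\<forall>x\<in>set (es @ [e]). 0 < x"
      using snoc.prems by (auto simp: sorted_wrt_append intro: less_le_trans)
    obtain cs where cs: "es @ [e] = expand_cnf cs" "sorted_wrt (>) (map fst cs)"
      "\<forall>(a, p)\<in>set cs. p \<ge> 1" "fst ` set cs = set (es @ [e])"
      using snoc.prems by (rule expand_cnf_exists)
    have "\<forall>a\<in>fst ` set cs. 0 < a" unfolding cs(4) by (rule pos)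
    then have cs': "cs \<noteq> []" "\<forall>(a, p)\<in>set cs. a > 0 \<and> p \<ge> 1"
      using cs(1,3) by force+
    have val: "cnf_val (es @ [e]) = sum_list (map (\<lambda>(a, p). nat_mult p (omega_pow a)) cs)"
      unfolding cs(1) by (rule cnf_val_expand)
    show ?thesis
    proof (cases "\<exists>a. cs = [(a, 1)]")
      case True
      then have "es = []" using cs(1) by auto
      then show ?thesis by simp
    next
      case nsingle: False
      let ?parts = "\<lambda>cs bs. sorted_wrt (\<lambda>s t. t \<lless> s) bs \<and>
        list_all2 (\<lambda>c s. \<exists>ss. length ss = snd c \<and> block_seq ss \<and>
          list_all (in_schreier L (omega_pow (fst c))) ss \<and> s = \<Union>(set ss)) cs bs"
      have neq: "cnf_val (es @ [e]) \<noteq> omega_pow b" for b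
        unfolding val using cantor_neq_omega_pow[OF cs'(1) cs(2) cs'(2) nsingle] .
      have lim: "is_limit (cnf_val (es @ [e]))"
        unfolding val using cs' by (rule sum_list_last_limit)
      have "in_schreier L (cnf_val (es @ [e])) s \<longleftrightarrow> (\<exists>bs. ?parts cs bs \<and> s = \<Union>(set bs))"
      proof
        assume "in_schreier L (cnf_val (es @ [e])) s"
        then show "\<exists>bs. ?parts cs bs \<and> s = \<Union>(set bs)"
        proof (cases rule: in_schreier.cases)
          case zero
          then show ?thesis using lim by (metis is_limit_simps(1))
        next
          case (succ z t n)
          then show ?thesis using lim by (metis is_limit_simps(2) add_one_omega1)
        next
          case (omega_pow_succ ss b)
          then show ?thesis using neq by metis
        next
          case (omega_pow_limit l)
          then show ?thesis using neq by metis
        next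
          case (cantor ds bs)
          have "cnf_val (expand_cnf ds) = cnf_val (expand_cnf cs)"
            using cantor(1) val cnf_val_expand by metis
          then have eq: "expand_cnf ds = expand_cnf cs"
            using cantor(4) cs(2) by (intro cnf_val_inject sorted_expand_cnf)
          have "\<forall>(a, p)\<in>set ds. p \<ge> 1" using cantor(5) by auto
          note iff = cantor_parts_iff_cnf_split[OF this, of L s] cantor_parts_iff_cnf_split[OF cs(3), of L s]
          have "\<exists>bs. ?parts ds bs \<and> s = \<Union>(set bs)" using cantor by blast
          then show ?thesis using iff unfolding eq by simp
        qed
      next
        assume "\<exists>bs. ?parts cs bs \<and> s = \<Union>(set bs)"
        then show "in_schreier L (cnf_val (es @ [e])) s"
          unfolding val using in_schreier.cantor[OF cs'(1) cs(2) cs'(2) nsingle] by blast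
      qed
      also have "\<dots> \<longleftrightarrow> cnf_split L (rev (es @ [e])) s"
        unfolding cs(1) using cantor_parts_iff_cnf_split[OF cs(3), of L s] by simp
      finally show ?thesis .
    qed
  qed
qed

section \<open>Removing the least element of a set\<close>

lemma limit_approxD:
  assumes "limit_approx L" "is_limit l"
  shows "n \<ge> 1 \<Longrightarrow> is_succ (L l n)" "n \<ge> 1 \<Longrightarrow> L l n < l"
    and "c < l \<Longrightarrow> \<exists>k\<ge>1. \<forall>n\<ge>k. c < L l n"
proof -
  have *: "strict_mono_on {1..} (L l)" "\<forall>n\<ge>1. is_succ (L l n) \<and> L l n < l" "Sup (L l ` {1..}) = l"
    using assms unfolding limit_approx_def by blast+
  show "n \<ge> 1 \<Longrightarrow> is_succ (L l n)" "n \<ge> 1 \<Longrightarrow> L l n < l" using *(2) by blast+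
  assume "c < l"
  then have "c < Sup (L l ` {1..})" using *(3) by simp
  then obtain k where k: "k \<ge> 1" "c < L l k"
    by (subst (asm) less_Sup_omega1_iff) auto
  have "c < L l n" if "n \<ge> k" for n
  proof (cases "n = k")
    case False
    then have "L l k < L l n" using *(1) that k(1) by (auto simp: strict_mono_on_def)
    then show ?thesis using k(2) by simp
  qed (use k in simp)
  then show "\<exists>k\<ge>1. \<forall>n\<ge>k. c < L l n" using k(1) by blast
qed

text \<open>\<open>es\<close> lists the exponents of the ordinal $\eta$ with
  $\mathcal{A}_{\omega^a}(n) = \mathcal{A}_\eta$ above $n$, where $\mathcal{A}(n)$ consists of the sets
  $s > n$ with $\{n\} \cup s \in \mathcal{A}$. The last conjunct makes $\eta$ tend to $\omega^a$
  as $n$ tends to infinity.\<close>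

definition is_cnf_tail :: "(omega1 \<Rightarrow> nat \<Rightarrow> omega1) \<Rightarrow> omega1 \<Rightarrow> nat \<Rightarrow> omega1 list \<Rightarrow> bool" where
  "is_cnf_tail L a n es \<longleftrightarrow> sorted_wrt (\<ge>) es \<and> (\<forall>e\<in>set es. e < a) \<and>
    (\<forall>s. s \<noteq> {} \<longrightarrow> Min s = n \<longrightarrow> in_schreier L (omega_pow a) s =
      (\<exists>t. s = insert n t \<and> (\<forall>y\<in>t. n < y) \<and> cnf_split L (rev es) t)) \<and>
    (\<forall>d. a = osucc d \<or> is_limit a \<and> L a n = osucc d \<longrightarrow>
      nat_mult (n - 1) (omega_pow d) \<le> cnf_val es)"

lemma is_cnf_tailD:
  assumes "is_cnf_tail L a n es"
  shows "sorted_wrt (\<ge>) es" "\<And>e. e \<in> set es \<Longrightarrow> e < a"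
    and "\<And>s. s \<noteq> {} \<Longrightarrow> Min s = n \<Longrightarrow> in_schreier L (omega_pow a) s =
      (\<exists>t. s = insert n t \<and> (\<forall>y\<in>t. n < y) \<and> cnf_split L (rev es) t)"
    and "\<And>d. a = osucc d \<or> is_limit a \<and> L a n = osucc d \<Longrightarrow>
      nat_mult (n - 1) (omega_pow d) \<le> cnf_val es"
proof -
  note * = assms[unfolded is_cnf_tail_def]
  show "sorted_wrt (\<ge>) es" by (rule *[THEN conjunct1])
  show "\<And>e. e \<in> set es \<Longrightarrow> e < a"
    by (rule *[THEN conjunct2, THEN conjunct1, THEN bspec])
  show "\<And>s. s \<noteq> {} \<Longrightarrow> Min s = n \<Longrightarrow> in_schreier L (omega_pow a) s =
      (\<exists>t. s = insert n t \<and> (\<forall>y\<in>t. n < y) \<and> cnf_split L (rev es) t)"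
    by (rule *[THEN conjunct2, THEN conjunct2, THEN conjunct1, THEN spec, THEN mp, THEN mp])
  show "\<And>d. a = osucc d \<or> is_limit a \<and> L a n = osucc d \<Longrightarrow>
      nat_mult (n - 1) (omega_pow d) \<le> cnf_val es"
    by (rule *[THEN conjunct2, THEN conjunct2, THEN conjunct2, THEN spec, THEN mp])
qed

text \<open>For \<open>a = osucc b\<close> a set with minimum \<open>n\<close> consists of
  \<open>n\<close> parts for exponent \<open>b\<close>; without \<open>n\<close>, a tail of the
  first part remains, followed by \<open>n - 1\<close> full parts. For a limit the tail of
  \<open>L a n\<close> is taken over unchanged. Since \<open>L a n\<close> is a successor, the bound
  of the successor case survives, which explains the second alternative in the last
  conjunct.\<close>

lemma is_cnf_tail_exists:
  assumes L: "limit_approx L" and "n \<ge> 1"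
  shows "\<exists>es. is_cnf_tail L a n es"
proof (induction a rule: less_induct)
  case (less a)
  show ?case
  proof (cases a rule: omega1_cases)
    case zero
    show ?thesis
      using assms(2)
      by (intro exI[of _ "[]"]) (auto simp: is_cnf_tail_def zero in_schreier_one_iff)
  next
    case (succ b)
    then have "b < a" by simp
    from less[OF this] obtain es where "is_cnf_tail L b n es" by blast
    note es = is_cnf_tailD[OF this]
    \<comment> \<open>The exponents in \<open>es\<close> lie below \<open>b\<close>, so they come
      last here; after reversal they govern the remainder of the first part, which precedes the full
      parts.\<close>
    let ?fs = "replicate (n - 1) b @ es"
    have sorted: "sorted_wrt (\<ge>) ?fs"
    proof -
      have "sorted_wrt (\<ge>) (replicate m b)" for m by (induction m) auto
      then show ?thesis using es(1) by (auto simp: sorted_wrt_append less_imp_le es(2))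
    qed
    have iff: "in_schreier L (omega_pow a) s \<longleftrightarrow>
        (\<exists>t. s = insert n t \<and> (\<forall>y\<in>t. n < y) \<and> cnf_split L (rev ?fs) t)"
      if s: "s \<noteq> {}" "Min s = n" for s
    proof -
      have repl: "replicate n b = b # replicate (n - 1) b" using assms(2) by (cases n) auto
      have "in_schreier L (omega_pow a) s \<longleftrightarrow> cnf_split L (b # replicate (n - 1) b) s"
        using s repl by (simp add: succ in_schreier_omega_pow_osucc_iff)
      also have "\<dots> \<longleftrightarrow> (\<exists>t u. s = t \<union> u \<and> Min t = n \<and> in_schreier L (omega_pow b) t \<and>
          cnf_split L (replicate (n - 1) b) u \<and> (\<forall>x\<in>t. \<forall>y\<in>u. x < y))" (is "_ \<longleftrightarrow> ?R")
      proof
        assume "cnf_split L (b # replicate (n - 1) b) s"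
        then obtain t u where tu: "s = t \<union> u" "in_schreier L (omega_pow b) t"
          "cnf_split L (replicate (n - 1) b) u" "\<forall>x\<in>t. \<forall>y\<in>u. x < y" by auto
        have t: "finite t" "t \<noteq> {}" "finite u"
          using in_schreier_omega_pow_block[OF tu(2)] cnf_split_block[OF tu(3)] by (auto simp: is_block_def)
        then have "Min t \<in> t" by simp
        have "Min t = Min s"
          unfolding tu(1)
        proof (rule Min_eqI[symmetric])
          show "Min t \<le> y" if "y \<in> t \<union> u" for y
            using that t(1) tu(4) \<open>Min t \<in> t\<close> by (auto simp: less_imp_le simp del: Min_le_iff)
        qed (use t \<open>Min t \<in> t\<close> in auto)
        then show ?R using tu s by blast
      qed auto
      also have "\<dots> \<longleftrightarrow> (\<exists>t u. s = insert n t \<union> u \<and> (\<forall>y\<in>t. n < y) \<and> cnf_split L (rev es) t \<and>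
          cnf_split L (replicate (n - 1) b) u \<and> (\<forall>x\<in>insert n t. \<forall>y\<in>u. x < y))" (is "_ \<longleftrightarrow> ?R'")
      proof
        assume ?R
        then obtain t u where tu: "s = t \<union> u" "Min t = n" "in_schreier L (omega_pow b) t"
          "cnf_split L (replicate (n - 1) b) u" "\<forall>x\<in>t. \<forall>y\<in>u. x < y" by blast
        moreover have "t \<noteq> {}" using in_schreier_omega_pow_block[OF tu(3)] by (simp add: is_block_def)
        ultimately obtain v where "t = insert n v" "\<forall>y\<in>v. n < y" "cnf_split L (rev es) v"
          using es(3)[of t] by auto
        then show ?R' using tu by blast
      next
        assume ?R'
        then obtain t u where tu: "s = insert n t \<union> u" "\<forall>y\<in>t. n < y" "cnf_split L (rev es) t"
          "cnf_split L (replicate (n - 1) b) u" "\<forall>x\<in>insert n t. \<forall>y\<in>u. x < y" by blast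
        have "finite t" using cnf_split_block[OF tu(3)] by simp
        then have "Min (insert n t) = n" using tu(2) by (intro Min_eqI) (auto simp: less_imp_le)
        moreover from this have "in_schreier L (omega_pow b) (insert n t)" using es(3)[of "insert n t"] tu by auto
        ultimately show ?R using tu by blast
      qed
      also have "\<dots> \<longleftrightarrow> (\<exists>v. s = insert n v \<and> (\<forall>y\<in>v. n < y) \<and> cnf_split L (rev ?fs) v)"
        unfolding rev_append rev_replicate cnf_split_append
      proof (intro iffI; elim exE conjE)
        fix t u assume "s = insert n t \<union> u" "\<forall>y\<in>t. n < y" "cnf_split L (rev es) t"
          "cnf_split L (replicate (n - 1) b) u" "\<forall>x\<in>insert n t. \<forall>y\<in>u. x < y"
        then show "\<exists>v. s = insert n v \<and> (\<forall>y\<in>v. n < y) \<and> (\<exists>t u. v = t \<union> u \<and>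
            cnf_split L (rev es) t \<and> cnf_split L (replicate (n - 1) b) u \<and> (\<forall>x\<in>t. \<forall>y\<in>u. x < y))"
          by (intro exI[of _ "t \<union> u"]) auto
      next
        fix v t u assume "s = insert n v" "\<forall>y\<in>v. n < y" "v = t \<union> u" "cnf_split L (rev es) t"
          "cnf_split L (replicate (n - 1) b) u" "\<forall>x\<in>t. \<forall>y\<in>u. x < y"
        then show "\<exists>t u. s = insert n t \<union> u \<and> (\<forall>y\<in>t. n < y) \<and> cnf_split L (rev es) t \<and>
          cnf_split L (replicate (n - 1) b) u \<and> (\<forall>x\<in>insert n t. \<forall>y\<in>u. x < y)"
          by (intro exI[of _ t] exI[of _ u]) auto
      qed
      finally show ?thesis .
    qed
    have val: "nat_mult (n - 1) (omega_pow b) \<le> cnf_val ?fs"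
      by (simp add: cnf_val_replicate le_add_left_omega1 del: map_replicate)
    have "is_cnf_tail L a n ?fs"
      unfolding is_cnf_tail_def
    proof (intro conjI allI impI ballI)
      show "e < a" if "e \<in> set ?fs" for e using that es(2)[of e] \<open>b < a\<close> by (auto intro: less_trans)
      show "nat_mult (n - 1) (omega_pow d) \<le> cnf_val ?fs"
        if "a = osucc d \<or> is_limit a \<and> L a n = osucc d" for d
        using that succ val by simp
    qed (use sorted iff in auto)
    then show ?thesis by blast
  next
    case limit
    have "L a n < a" using limit_approxD(2)[OF L limit assms(2)] .
    from less[OF this] obtain es where "is_cnf_tail L (L a n) n es" by blast
    note es = is_cnf_tailD[OF this]
    have "is_cnf_tail L a n es"
      unfolding is_cnf_tail_def
    proof (intro conjI allI impI ballI)
      show "e < a" if "e \<in> set es" for e using less_trans[OF es(2)[OF that] \<open>L a n < a\<close>] .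
      show "in_schreier L (omega_pow a) s = (\<exists>t. s = insert n t \<and> (\<forall>y\<in>t. n < y) \<and> cnf_split L (rev es) t)"
        if "s \<noteq> {}" "Min s = n" for s
        using es(3)[OF that] in_schreier_omega_pow_limit_iff[OF limit, of L s] that by simp
      show "nat_mult (n - 1) (omega_pow d) \<le> cnf_val es"
        if "a = osucc d \<or> is_limit a \<and> L a n = osucc d" for d
        using that es(4)[of d] limit by auto
    qed (rule es(1))
    then show ?thesis by blast
  qed
qed

text \<open>Write \<xi> as \<open>cnf_val (es @ [a])\<close>. The minimum lies in the part of the
  smallest exponent \<open>a\<close>, so removing it replaces that power by a tail
  \<open>g n\<close> and keeps \<open>es\<close>. The value of \<open>g n\<close> stays below
  \<open>omega_pow a\<close> and tends to it, which gives both bounds for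
  \<open>x n\<close>.\<close>

lemma schreier_remove_Min:
  assumes L: "limit_approx L" and "\<xi> \<noteq> 0"
  obtains x where "\<forall>n\<ge>1. x n < \<xi>"
    and "\<forall>b<\<xi>. \<exists>N. \<forall>n\<ge>N. b \<le> x n"
    and "\<forall>s. in_schreier L \<xi> s \<longleftrightarrow>
      (\<exists>n t. s = insert n t \<and> n \<ge> 1 \<and> (\<forall>y\<in>t. n < y) \<and> in_schreier L (x n) t)"
proof -
  obtain fs where fs: "sorted_wrt (\<ge>) fs" "\<xi> = cnf_val fs" by (rule cnf_exists)
  then obtain es a where "fs = es @ [a]" using assms(2) by (cases fs rule: rev_exhaust) auto
  then have es: "sorted_wrt (\<ge>) (es @ [a])" "\<xi> = cnf_val (es @ [a])" using fs by auto
  define g where "g n = (SOME es. is_cnf_tail L a n es)" for n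
  have g: "is_cnf_tail L a n (g n)" if "n \<ge> 1" for n
    unfolding g_def using is_cnf_tail_exists[OF L that] by (rule someI_ex)
  note good = is_cnf_tailD[OF g]
  define x where "x n = cnf_val (es @ g n)" for n
  show ?thesis
  proof (rule that[of x]; intro allI impI)
    fix n :: nat assume n: "n \<ge> 1"
    have "cnf_val (g n) < omega_pow a" using good(1,2)[OF n] by (intro cnf_val_less) auto
    then show "x n < \<xi>" by (simp add: x_def es add_left_strict_mono_omega1)
  next
    fix b assume "b < \<xi>"
    then have "b < cnf_val es \<or> (\<exists>c<omega_pow a. b \<le> cnf_val es + c)"
      unfolding es(2) by (simp add: less_add_omega1_iff[of b "cnf_val es"])
    then obtain c where c: "c < omega_pow a" "b \<le> cnf_val es + c"
    proof
      assume "b < cnf_val es"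
      then show ?thesis using that[of 0] omega_pow_pos by simp
    qed blast
    have "\<exists>N\<ge>1. \<forall>n\<ge>N. c \<le> cnf_val (g n)"
    proof (cases a rule: omega1_cases)
      case zero
      then have "c = 0" using c(1) by (simp add: omega_pow_zero one_omega1_def less_osucc_iff antisym)
      then show ?thesis by auto
    next
      case (succ d)
      then obtain m where m: "c < nat_mult m (omega_pow d)"
        using c(1) by (auto simp: less_omega_pow_osucc_iff)
      \<comment> \<open>The minimum itself uses up one unit: only \<open>n - 1\<close> copies of the
        power are left, hence \<open>Suc m\<close>.\<close>
      have "c \<le> cnf_val (g n)" if "n \<ge> Suc m" for n
      proof -
        have "nat_mult m (omega_pow d) \<le> nat_mult (n - 1) (omega_pow d)"
          using that nat_mult_strict_mono[of m "n - 1" "omega_pow d"]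
          by (cases "m = n - 1") (auto simp: less_imp_le)
        also have "\<dots> \<le> cnf_val (g n)" using good(4)[of n d] that succ by auto
        finally show ?thesis using m by simp
      qed
      then show ?thesis by (intro exI[of _ "Suc m"]) auto
    next
      case limit
      then obtain e where e: "e < a" "c < omega_pow e" using c(1) less_omega_pow_limit_iff by blast
      obtain k where k: "k \<ge> 1" "\<And>n. n \<ge> k \<Longrightarrow> e < L a n"
        using limit_approxD(3)[OF L limit e(1)] by blast
      \<comment> \<open>The bound 2 ensures that at least one copy remains among the
        \<open>n - 1\<close>.\<close>
      have "c \<le> cnf_val (g n)" if n: "n \<ge> max k 2" for n
      proof -
        have "n \<ge> 1" using n by simp
        then obtain d where d: "L a n = osucc d"
          using limit_approxD(1)[OF L limit] by (auto simp: is_succ_def)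
        then have "e \<le> d" using k(2)[of n] n by (simp add: less_osucc_iff)
        have "c \<le> omega_pow d" using e(2) omega_pow_le_iff[of e d] \<open>e \<le> d\<close> by (meson less_imp_le order_trans)
        also have "\<dots> \<le> nat_mult (n - 1) (omega_pow d)"
          using n by (cases n; cases "n - 1") (auto simp: le_add_left_omega1)
        also have "\<dots> \<le> cnf_val (g n)" using good(4)[OF \<open>n \<ge> 1\<close>] limit d by blast
        finally show ?thesis .
      qed
      then show ?thesis using k(1) by (intro exI[of _ "max k 2"]) auto
    qed
    then obtain N where "\<And>n. n \<ge> N \<Longrightarrow> c \<le> cnf_val (g n)" by blast
    then have "b \<le> x n" if "n \<ge> N" for n
      using c(2) that add_left_mono_omega1[of c "cnf_val (g n)" "cnf_val es"]
      by (auto simp: x_def intro: order_trans)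
    then show "\<exists>N. \<forall>n\<ge>N. b \<le> x n" by blast
  next
    fix s
    have split: "in_schreier L (x n) t \<longleftrightarrow> cnf_split L (rev (es @ g n)) t" if n: "n \<ge> 1" for n t
    proof -
      have "sorted_wrt (\<ge>) (es @ g n)"
        using good(1,2)[OF n] es(1) by (fastforce simp: sorted_wrt_append)
      then show ?thesis unfolding x_def by (rule in_schreier_cnf_val_iff)
    qed
    have "in_schreier L \<xi> s \<longleftrightarrow> (\<exists>t u. s = t \<union> u \<and> in_schreier L (omega_pow a) t \<and>
        cnf_split L (rev es) u \<and> (\<forall>x\<in>t. \<forall>y\<in>u. x < y))"
      unfolding es(2) in_schreier_cnf_val_iff[OF es(1)] by simp
    also have "\<dots> \<longleftrightarrow> (\<exists>n t u. s = insert n t \<union> u \<and> n \<ge> 1 \<and> (\<forall>y\<in>t. n < y) \<and>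
        cnf_split L (rev (g n)) t \<and> cnf_split L (rev es) u \<and> (\<forall>x\<in>insert n t. \<forall>y\<in>u. x < y))"
        (is "?P \<longleftrightarrow> ?Q")
    proof
      assume ?P
      then obtain t u where tu: "s = t \<union> u" "in_schreier L (omega_pow a) t"
        "cnf_split L (rev es) u" "\<forall>x\<in>t. \<forall>y\<in>u. x < y" by blast
      have t: "finite t" "t \<noteq> {}" "t \<subseteq> {1..}"
        using in_schreier_omega_pow_block[OF tu(2)] by (auto simp: is_block_def)
      then have "Min t \<in> t" by simp
      then have "Min t \<ge> 1" using t by auto
      from good(3)[OF this t(2) refl] tu(2) obtain v where
        "t = insert (Min t) v" "\<forall>y\<in>v. Min t < y" "cnf_split L (rev (g (Min t))) v" by blast
      then show ?Q using tu \<open>Min t \<ge> 1\<close> by metis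
    next
      assume ?Q
      then obtain n t u where tu: "s = insert n t \<union> u" "n \<ge> 1" "\<forall>y\<in>t. n < y"
        "cnf_split L (rev (g n)) t" "cnf_split L (rev es) u" "\<forall>x\<in>insert n t. \<forall>y\<in>u. x < y" by blast
      have "finite t" using cnf_split_block[OF tu(4)] by simp
      then have "Min (insert n t) = n" using tu(3) by (intro Min_eqI) (auto simp: less_imp_le)
      then have "in_schreier L (omega_pow a) (insert n t)" using good(3)[OF tu(2), of "insert n t"] tu by auto
      then show ?P using tu by blast
    qed
    also have "\<dots> \<longleftrightarrow> (\<exists>n v. s = insert n v \<and> n \<ge> 1 \<and> (\<forall>y\<in>v. n < y) \<and>
        cnf_split L (rev (es @ g n)) v)" (is "_ \<longleftrightarrow> ?R")
      unfolding rev_append cnf_split_append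
    proof (intro iffI; elim exE conjE)
      fix n t u assume "s = insert n t \<union> u" "n \<ge> 1" "\<forall>y\<in>t. n < y"
        "cnf_split L (rev (g n)) t" "cnf_split L (rev es) u" "\<forall>x\<in>insert n t. \<forall>y\<in>u. x < y"
      then show "\<exists>n v. s = insert n v \<and> n \<ge> 1 \<and> (\<forall>y\<in>v. n < y) \<and> (\<exists>t u. v = t \<union> u \<and>
          cnf_split L (rev (g n)) t \<and> cnf_split L (rev es) u \<and> (\<forall>x\<in>t. \<forall>y\<in>u. x < y))"
        by (intro exI[of _ n] exI[of _ "t \<union> u"]) auto
    next
      fix n v t u assume "s = insert n v" "n \<ge> 1" "\<forall>y\<in>v. n < y" "v = t \<union> u"
        "cnf_split L (rev (g n)) t" "cnf_split L (rev es) u" "\<forall>x\<in>t. \<forall>y\<in>u. x < y"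
      then show "\<exists>n t u. s = insert n t \<union> u \<and> n \<ge> 1 \<and> (\<forall>y\<in>t. n < y) \<and>
        cnf_split L (rev (g n)) t \<and> cnf_split L (rev es) u \<and> (\<forall>x\<in>insert n t. \<forall>y\<in>u. x < y)"
        by (intro exI[of _ n] exI[of _ t] exI[of _ u]) auto
    qed
    also have "\<dots> \<longleftrightarrow> (\<exists>n t. s = insert n t \<and> n \<ge> 1 \<and> (\<forall>y\<in>t. n < y) \<and> in_schreier L (x n) t)"
      using split by (metis (no_types, lifting))
    finally show "in_schreier L \<xi> s \<longleftrightarrow>
      (\<exists>n t. s = insert n t \<and> n \<ge> 1 \<and> (\<forall>y\<in>t. n < y) \<and> in_schreier L (x n) t)" .
  qed
qed

section \<open>Block collections\<close>

text \<open>With the order stated for the set of members, finite and infinite collections differ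
  only in cardinality, and passing to subsets or adjoining blocks needs no reindexing.\<close>

definition block_chain :: "nat set set \<Rightarrow> bool" where
  "block_chain S \<longleftrightarrow> (\<forall>s\<in>S. is_block s) \<and> (\<forall>s\<in>S. \<forall>t\<in>S. s = t \<or> s \<lless> t \<or> t \<lless> s)"

lemma block_lessD: "s \<lless> t \<Longrightarrow> is_block s" "s \<lless> t \<Longrightarrow> is_block t"
  by (simp_all add: block_less_def)

lemma block_less_Min: "s \<lless> t \<Longrightarrow> Min s < Min t"
  unfolding block_less_iff is_block_def by simp

lemma block_less_irrefl: "\<not> s \<lless> s"
  using block_less_Min by blast

lemma block_chain_subset: "block_chain S \<Longrightarrow> T \<subseteq> S \<Longrightarrow> block_chain T"
  by (simp add: block_chain_def subset_iff)

lemma block_chain_insert: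
  "block_chain S \<Longrightarrow> is_block t \<Longrightarrow> (\<And>s. s \<in> S \<Longrightarrow> t \<lless> s) \<Longrightarrow> block_chain (insert t S)"
  by (auto simp: block_chain_def)

lemma block_chain_less_iff:
  assumes "block_chain S" "s \<in> S" "t \<in> S"
  shows "s \<lless> t \<longleftrightarrow> Min s < Min t"
proof
  assume "Min s < Min t"
  moreover have "s = t \<or> s \<lless> t \<or> t \<lless> s" using assms by (simp add: block_chain_def)
  ultimately show "s \<lless> t" using block_less_Min[of t s] by auto
qed (rule block_less_Min)

lemma block_chain_inj_Min:
  assumes "block_chain S"
  shows "inj_on Min S"
proof (rule inj_onI)
  fix s t assume "s \<in> S" "t \<in> S" "Min s = Min t"
  moreover from this have "s = t \<or> s \<lless> t \<or> t \<lless> s" using assms by (simp add: block_chain_def)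
  ultimately show "s = t" using block_less_Min[of t s] block_less_Min[of s t] by auto
qed

text \<open>Blocks of a chain have distinct minima, ordered like the blocks themselves, so sorting
  the minima produces the required list.\<close>

lemma fin_colls_iff: "S \<in> fin_colls \<longleftrightarrow> finite S \<and> block_chain S"
proof
  assume "S \<in> fin_colls"
  then obtain ss where ss: "S = set ss" "block_seq ss" by (auto simp: fin_colls_def)
  have "s = t \<or> s \<lless> t \<or> t \<lless> s" if st: "s \<in> set ss" "t \<in> set ss" for s t
  proof -
    obtain i j where ij: "i < length ss" "s = ss ! i" "j < length ss" "t = ss ! j"
      using st by (auto simp: in_set_conv_nth)
    have "sorted_wrt (\<lless>) ss" using ss(2) by (simp add: block_seq_def)
    then show ?thesis using ij sorted_wrt_nth_less[of "(\<lless>)" ss] by (cases i j rule: linorder_cases) auto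
  qed
  then show "finite S \<and> block_chain S"
    using ss by (auto simp: block_chain_def block_seq_def list_all_iff)
next
  assume S: "finite S \<and> block_chain S"
  define g where "g = inv_into S Min"
  have g: "g n \<in> S" "Min (g n) = n" if "n \<in> Min ` S" for n
    using that unfolding g_def by (rule inv_into_into, rule f_inv_into_f)
  define ns where "ns = sorted_list_of_set (Min ` S)"
  have set: "set ns = Min ` S" using S by (simp add: ns_def)
  have "sorted_wrt (<) ns" by (simp add: ns_def)
  then have "sorted_wrt (\<lambda>m n. g m \<lless> g n) ns"
  proof (rule sorted_wrt_mono_rel[rotated])
    fix m n assume "m \<in> set ns" "n \<in> set ns" "m < n"
    then show "g m \<lless> g n" using S g[of m] g[of n] block_chain_less_iff[of S "g m" "g n"] set by simp
  qed
  then have "block_seq (map g ns)"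
    using S g set by (auto simp: block_seq_def sorted_wrt_map list_all_iff block_chain_def)
  moreover have "set (map g ns) = S"
    unfolding set_map set g_def
    using block_chain_inj_Min S by (simp add: inv_into_image_cancel)
  ultimately show "S \<in> fin_colls" unfolding fin_colls_def by force
qed

lemma block_less_seq:
  assumes "\<And>n. f n \<lless> f (Suc n)" "m < n"
  shows "f m \<lless> f n"
  using assms(2) by (induction rule: less_Suc_induct) (auto intro: assms(1) block_less_trans)

lemma range_in_inf_colls: "(\<And>n. f n \<lless> f (Suc n)) \<Longrightarrow> range f \<in> inf_colls"
  unfolding inf_colls_def using block_lessD(1) by blast

lemma inf_colls_iff: "S \<in> inf_colls \<longleftrightarrow> infinite S \<and> block_chain S"
proof
  assume "S \<in> inf_colls"
  then obtain f where f: "S = range f" "\<And>n. is_block (f n)" "\<And>n. f n \<lless> f (Suc n)"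
    by (auto simp: inf_colls_def)
  have less: "f m \<lless> f n" if "m < n" for m n using f(3) that by (rule block_less_seq)
  then have "inj f"
    by (intro injI) (metis block_less_irrefl neqE)
  moreover have "f m = f n \<or> f m \<lless> f n \<or> f n \<lless> f m" for m n
    using less by (cases m n rule: linorder_cases) auto
  ultimately show "infinite S \<and> block_chain S"
    using f by (auto simp: block_chain_def finite_image_iff)
next
  assume S: "infinite S \<and> block_chain S"
  then have inf: "infinite (Min ` S)"
    using finite_imageD[OF _ block_chain_inj_Min] by blast
  define g where "g = inv_into S Min"
  have g: "g n \<in> S" "Min (g n) = n" if "n \<in> Min ` S" for n
    using that unfolding g_def by (rule inv_into_into, rule f_inv_into_f)
  define f where "f n = g (enumerate (Min ` S) n)" for n
  have "f n \<lless> f (Suc n)" for n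
    unfolding f_def using S inf
    by (subst block_chain_less_iff[of S]) (auto simp: g enumerate_in_set enumerate_step)
  moreover have "range f = S"
  proof -
    have "range f = g ` Min ` S"
      unfolding f_def using range_enumerate[OF inf] by (metis image_image)
    then show ?thesis
      unfolding g_def using block_chain_inj_Min S by (simp add: inv_into_image_cancel)
  qed
  ultimately show "S \<in> inf_colls" using range_in_inf_colls by metis
qed

lemma inf_colls_block: "D \<in> inf_colls \<Longrightarrow> d \<in> D \<Longrightarrow> is_block d"
  by (simp add: inf_colls_iff block_chain_def)

section \<open>Finite unions, tails and subcollections\<close>

lemma Union_in_FU: "C \<subseteq> D \<Longrightarrow> finite C \<Longrightarrow> C \<noteq> {} \<Longrightarrow> \<Union>C \<in> FU D"
  by (auto simp: FU_def)

lemma FU_E: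
  assumes "s \<in> FU D"
  obtains C where "s = \<Union>C" "C \<subseteq> D" "finite C" "C \<noteq> {}"
  using assms unfolding FU_def by auto

lemma FU_mono: "C \<subseteq> D \<Longrightarrow> FU C \<subseteq> FU D"
  unfolding FU_def by blast

lemma subset_FU: "D \<subseteq> FU D"
proof
  fix d assume "d \<in> D"
  then show "d \<in> FU D" unfolding FU_def by (intro CollectI exI[of _ "{d}"]) simp
qed

lemma Un_in_FU: "s \<in> FU D \<Longrightarrow> t \<in> FU D \<Longrightarrow> s \<union> t \<in> FU D"
proof -
  assume "s \<in> FU D" "t \<in> FU D"
  then obtain A B where AB: "s = \<Union>A" "A \<subseteq> D" "finite A" "A \<noteq> {}" "t = \<Union>B" "B \<subseteq> D" "finite B"
    by (meson FU_E)
  then show ?thesis using Union_in_FU[of "A \<union> B" D] by simp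
qed

lemma FU_induct [consumes 1, case_names base Un]:
  assumes "s \<in> FU D" "\<And>d. d \<in> D \<Longrightarrow> P d" "\<And>s t. P s \<Longrightarrow> P t \<Longrightarrow> P (s \<union> t)"
  shows "P s"
proof -
  obtain C where C: "s = \<Union>C" "C \<subseteq> D" "finite C" "C \<noteq> {}" using assms(1) by (rule FU_E)
  from C(3,4,2) have "P (\<Union>C)"
    by (induction rule: finite_ne_induct) (use assms(2,3) in auto)
  then show ?thesis using C(1) by simp
qed

lemma FU_closed: "C \<subseteq> FU D \<Longrightarrow> FU C \<subseteq> FU D"
proof
  fix s assume "C \<subseteq> FU D" "s \<in> FU C"
  from this(2) show "s \<in> FU D"
    by (induction rule: FU_induct) (use \<open>C \<subseteq> FU D\<close> Un_in_FU in blast)+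
qed

lemma is_block_Un: "is_block s \<Longrightarrow> is_block t \<Longrightarrow> is_block (s \<union> t)"
  by (auto simp: is_block_def)

lemma block_less_Un_right: "t \<lless> u \<Longrightarrow> t \<lless> v \<Longrightarrow> t \<lless> u \<union> v"
  by (auto simp: block_less_iff is_block_Un)

lemma block_less_Un_left: "u \<lless> t \<Longrightarrow> v \<lless> t \<Longrightarrow> u \<union> v \<lless> t"
  by (auto simp: block_less_iff is_block_Un)

lemma FU_block:
  assumes "s \<in> FU D" "\<And>d. d \<in> D \<Longrightarrow> is_block d"
  shows "is_block s"
  using assms(1) by (induction rule: FU_induct) (auto intro: assms(2) is_block_Un)

lemma FU_less:
  assumes "s \<in> FU D" "\<And>d. d \<in> D \<Longrightarrow> t \<lless> d"
  shows "t \<lless> s"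
  using assms(1) by (induction rule: FU_induct) (auto intro: assms(2) block_less_Un_right)

lemma finite_FU: "finite D \<Longrightarrow> finite (FU D)"
proof -
  assume "finite D"
  then have "finite (\<Union> ` Pow D)" by simp
  then show ?thesis by (rule rev_finite_subset) (auto simp: FU_def)
qed

lemma FU_empty [simp]: "FU {} = {}"
  by (auto simp: FU_def)

definition tail :: "nat set set \<Rightarrow> nat set \<Rightarrow> nat set set" where
  "tail D t = {d \<in> D. t \<lless> d}"

lemma FU_tail:
  assumes "\<And>d. d \<in> D \<Longrightarrow> is_block d"
  shows "FU (tail D t) = {u \<in> FU D. t \<lless> u}"
proof (intro equalityI subsetI)
  fix u assume u: "u \<in> FU (tail D t)"
  moreover have "FU (tail D t) \<subseteq> FU D" by (rule FU_mono) (auto simp: tail_def)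
  moreover have "t \<lless> u" using u by (rule FU_less) (simp add: tail_def)
  ultimately show "u \<in> {u \<in> FU D. t \<lless> u}" by blast
next
  fix u assume "u \<in> {u \<in> FU D. t \<lless> u}"
  then have "u \<in> FU D" "t \<lless> u" by simp_all
  from this(1) obtain C where C: "u = \<Union>C" "C \<subseteq> D" "finite C" "C \<noteq> {}" by (rule FU_E)
  have "t \<lless> d" if "d \<in> C" for d
  proof -
    have "is_block d" "d \<subseteq> u" using that C(1,2) assms by auto
    then show ?thesis using \<open>t \<lless> u\<close> unfolding block_less_iff by auto
  qed
  then have "C \<subseteq> tail D t" using C(2) by (auto simp: tail_def)
  then show "u \<in> FU (tail D t)" unfolding C(1) using C(3,4) by (rule Union_in_FU)
qed

lemma finite_bounded_Min:
  assumes "block_chain E"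
  shows "finite {d \<in> E. Min d \<le> n}"
proof (rule finite_imageD)
  show "finite (Min ` {d \<in> E. Min d \<le> n})" by (rule finite_subset[of _ "{..n}"]) auto
  show "inj_on Min {d \<in> E. Min d \<le> n}"
    by (rule inj_on_subset[OF block_chain_inj_Min[OF assms]]) simp
qed

lemma tail_in_inf_colls:
  assumes "D \<in> inf_colls" "is_block t"
  shows "tail D t \<in> inf_colls"
proof -
  have D: "infinite D" "block_chain D" using assms(1) by (auto simp: inf_colls_iff)
  have "D - tail D t \<subseteq> {d \<in> D. Min d \<le> Max t}"
    using D(2) assms(2) by (auto simp: tail_def block_less_def block_chain_def)
  then have "finite (D - tail D t)" by (rule finite_subset) (rule finite_bounded_Min[OF D(2)])
  then have "infinite (tail D t)" using D(1) finite_Diff2[of "tail D t" D] by auto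
  moreover have "block_chain (tail D t)" by (rule block_chain_subset[OF D(2)]) (simp add: tail_def)
  ultimately show ?thesis by (simp add: inf_colls_iff)
qed

lemma coll_less_refl: "D \<in> inf_colls \<Longrightarrow> D \<sqsubset> D"
  by (simp add: coll_less_def subset_FU)

lemma coll_less_FU: "D1 \<sqsubset> D \<Longrightarrow> FU D1 \<subseteq> FU D"
  by (simp add: coll_less_def FU_closed)

lemma coll_less_trans: "D1 \<sqsubset> D2 \<Longrightarrow> D2 \<sqsubset> D3 \<Longrightarrow> D1 \<sqsubset> D3"
  using FU_closed[of D2 D3] by (auto simp: coll_less_def)

lemma coll_lessD: "D1 \<sqsubset> D \<Longrightarrow> D1 \<in> inf_colls" "D1 \<sqsubset> D \<Longrightarrow> D \<in> inf_colls"
  by (simp_all add: coll_less_def)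

lemma subset_coll_less: "D1 \<in> inf_colls \<Longrightarrow> D \<in> inf_colls \<Longrightarrow> D1 \<subseteq> D \<Longrightarrow> D1 \<sqsubset> D"
  using subset_FU[of D] by (auto simp: coll_less_def)

lemma tail_coll_less: "D \<in> inf_colls \<Longrightarrow> is_block t \<Longrightarrow> tail D t \<sqsubset> D"
  using tail_in_inf_colls[of D t] subset_coll_less[of "tail D t" D] by (auto simp: tail_def)

section \<open>Hindman's theorem for finite unions\<close>

text \<open>Baumgartner's notion of largeness. It passes to subcollections and, after thinning out,
  to one piece of a finite partition, before anything is known about sets that contain all finite
  unions of a collection.\<close>

definition large :: "nat set set \<Rightarrow> nat set set \<Rightarrow> bool" where
  "large X D \<longleftrightarrow> D \<in> inf_colls \<and> (\<forall>E. E \<sqsubset> D \<longrightarrow> FU E \<inter> X \<noteq> {})"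

lemma large_coll_less: "large X D \<Longrightarrow> E \<sqsubset> D \<Longrightarrow> large X E"
  unfolding large_def using coll_less_trans coll_lessD by blast

lemma large_mono: "large X D \<Longrightarrow> X \<inter> FU D \<subseteq> Y \<Longrightarrow> large Y D"
  unfolding large_def using coll_less_FU by blast

text \<open>If \<open>X\<close> is not large, some subcollection avoids it, and there
  \<open>Y\<close> has to be large.\<close>

lemma large_Un:
  assumes "large (X \<union> Y) D"
  obtains E where "E \<sqsubset> D" "large X E \<or> large Y E"
proof (cases "large X D")
  case True
  then show ?thesis using that[of D] coll_less_refl by (simp add: large_def)
next
  case False
  then obtain E where E: "E \<sqsubset> D" "FU E \<inter> X = {}" using assms by (auto simp: large_def)
  then have "large Y E" using large_mono[OF large_coll_less[OF assms E(1)], of Y] by blast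
  then show ?thesis using that[of E] E(1) by blast
qed

lemma large_Union:
  assumes "finite I" "large (\<Union>i\<in>I. X i) D"
  shows "\<exists>i\<in>I. \<exists>E. E \<sqsubset> D \<and> large (X i) E"
  using assms
proof (induction I arbitrary: D rule: finite_induct)
  case empty
  then show ?case using coll_less_refl by (auto simp: large_def)
next
  case (insert i I)
  then have "large (X i \<union> (\<Union>i\<in>I. X i)) D" by simp
  then obtain E where E: "E \<sqsubset> D" "large (X i) E \<or> large (\<Union>i\<in>I. X i) E" by (rule large_Un)
  then show ?case using insert.IH[of E] coll_less_trans by blast
qed

lemma Un_image_Max:
  fixes I :: "nat set"
  assumes "finite I" "I \<noteq> {}"
  shows "\<Union>(f ` I) = \<Union>(f ` (I - {Max I})) \<union> f (Max I)"
proof -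
  have "insert (Max I) (I - {Max I}) = I" using Max_in[OF assms] by (rule insert_Diff)
  then have "\<Union>(f ` I) = \<Union>(f ` insert (Max I) (I - {Max I}))" by (simp only:)
  also have "\<dots> = \<Union>(f ` (I - {Max I})) \<union> f (Max I)" by (simp only: image_insert Union_insert Un_commute)
  finally show ?thesis .
qed

text \<open>Otherwise a sequence whose finite unions avoid \<open>X\<close> could be chosen recursively.\<close>

lemma large_finite_covering:
  assumes "large X D"
  shows "\<exists>A. finite A \<and> A \<subseteq> FU D \<and>
    (\<forall>d\<in>FU D. (\<forall>a\<in>A. a \<lless> d) \<longrightarrow> (\<exists>e\<in>A. e \<union> d \<in> X))"
proof (rule ccontr)
  assume contr: "\<not> ?thesis"
  have neg: "\<exists>d\<in>FU D. (\<forall>a\<in>A. a \<lless> d) \<and> (\<forall>e\<in>A. e \<union> d \<notin> X)"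
    if "finite A" "A \<subseteq> FU D" for A
    using contr[simplified not_ex, THEN spec[of _ A]] that by auto
  \<comment> \<open>The negated claim controls \<open>e \<union> d'\<close> for \<open>e\<close> in
    the given set, but not \<open>d'\<close> itself. Enlarging the set by \<open>d\<close> and all
    \<open>e \<union> d\<close> lets \<open>d \<union> d'\<close> avoid \<open>X\<close> both alone
    and joined with any \<open>e\<close> of \<open>A\<close>.\<close>
  have ex: "\<exists>g\<in>FU D. (\<forall>a\<in>A. a \<lless> g) \<and> g \<notin> X \<and> (\<forall>e\<in>A. e \<union> g \<notin> X)"
    if A: "finite A" "A \<subseteq> FU D" for A
  proof -
    obtain d where d: "d \<in> FU D" "\<forall>a\<in>A. a \<lless> d" using neg[OF A] by blast
    let ?A = "insert d (A \<union> (\<lambda>e. e \<union> d) ` A)"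
    have "finite ?A" "?A \<subseteq> FU D" using A d Un_in_FU by auto
    then obtain d' where d': "d' \<in> FU D" "\<forall>a\<in>?A. a \<lless> d'" "\<forall>e\<in>?A. e \<union> d' \<notin> X"
      using neg[of ?A] by blast
    show ?thesis
    proof (intro bexI[of _ "d \<union> d'"] conjI ballI)
      show "a \<lless> d \<union> d'" if "a \<in> A" for a using that d(2) d'(2) by (intro block_less_Un_right) auto
      show "e \<union> (d \<union> d') \<notin> X" if "e \<in> A" for e
        using bspec[OF d'(3), of "e \<union> d"] that by (simp add: Un_assoc)
    qed (use d d' Un_in_FU in auto)
  qed
  define c where "c A = (SOME g. g \<in> FU D \<and> (\<forall>a\<in>A. a \<lless> g) \<and> g \<notin> X \<and> (\<forall>e\<in>A. e \<union> g \<notin> X))" for A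
  have c_all: "c A \<in> FU D \<and> (\<forall>a\<in>A. a \<lless> c A) \<and> c A \<notin> X \<and> (\<forall>e\<in>A. e \<union> c A \<notin> X)"
    if "finite A" "A \<subseteq> FU D" for A
    unfolding c_def by (rule someI_ex) (use ex[OF that] in \<open>simp add: Bex_def\<close>)
  have c: "c A \<in> FU D" "a \<in> A \<Longrightarrow> a \<lless> c A" "c A \<notin> X" "a \<in> A \<Longrightarrow> a \<union> c A \<notin> X"
    if "finite A" "A \<subseteq> FU D" for A a
    using c_all[OF that] by simp_all
  define S where "S = rec_nat {} (\<lambda>_ S. insert (c (FU S)) S)"
  have S_simps: "S 0 = {}" "\<And>n. S (Suc n) = insert (c (FU (S n))) (S n)" by (simp_all add: S_def)
  have S: "finite (S n)" "S n \<subseteq> FU D" for n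
    by (induction n) (use c(1) FU_closed finite_FU in \<open>simp_all add: S_simps\<close>)
  then have FS: "finite (FU (S n))" "FU (S n) \<subseteq> FU D" for n
    using finite_FU FU_closed by auto
  define g where "g n = c (FU (S n))" for n
  have S_eq: "S n = g ` {..<n}" for n
    by (induction n) (auto simp: S_simps g_def lessThan_Suc)
  have "g n \<lless> g (Suc n)" for n
    unfolding g_def[of "Suc n"] using FS[of "Suc n"] subset_FU[of "S (Suc n)"]
    by (intro c(2)) (auto simp: S_eq)
  then have "range g \<in> inf_colls" by (rule range_in_inf_colls)
  moreover have "range g \<subseteq> FU D" using c(1) FS by (auto simp: g_def)
  ultimately have "range g \<sqsubset> D" using assms by (simp add: coll_less_def large_def)
  then obtain u where u: "u \<in> FU (range g)" "u \<in> X" using assms by (auto simp: large_def)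
  from this(1) obtain C where C: "u = \<Union>C" "C \<subseteq> range g" "finite C" "C \<noteq> {}" by (rule FU_E)
  obtain I where I: "C = g ` I" "finite I" using finite_subset_image[OF C(3,2)] by blast
  then have "I \<noteq> {}" using C(4) by blast
  show False
  proof (cases "I - {Max I} = {}")
    case True
    have "u = g (Max I)" unfolding C(1) I(1) Un_image_Max[OF I(2) \<open>I \<noteq> {}\<close>] True by simp
    then show False using u(2) c(3)[OF FS] by (simp add: g_def)
  next
    case False
    have "i < Max I" if "i \<in> I - {Max I}" for i using that I(2) by (simp add: order_less_le)
    then have "g ` (I - {Max I}) \<subseteq> S (Max I)" by (auto simp: S_eq)
    then have "\<Union>(g ` (I - {Max I})) \<in> FU (S (Max I))"
      using False I(2) by (intro Union_in_FU) auto
    then show False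
      using u(2) c(4)[OF FS] unfolding C(1) I(1) Un_image_Max[OF I(2) \<open>I \<noteq> {}\<close>] g_def[of "Max I"]
      by blast
  qed
qed

text \<open>Far enough out, every member of \<open>X\<close> stays in \<open>X\<close> after joining
  one of finitely many blocks \<open>e\<close>. So \<open>X\<close> is there a finite union of sets
  indexed by \<open>e\<close>, and one of them is large on a subcollection.\<close>

lemma large_extension:
  assumes "large X D"
  obtains e E where "e \<in> FU D" "E \<sqsubset> D" "\<forall>d\<in>E. e \<lless> d" "large {x \<in> X. e \<union> x \<in> X} E"
proof -
  from large_finite_covering[OF assms] obtain A where "finite A \<and> A \<subseteq> FU D \<and>
    (\<forall>d\<in>FU D. (\<forall>a\<in>A. a \<lless> d) \<longrightarrow> (\<exists>e\<in>A. e \<union> d \<in> X))" ..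
  then have A: "finite A" "A \<subseteq> FU D" "\<And>d. d \<in> FU D \<Longrightarrow> \<forall>a\<in>A. a \<lless> d \<Longrightarrow> \<exists>e\<in>A. e \<union> d \<in> X"
    by simp_all
  have D: "D \<in> inf_colls" using assms by (simp add: large_def)
  have blk: "is_block a" if "a \<in> A" for a
    using FU_block[of a D] that A(2) inf_colls_block[OF D] by blast
  \<comment> \<open>The point 1 makes \<open>t\<close> a block even if \<open>A\<close> is empty;
    the same device is used below whenever something has to lie beyond finitely many blocks.\<close>
  define t where "t = insert 1 (\<Union>A)"
  have t: "is_block t" using A(1) blk by (auto simp: t_def is_block_def)
  have above: "a \<lless> d" if "t \<lless> d" "a \<in> A" for a d
    using that blk unfolding block_less_iff t_def by blast
  let ?D = "tail D t"
  have less: "?D \<sqsubset> D" using D t by (rule tail_coll_less)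
  have FU: "FU ?D = {u \<in> FU D. t \<lless> u}" by (rule FU_tail) (rule inf_colls_block[OF D])
  have "large X ?D" using assms less by (rule large_coll_less)
  then have "large (\<Union>e\<in>A. {x \<in> X. e \<union> x \<in> X}) ?D"
  proof (rule large_mono, intro subsetI)
    fix x assume x: "x \<in> X \<inter> FU ?D"
    then show "x \<in> (\<Union>e\<in>A. {x \<in> X. e \<union> x \<in> X})" using A(3)[of x] above unfolding FU by blast
  qed
  then obtain e E where E: "e \<in> A" "E \<sqsubset> ?D" "large {x \<in> X. e \<union> x \<in> X} E"
    using large_Union[OF A(1)] by blast
  show ?thesis
  proof (rule that)
    show "e \<in> FU D" using E(1) A(2) by blast
    show "E \<sqsubset> D" using coll_less_trans[OF E(2) less] .
    show "\<forall>d\<in>E. e \<lless> d"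
      using E(1,2) above FU by (auto simp: coll_less_def)
  qed (rule E(3))
qed

text \<open>Baumgartner's argument: iterating \<open>large_extension\<close> gives sets $e_0 < e_1 < \dots$ and large sets
  $X_0 \supseteq X_1 \supseteq \dots$ such that adding a union of some of $e_0, \dots, e_{n-1}$ to a member
  of $X_n$ does not leave $X_0$. The $e_n$ themselves need not lie in $X_0$; finite unions
  of them that belong to the successive $X_n$ do.\<close>

lemma large_contains_FU:
  assumes "large X D"
  obtains E where "E \<sqsubset> D" "FU E \<subseteq> X"
proof -
  \<comment> \<open>The starting pair is put into the invariant at \<open>n = 0\<close>, so that the
    sequence obtained by dependent choice begins with \<open>(X, D)\<close>.\<close>
  define P where "P n p \<longleftrightarrow> large (fst p) (snd p) \<and> (n = 0 \<longrightarrow> p = (X, D))" for n :: nat and p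
  define Q where "Q p q \<longleftrightarrow> (\<exists>e. e \<in> FU (snd p) \<and> snd q \<sqsubset> snd p \<and> (\<forall>d\<in>snd q. e \<lless> d) \<and>
    fst q = {x \<in> fst p. e \<union> x \<in> fst p})" for p q :: "nat set set \<times> nat set set"
  have "\<exists>f. \<forall>n. P n (f n) \<and> Q (f n) (f (Suc n))"
  proof (rule dependent_nat_choice)
    show "\<exists>p. P 0 p" using assms by (simp add: P_def)
    fix p and n :: nat
    assume "P n p"
    then have "large (fst p) (snd p)" by (simp add: P_def)
    then obtain e E where "e \<in> FU (snd p)" "E \<sqsubset> snd p" "\<forall>d\<in>E. e \<lless> d"
      "large {x \<in> fst p. e \<union> x \<in> fst p} E" by (rule large_extension)
    then show "\<exists>q. P (Suc n) q \<and> Q p q"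
      by (intro exI[of _ "({x \<in> fst p. e \<union> x \<in> fst p}, E)"]) (auto simp: P_def Q_def)
  qed
  then obtain f where f: "\<forall>n. P n (f n) \<and> Q (f n) (f (Suc n))" ..
  define Xs where "Xs n = fst (f n)" for n
  define Ds where "Ds n = snd (f n)" for n
  have large: "large (Xs n) (Ds n)" for n
    using spec[OF f, of n] by (simp add: Xs_def Ds_def P_def)
  have init: "Xs 0 = X" "Ds 0 = D" using spec[OF f, of 0] by (simp_all add: Xs_def Ds_def P_def)
  have "\<forall>n. \<exists>e. e \<in> FU (Ds n) \<and> Ds (Suc n) \<sqsubset> Ds n \<and> (\<forall>d\<in>Ds (Suc n). e \<lless> d) \<and>
      Xs (Suc n) = {x \<in> Xs n. e \<union> x \<in> Xs n}"
    using f unfolding Xs_def Ds_def Q_def by simp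
  from choice[OF this] obtain e where e_all: "\<forall>n. e n \<in> FU (Ds n) \<and> Ds (Suc n) \<sqsubset> Ds n \<and>
      (\<forall>d\<in>Ds (Suc n). e n \<lless> d) \<and> Xs (Suc n) = {x \<in> Xs n. e n \<union> x \<in> Xs n}" ..
  have e: "e n \<in> FU (Ds n)" "Ds (Suc n) \<sqsubset> Ds n" "d \<in> Ds (Suc n) \<Longrightarrow> e n \<lless> d"
    "Xs (Suc n) = {x \<in> Xs n. e n \<union> x \<in> Xs n}" for n d
    using spec[OF e_all, of n] by simp_all
  have Ds: "Ds n \<in> inf_colls" for n using large by (simp add: large_def)
  have Ds_less: "Ds n \<sqsubset> Ds m" if "m \<le> n" for m n
    using that by (induction rule: dec_induct) (use Ds e(2) in \<open>auto intro: coll_less_refl coll_less_trans\<close>)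
  have e_less: "e n \<lless> e (Suc n)" for n
    using e(1)[of "Suc n"] e(3)[of _ n] by (rule FU_less)
  have e_mono: "e m \<lless> e n" if "m < n" for m n using e_less that by (rule block_less_seq)
  have e_in: "e n \<in> FU (Ds m)" if "m \<le> n" for m n
    using e(1)[of n] coll_less_FU[OF Ds_less[OF that]] by blast
  have tail_e: "e ` {m..} \<sqsubset> Ds m" for m
  proof -
    have "e ` {m..} = range (\<lambda>k. e (m + k))"
      by (auto simp: image_iff) (metis le_add_diff_inverse)
    moreover have "range (\<lambda>k. e (m + k)) \<in> inf_colls"
      by (rule range_in_inf_colls) (simp add: e_less)
    ultimately show ?thesis using Ds e_in by (auto simp: coll_less_def)
  qed
  have add_e: "\<Union>(e ` J) \<union> x \<in> X" if "x \<in> Xs n" "J \<subseteq> {..<n}" for x n J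
    using that
  proof (induction n arbitrary: x J)
    case 0
    then show ?case by (simp add: init)
  next
    case (Suc n)
    have x: "x \<in> Xs n" "e n \<union> x \<in> Xs n" using Suc.prems(1) by (auto simp: e(4))
    have J: "J - {n} \<subseteq> {..<n}" using Suc.prems(2) by auto
    show ?case
    proof (cases "n \<in> J")
      case True
      then have "\<Union>(e ` J) \<union> x = \<Union>(e ` (J - {n})) \<union> (e n \<union> x)" by auto
      then show ?thesis using Suc.IH[OF x(2) J] by simp
    next
      case False
      then show ?thesis using Suc.IH[OF x(1) J] by simp
    qed
  qed
  \<comment> \<open>\<open>Xs m\<close> is large on \<open>Ds m\<close>, and the \<open>e n\<close>
    with \<open>n \<ge> m\<close> form a subcollection of \<open>Ds m\<close>, so some finite union
    of them lies in \<open>Xs m\<close>.\<close>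
  let ?R = "\<lambda>m J. finite J \<and> J \<noteq> {} \<and> J \<subseteq> {m..} \<and> \<Union>(e ` J) \<in> Xs m"
  have "\<forall>m. \<exists>J. ?R m J"
  proof
    fix m
    obtain y where y: "y \<in> FU (e ` {m..})" "y \<in> Xs m"
      using large[of m] tail_e[of m] unfolding large_def by blast
    from this(1) obtain C where C: "y = \<Union>C" "C \<subseteq> e ` {m..}" "finite C" "C \<noteq> {}" by (rule FU_E)
    obtain J where "J \<subseteq> {m..}" "finite J" "C = e ` J"
      using finite_subset_image[OF C(3,2)] by blast
    then show "\<exists>J. ?R m J" using C(1,4) y(2) by (intro exI[of _ J]) simp
  qed
  from choice[OF this] obtain J where "\<forall>m. ?R m (J m)" ..
  then have J: "?R m (J m)" for m ..
  \<comment> \<open>Each index set starts beyond the maximum of the previous one. This orders the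
    unions \<open>y k\<close> and keeps all earlier indices below \<open>m k\<close>.\<close>
  define m where "m = rec_nat 0 (\<lambda>_ m. Suc (Max (J m)))"
  have m_Suc: "m (Suc k) = Suc (Max (J (m k)))" for k by (simp add: m_def)
  have J_bound: "J (m k) \<subseteq> {m k..<m (Suc k)}" for k
    using J[of "m k"] by (auto simp: m_Suc less_Suc_eq_le)
  have m_less: "m k < m (Suc k)" for k
  proof -
    obtain j where "j \<in> J (m k)" using J[of "m k"] by blast
    then show ?thesis using J_bound[of k] by fastforce
  qed
  have m_mono: "m k \<le> m l" if "k \<le> l" for k l
    using m_less that by (meson lift_Suc_mono_le less_imp_le)
  define y where "y k = \<Union>(e ` J (m k))" for k
  have y_FU: "y k \<in> FU (e ` J (m k))" for k
    unfolding y_def using J[of "m k"] by (intro Union_in_FU) auto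
  have "y k \<lless> y (Suc k)" for k
  proof -
    have "e i \<lless> y (Suc k)" if i: "i \<in> J (m k)" for i
    proof (rule FU_less[OF y_FU])
      fix d assume "d \<in> e ` J (m (Suc k))"
      then obtain j where j: "j \<in> J (m (Suc k))" "d = e j" by blast
      have "i < m (Suc k)" using J_bound[of k] i by auto
      moreover have "m (Suc k) \<le> j" using J_bound[of "Suc k"] j(1) by auto
      ultimately show "e i \<lless> d" using e_mono j(2) by simp
    qed
    moreover from y_FU[of k] have "y k \<lless> y (Suc k)" if "\<And>i. i \<in> J (m k) \<Longrightarrow> e i \<lless> y (Suc k)"
      by (induction rule: FU_induct) (use that in \<open>auto intro: block_less_Un_left\<close>)
    ultimately show ?thesis by blast
  qed
  then have "range y \<in> inf_colls" by (rule range_in_inf_colls)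
  moreover have "range y \<subseteq> FU D"
  proof -
    have "FU (e ` J (m k)) \<subseteq> FU (Ds 0)" for k using e_in[of 0] by (intro FU_closed) auto
    then show ?thesis using y_FU init by auto
  qed
  ultimately have "range y \<sqsubset> D" using assms by (simp add: coll_less_def large_def)
  moreover have "FU (range y) \<subseteq> X"
  proof
    fix u assume "u \<in> FU (range y)"
    then obtain C where C: "u = \<Union>C" "C \<subseteq> range y" "finite C" "C \<noteq> {}" by (rule FU_E)
    obtain K where K: "C = y ` K" "finite K" using finite_subset_image[OF C(3,2)] by blast
    then have "K \<noteq> {}" using C(4) by blast
    \<comment> \<open>Only the last block serves as a member of \<open>Xs (m ?l)\<close>; the
      earlier ones are dissolved into sets \<open>e j\<close> with \<open>j < m ?l\<close>, which
      \<open>add_e\<close> joins without leaving \<open>X\<close>.\<close>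
    let ?l = "Max K" and ?J = "\<Union>k\<in>K - {Max K}. J (m k)"
    have "?J \<subseteq> {..<m ?l}"
    proof
      fix j assume "j \<in> ?J"
      then obtain k where k: "k \<in> K" "k \<noteq> ?l" "j \<in> J (m k)" by blast
      then have "Suc k \<le> ?l" using Max_ge[OF K(2) k(1)] by simp
      then show "j \<in> {..<m ?l}" using J_bound[of k] k(3) m_mono[of "Suc k" ?l] by fastforce
    qed
    moreover have "y ?l \<in> Xs (m ?l)" using J[of "m ?l"] by (simp add: y_def)
    ultimately have "\<Union>(e ` ?J) \<union> y ?l \<in> X" using add_e by blast
    moreover have "u = \<Union>(e ` ?J) \<union> y ?l"
      unfolding C(1) K(1) Un_image_Max[OF K(2) \<open>K \<noteq> {}\<close>] by (auto simp: y_def)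
    ultimately show "u \<in> X" by simp
  qed
  ultimately show ?thesis using that by blast
qed

theorem hindman:
  assumes "D \<in> inf_colls"
  obtains E where "E \<sqsubset> D" "FU E \<subseteq> X \<or> FU E \<inter> X = {}"
proof -
  have "FU E \<noteq> {}" if "E \<sqsubset> D" for E
    using subset_FU[of E] coll_lessD(1)[OF that] by (auto simp: inf_colls_iff)
  then have "large (X \<union> - X) D" using assms by (simp add: large_def)
  then obtain E where E: "E \<sqsubset> D" "large X E \<or> large (- X) E" by (rule large_Un)
  from E(2) show ?thesis
  proof
    assume "large X E"
    then obtain E' where "E' \<sqsubset> E" "FU E' \<subseteq> X" by (rule large_contains_FU)
    then show ?thesis using that coll_less_trans E(1) by blast
  next
    assume "large (- X) E"
    then obtain E' where "E' \<sqsubset> E" "FU E' \<subseteq> - X" by (rule large_contains_FU)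
    then show ?thesis using that[of E'] coll_less_trans E(1) by blast
  qed
qed

section \<open>The Ramsey dichotomy\<close>

lemma hereditary_dense_finite:
  assumes her: "\<And>t E E'. P t E \<Longrightarrow> E' \<sqsubset> E \<Longrightarrow> P t E'"
    and dense: "\<And>t E. is_block t \<Longrightarrow> E \<in> inf_colls \<Longrightarrow> \<exists>E'. E' \<sqsubset> E \<and> P t E'"
    and "finite A" "\<forall>t\<in>A. is_block t" "E \<in> inf_colls"
  shows "\<exists>E'. E' \<sqsubset> E \<and> (\<forall>t\<in>A. P t E')"
  using assms(3,4)
proof (induction A rule: finite_induct)
  case empty
  show ?case using coll_less_refl[OF assms(5)] by blast
next
  case (insert t A)
  then obtain E1 where E1: "E1 \<sqsubset> E" "\<forall>t\<in>A. P t E1" by auto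
  obtain E2 where E2: "E2 \<sqsubset> E1" "P t E2"
    using dense[of t E1] coll_lessD(1)[OF E1(1)] insert.prems by auto
  have "P s E2" if "s \<in> A" for s using her[OF _ E2(1)] E1(2) that by simp
  then show ?case using coll_less_trans[OF E2(1) E1(1)] E2(2) by blast
qed

text \<open>At each stage only finitely many blocks are unions of the members chosen so far, so a
  single thinning of the reservoir settles \<open>P\<close> for all of them. Later members come from
  that reservoir; hence the tail beyond \<open>t\<close> lies below the reservoir for which
  \<open>P t\<close> was settled, and heredity of \<open>P\<close> applies.\<close>

theorem block_fusion:
  assumes her: "\<And>t E E'. P t E \<Longrightarrow> E' \<sqsubset> E \<Longrightarrow> P t E'"
    and dense: "\<And>t E. is_block t \<Longrightarrow> E \<in> inf_colls \<Longrightarrow> \<exists>E'. E' \<sqsubset> E \<and> P t E'"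
    and D: "D \<in> inf_colls"
  obtains E where "E \<sqsubset> D" "\<forall>t\<in>FU E. P t (tail E t)"
proof -
  define I where "I n p \<longleftrightarrow> finite (fst p) \<and> (\<forall>s\<in>fst p. is_block s) \<and> snd p \<in> inf_colls \<and>
    (n = 0 \<longrightarrow> p = ({}, D))" for n :: nat and p
  define Q where "Q p q \<longleftrightarrow> (\<exists>d. d \<in> snd p \<and> (\<forall>s\<in>fst p. s \<lless> d) \<and> fst q = insert d (fst p) \<and>
    snd q \<sqsubset> snd p \<and> (\<forall>t\<in>FU (fst q). P t (snd q)))" for p q :: "nat set set \<times> nat set set"
  have "\<exists>f. \<forall>n. I n (f n) \<and> Q (f n) (f (Suc n))"
  proof (rule dependent_nat_choice)
    show "\<exists>p. I 0 p" using D by (simp add: I_def)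
    fix p and n :: nat
    assume "I n p"
    then have p: "finite (fst p)" "\<forall>s\<in>fst p. is_block s" "snd p \<in> inf_colls" by (simp_all add: I_def)
    define t where "t = insert 1 (\<Union>(fst p))"
    have t: "is_block t" using p(1,2) by (auto simp: t_def is_block_def)
    have "tail (snd p) t \<noteq> {}"
      using tail_in_inf_colls[OF p(3) t] by (auto simp: inf_colls_iff)
    then obtain d where d: "d \<in> snd p" "t \<lless> d" by (auto simp: tail_def)
    have above: "\<forall>s\<in>fst p. s \<lless> d" using d(2) p(2) by (auto simp: block_less_iff t_def)
    let ?S = "insert d (fst p)"
    have S: "finite ?S" "\<forall>s\<in>?S. is_block s" using p d(2) block_lessD(2) by auto
    have S_block: "\<forall>t\<in>FU ?S. is_block t" using FU_block[of _ ?S] S(2) by auto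
    have "\<exists>E. E \<sqsubset> snd p \<and> (\<forall>t\<in>FU ?S. P t E)"
      by (rule hereditary_dense_finite[of P, OF _ _ finite_FU[OF S(1)] S_block p(3)])
        (erule her dense, assumption)+
    then obtain E where E: "E \<sqsubset> snd p" "\<forall>t\<in>FU ?S. P t E" by blast
    show "\<exists>q. I (Suc n) q \<and> Q p q"
    proof (intro exI[of _ "(?S, E)"] conjI)
      show "I (Suc n) (?S, E)" using S coll_lessD(1)[OF E(1)] by (simp add: I_def)
      show "Q p (?S, E)" unfolding Q_def using d(1) above E by (intro exI[of _ d]) simp
    qed
  qed
  then obtain f where f: "\<forall>n. I n (f n) \<and> Q (f n) (f (Suc n))" ..
  define S where "S n = fst (f n)" for n
  define Ds where "Ds n = snd (f n)" for n
  have init: "S 0 = {}" "Ds 0 = D" using spec[OF f, of 0] by (simp_all add: S_def Ds_def I_def)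
  have Ds: "Ds n \<in> inf_colls" for n using spec[OF f, of n] by (simp add: Ds_def I_def)
  have "\<forall>n. \<exists>d. d \<in> Ds n \<and> (\<forall>s\<in>S n. s \<lless> d) \<and> S (Suc n) = insert d (S n) \<and>
    Ds (Suc n) \<sqsubset> Ds n \<and> (\<forall>t\<in>FU (S (Suc n)). P t (Ds (Suc n)))"
    using f unfolding S_def Ds_def Q_def by simp
  from choice[OF this] obtain d where d_all: "\<forall>n. d n \<in> Ds n \<and> (\<forall>s\<in>S n. s \<lless> d n) \<and>
    S (Suc n) = insert (d n) (S n) \<and> Ds (Suc n) \<sqsubset> Ds n \<and>
    (\<forall>t\<in>FU (S (Suc n)). P t (Ds (Suc n)))" ..
  have d: "d n \<in> Ds n" "s \<in> S n \<Longrightarrow> s \<lless> d n" "S (Suc n) = insert (d n) (S n)" "Ds (Suc n) \<sqsubset> Ds n"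
    "t \<in> FU (S (Suc n)) \<Longrightarrow> P t (Ds (Suc n))" for n s t
    using spec[OF d_all, of n] by simp_all
  have S_eq: "S n = d ` {..<n}" for n
    by (induction n) (simp_all add: init d(3) lessThan_Suc)
  have d_less: "d n \<lless> d (Suc n)" for n
    by (rule d(2)) (simp add: S_eq)
  have d_mono: "d m \<lless> d n" if "m < n" for m n using d_less that by (rule block_less_seq)
  have Ds_less: "Ds n \<sqsubset> Ds m" if "m \<le> n" for m n
    using that by (induction rule: dec_induct) (use Ds d(4) in \<open>auto intro: coll_less_refl coll_less_trans\<close>)
  have d_in: "d n \<in> FU (Ds m)" if "m \<le> n" for m n
    using d(1)[of n] subset_FU[of "Ds n"] coll_less_FU[OF Ds_less[OF that]] by auto
  let ?E = "range d"
  have E: "?E \<in> inf_colls" using d_less by (rule range_in_inf_colls)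
  moreover have "?E \<subseteq> FU D" using d_in[of 0] init(2) by auto
  ultimately have "?E \<sqsubset> D" using D by (simp add: coll_less_def)
  moreover have "P t (tail ?E t)" if t: "t \<in> FU ?E" for t
  proof -
    obtain C where C: "t = \<Union>C" "C \<subseteq> ?E" "finite C" "C \<noteq> {}" using t by (rule FU_E)
    obtain J where J: "C = d ` J" "finite J" using finite_subset_image[OF C(3,2)] by blast
    then have J_ne: "J \<noteq> {}" using C(4) by blast
    let ?m = "Max J"
    have "?m \<in> J" using Max_in[OF J(2) J_ne] .
    have "C \<subseteq> S (Suc ?m)" unfolding J(1) S_eq using Max_ge[OF J(2)] by (auto simp: less_Suc_eq_le)
    then have "t \<in> FU (S (Suc ?m))" unfolding C(1) using C(3,4) by (rule Union_in_FU)
    then have P: "P t (Ds (Suc ?m))" by (rule d(5))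
    \<comment> \<open>A member beyond \<open>t\<close> comes after the last member
      \<open>d ?m\<close> used in \<open>t\<close>, so it was drawn from the reservoir thinned for
      \<open>t\<close>.\<close>
    have "k > ?m" if k: "t \<lless> d k" for k
    proof (rule ccontr)
      assume "\<not> k > ?m"
      have "is_block (d ?m)" "d ?m \<subseteq> t"
        using inf_colls_block[OF E] \<open>?m \<in> J\<close> C(1) J(1) by auto
      then have "d ?m \<lless> d k" using k by (auto simp: block_less_iff)
      moreover have "d k \<lless> d ?m \<or> k = ?m" using d_mono[of k ?m] \<open>\<not> k > ?m\<close> by force
      ultimately show False using block_less_Min[of "d ?m" "d k"] block_less_Min[of "d k" "d ?m"] by auto
    qed
    then have "tail ?E t \<subseteq> FU (Ds (Suc ?m))"
      using d_in[of "Suc ?m"] by (auto simp: tail_def Suc_le_eq)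
    moreover have "is_block t" using t inf_colls_block[OF E] by (rule FU_block)
    ultimately have "tail ?E t \<sqsubset> Ds (Suc ?m)"
      using tail_in_inf_colls[OF E] Ds by (simp add: coll_less_def)
    then show ?thesis by (rule her[OF P])
  qed
  ultimately show ?thesis using that by blast
qed

section \<open>Removing the first block\<close>

lemma is_block_Min: "is_block t \<Longrightarrow> 1 \<le> Min t"
  by (auto simp: is_block_def)

text \<open>The empty set belongs to the Schreier family only at \<xi> = 0, so the case distinction
  of the definition disappears.\<close>

lemma block_schreier_iff:
  "s \<in> block_schreier L \<xi> \<longleftrightarrow> s \<in> fin_colls \<and> in_schreier L \<xi> (Min ` s)"
proof (cases "\<xi> = 0")
  case True
  have "{} \<in> fin_colls" by (simp add: fin_colls_iff block_chain_def)
  then show ?thesis using True by (auto simp: block_schreier_def in_schreier_zero_iff)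
next
  case False
  then have "in_schreier L \<xi> (Min ` s) \<Longrightarrow> s \<noteq> {}"
    using in_schreier_block_or_zero[of L \<xi> "Min ` s"] by (auto simp: is_block_def)
  then show ?thesis using False by (auto simp: block_schreier_def schreier_def)
qed

lemma block_schreier_zero: "block_schreier L 0 = {{}}"
  by (simp add: block_schreier_def)

text \<open>Members of a chain are determined by their minima, so \<open>schreier_remove_Min\<close>
  lifts from points to blocks. The second bound says that the ordinals \<open>x n\<close> eventually
  dominate every ordinal below \<xi>; it is what the lower estimate of the index rests on.\<close>

lemma block_schreier_remove_first:
  assumes "limit_approx L" "\<xi> \<noteq> 0"
  obtains x where "\<forall>n\<ge>1. x n < \<xi>" and "\<forall>b<\<xi>. \<exists>N. \<forall>n\<ge>N. b \<le> x n"
    and "\<forall>s. s \<in> block_schreier L \<xi> \<longleftrightarrow> (\<exists>t u. s = insert t u \<and> is_block t \<and>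
      (\<forall>v\<in>u. t \<lless> v) \<and> u \<in> block_schreier L (x (Min t)))"
proof -
  obtain x where x: "\<forall>n\<ge>1. x n < \<xi>" "\<forall>b<\<xi>. \<exists>N. \<forall>n\<ge>N. b \<le> x n"
    "\<forall>s. in_schreier L \<xi> s \<longleftrightarrow>
      (\<exists>n t. s = insert n t \<and> n \<ge> 1 \<and> (\<forall>y\<in>t. n < y) \<and> in_schreier L (x n) t)"
    using assms by (rule schreier_remove_Min)
  have "s \<in> block_schreier L \<xi> \<longleftrightarrow> (\<exists>t u. s = insert t u \<and> is_block t \<and>
      (\<forall>v\<in>u. t \<lless> v) \<and> u \<in> block_schreier L (x (Min t)))" for s
  proof
    assume "s \<in> block_schreier L \<xi>"
    then have s: "finite s" "block_chain s" "in_schreier L \<xi> (Min ` s)"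
      by (simp_all add: block_schreier_iff fin_colls_iff)
    from s(3)[unfolded x(3)[THEN spec]] obtain n m where m: "Min ` s = insert n m" "n \<ge> 1" "\<forall>y\<in>m. n < y"
      "in_schreier L (x n) m" by auto
    from m(1) have "n \<in> Min ` s" by simp
    then obtain t where t: "t \<in> s" "n = Min t" by auto
    let ?u = "s - {t}"
    have Min_u: "Min ` ?u = m"
    proof -
      have "Min ` ?u = Min ` s - {n}"
        using inj_on_image_set_diff[OF block_chain_inj_Min[OF s(2)], of s "{t}"] t by simp
      then show ?thesis using m(1,3) by auto
    qed
    have "t \<lless> v" if "v \<in> ?u" for v
    proof -
      have "Min v \<in> m" using that Min_u by blast
      then show ?thesis using block_chain_less_iff[OF s(2) t(1), of v] that m(3) t(2) by simp
    qed
    moreover have "is_block t" using s(2) t(1) by (simp add: block_chain_def)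
    moreover have "?u \<in> block_schreier L (x (Min t))"
      unfolding block_schreier_iff Min_u fin_colls_iff
      using s(1) block_chain_subset[OF s(2), of ?u] m(4) t(2) by auto
    moreover have "s = insert t ?u" using t(1) by auto
    ultimately show "\<exists>t u. s = insert t u \<and> is_block t \<and>
      (\<forall>v\<in>u. t \<lless> v) \<and> u \<in> block_schreier L (x (Min t))" by metis
  next
    assume "\<exists>t u. s = insert t u \<and> is_block t \<and> (\<forall>v\<in>u. t \<lless> v) \<and> u \<in> block_schreier L (x (Min t))"
    then obtain t u where tu: "s = insert t u" "is_block t" "\<forall>v\<in>u. t \<lless> v"
      "u \<in> block_schreier L (x (Min t))" by blast
    have u: "finite u" "block_chain u" "in_schreier L (x (Min t)) (Min ` u)"
      using tu(4) by (simp_all add: block_schreier_iff fin_colls_iff)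
    have "Min t \<ge> 1" using tu(2) by (rule is_block_Min)
    moreover have "\<forall>y\<in>Min ` u. Min t < y" using tu(3) block_less_Min by auto
    ultimately have "in_schreier L \<xi> (Min ` s)"
      unfolding x(3)[THEN spec] tu(1) image_insert using u(3)
      by (intro exI[of _ "Min t"] exI[of _ "Min ` u"]) simp
    moreover have "block_chain s"
      unfolding tu(1) using block_chain_insert[OF u(2) tu(2)] tu(3) by simp
    ultimately show "s \<in> block_schreier L \<xi>"
      using u(1) tu(1) by (simp add: block_schreier_iff fin_colls_iff)
  qed
  then show ?thesis using x(1,2) that[of x] by simp
qed

lemma first_member:
  assumes "E \<in> inf_colls"
  obtains t where "t \<in> E" "\<forall>d\<in>E - {t}. t \<lless> d" "E - {t} \<in> inf_colls"
proof -
  have E: "infinite E" "block_chain E" using assms by (simp_all add: inf_colls_iff)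
  then have "E \<noteq> {}" by auto
  then obtain s where "s \<in> E" by blast
  then obtain t where t: "t \<in> E" "\<And>d. d \<in> E \<Longrightarrow> Min t \<le> Min d"
    using ex_has_least_nat[of "\<lambda>s. s \<in> E" s Min] by blast
  have "t \<lless> d" if "d \<in> E - {t}" for d
    using that t block_less_Min[of d t] E(2) by (force simp: block_chain_def)
  moreover have "E - {t} \<in> inf_colls"
    using E block_chain_subset[OF E(2), of "E - {t}"] by (auto simp: inf_colls_iff)
  ultimately show ?thesis using that[OF t(1)] by blast
qed

text \<open>This is the front property: after the first member is split off, the induction
  hypothesis applies to the rest. It supplies actual members of the family inside any
  collection.\<close>

lemma block_schreier_initial:
  assumes "limit_approx L"
  shows "E \<in> inf_colls \<Longrightarrow> \<exists>s\<in>block_schreier L \<xi>. s \<subseteq> E \<and> (\<forall>v\<in>s. \<forall>w\<in>E - s. v \<lless> w)"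
proof (induction \<xi> arbitrary: E rule: less_induct)
  case (less \<xi>)
  show ?case
  proof (cases "\<xi> = 0")
    case True
    then show ?thesis by (simp add: block_schreier_zero)
  next
    case False
    obtain x where x: "\<forall>n\<ge>1. x n < \<xi>"
      "\<forall>s. s \<in> block_schreier L \<xi> \<longleftrightarrow> (\<exists>t u. s = insert t u \<and> is_block t \<and>
        (\<forall>v\<in>u. t \<lless> v) \<and> u \<in> block_schreier L (x (Min t)))"
      using assms False by (rule block_schreier_remove_first)
    obtain t where t: "t \<in> E" "\<forall>d\<in>E - {t}. t \<lless> d" "E - {t} \<in> inf_colls"
      using less.prems by (rule first_member)
    have blk: "is_block t" using inf_colls_block[OF less.prems t(1)] .
    then have "x (Min t) < \<xi>" using x(1) is_block_Min by simp
    from less.IH[OF this t(3)] obtain u where u: "u \<in> block_schreier L (x (Min t))" "u \<subseteq> E - {t}"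
      "\<forall>v\<in>u. \<forall>w\<in>E - {t} - u. v \<lless> w" by blast
    have "\<forall>v\<in>u. t \<lless> v" using t(2) u(2) by auto
    then have "insert t u \<in> block_schreier L \<xi>"
      unfolding x(2)[THEN spec] using blk u(1) by (intro exI[of _ t] exI[of _ u]) simp
    moreover have "insert t u \<subseteq> E" using t(1) u(2) by auto
    moreover have "\<forall>v\<in>insert t u. \<forall>w\<in>E - insert t u. v \<lless> w" using t(2) u(3) by auto
    ultimately show ?thesis by blast
  qed
qed

text \<open>For a fixed first block \<open>t\<close>, the induction hypothesis for the family of all
  \<open>u\<close> with \<open>insert t u \<in> F\<close> makes all continuations agree on a
  subcollection. Fusion achieves this for all \<open>t\<close> at once, on the tails; Hindman's
  theorem then makes the answer independent of \<open>t\<close>.\<close>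

theorem block_schreier_ramsey:
  assumes L: "limit_approx L"
  shows "D \<in> inf_colls \<Longrightarrow> \<exists>E. E \<sqsubset> D \<and>
    ((\<forall>s\<in>block_schreier L \<xi>. s \<subseteq> FU E \<longrightarrow> s \<in> F) \<or> (\<forall>s\<in>block_schreier L \<xi>. s \<subseteq> FU E \<longrightarrow> s \<notin> F))"
proof (induction \<xi> arbitrary: D F rule: less_induct)
  case (less \<xi>)
  show ?case
  proof (cases "\<xi> = 0")
    case True
    then show ?thesis using coll_less_refl[OF less.prems]
      by (intro exI[of _ D]) (simp add: block_schreier_zero)
  next
    case False
    obtain x where x: "\<forall>n\<ge>1. x n < \<xi>"
      "\<forall>s. s \<in> block_schreier L \<xi> \<longleftrightarrow> (\<exists>t u. s = insert t u \<and> is_block t \<and>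
        (\<forall>v\<in>u. t \<lless> v) \<and> u \<in> block_schreier L (x (Min t)))"
      using L False by (rule block_schreier_remove_first)
    define In where "In t E \<longleftrightarrow>
      (\<forall>u\<in>block_schreier L (x (Min t)). u \<subseteq> FU E \<longrightarrow> insert t u \<in> F)" for t E
    define Out where "Out t E \<longleftrightarrow>
      (\<forall>u\<in>block_schreier L (x (Min t)). u \<subseteq> FU E \<longrightarrow> insert t u \<notin> F)" for t E
    have "\<exists>E. E \<sqsubset> D \<and> (\<forall>t\<in>FU E. In t (tail E t) \<or> Out t (tail E t))"
    proof -
      obtain E where "E \<sqsubset> D" "\<forall>t\<in>FU E. In t (tail E t) \<or> Out t (tail E t)"
      proof (rule block_fusion[of "\<lambda>t E. In t E \<or> Out t E" D])
        fix t E E' assume "In t E \<or> Out t E" "E' \<sqsubset> E"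
        then show "In t E' \<or> Out t E'"
          using coll_less_FU[of E' E] unfolding In_def Out_def by (meson subset_trans)
      next
        fix t E assume "is_block t" "E \<in> inf_colls"
        then have "x (Min t) < \<xi>" using x(1) is_block_Min by simp
        from less.IH[OF this \<open>E \<in> inf_colls\<close>, of "{u. insert t u \<in> F}"]
        show "\<exists>E'. E' \<sqsubset> E \<and> (In t E' \<or> Out t E')" unfolding In_def Out_def by simp
      qed (use less.prems in auto)
      then show ?thesis by blast
    qed
    then obtain E where E: "E \<sqsubset> D" "\<forall>t\<in>FU E. In t (tail E t) \<or> Out t (tail E t)" by blast
    obtain E' where E': "E' \<sqsubset> E"
      "FU E' \<subseteq> {t. In t (tail E t)} \<or> FU E' \<inter> {t. In t (tail E t)} = {}"
      using coll_lessD(1)[OF E(1)] by (rule hindman)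
    have E_block: "\<And>d. d \<in> E \<Longrightarrow> is_block d" using inf_colls_block[OF coll_lessD(1)[OF E(1)]] .
    have decompose: "\<exists>t u. s = insert t u \<and> t \<in> FU E' \<and> t \<in> FU E \<and>
        u \<in> block_schreier L (x (Min t)) \<and> u \<subseteq> FU (tail E t)"
      if s: "s \<in> block_schreier L \<xi>" "s \<subseteq> FU E'" for s
    proof -
      from x(2)[THEN spec, THEN iffD1, OF s(1)] obtain t u
        where tu: "s = insert t u" "\<forall>v\<in>u. t \<lless> v" "u \<in> block_schreier L (x (Min t))"
        by (elim exE conjE)
      have sub: "FU E' \<subseteq> FU E" using E'(1) by (rule coll_less_FU)
      have "FU (tail E t) = {u \<in> FU E. t \<lless> u}" by (rule FU_tail) (rule E_block)
      then have "u \<subseteq> FU (tail E t)" using tu(1,2) s(2) sub by auto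
      then show ?thesis using tu(1,3) s(2) sub by (intro exI[of _ t] exI[of _ u]) auto
    qed
    from E'(2) show ?thesis
    proof
      assume *: "FU E' \<subseteq> {t. In t (tail E t)}"
      have "s \<in> F" if s: "s \<in> block_schreier L \<xi>" "s \<subseteq> FU E'" for s
      proof -
        obtain t u where tu: "s = insert t u" "t \<in> FU E'" "u \<in> block_schreier L (x (Min t))"
          "u \<subseteq> FU (tail E t)" using decompose[OF s] by (elim exE conjE)
        then have "In t (tail E t)" using * by auto
        then show ?thesis using tu unfolding In_def by simp
      qed
      then show ?thesis using coll_less_trans[OF E'(1) E(1)] by blast
    next
      assume *: "FU E' \<inter> {t. In t (tail E t)} = {}"
      have "s \<notin> F" if s: "s \<in> block_schreier L \<xi>" "s \<subseteq> FU E'" for s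
      proof -
        obtain t u where tu: "s = insert t u" "t \<in> FU E'" "t \<in> FU E"
          "u \<in> block_schreier L (x (Min t))" "u \<subseteq> FU (tail E t)" using decompose[OF s] by (elim exE conjE)
        then have "\<not> In t (tail E t)" using * by auto
        then have "Out t (tail E t)" using E(2) tu(3) by auto
        then show ?thesis using tu unfolding Out_def by simp
      qed
      then show ?thesis using coll_less_trans[OF E'(1) E(1)] by blast
    qed
  qed
qed

section \<open>Initial segments and the hereditary part\<close>

lemma empty_fin_colls: "{} \<in> fin_colls"
  by (simp add: fin_colls_iff block_chain_def)

lemma block_chain_Un:
  assumes "block_chain S" "block_chain T" "\<And>v w. v \<in> S \<Longrightarrow> w \<in> T \<Longrightarrow> v \<lless> w"
  shows "block_chain (S \<union> T)"
  unfolding block_chain_def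
proof (intro conjI ballI)
  show "is_block s" if "s \<in> S \<union> T" for s using that assms(1,2) by (auto simp: block_chain_def)
  show "s = t \<or> s \<lless> t \<or> t \<lless> s" if "s \<in> S \<union> T" "t \<in> S \<union> T" for s t
    using that
  proof (elim UnE)
    show ?thesis if "s \<in> S" "t \<in> S" using that assms(1) by (simp add: block_chain_def)
    show ?thesis if "s \<in> T" "t \<in> T" using that assms(2) by (simp add: block_chain_def)
    show ?thesis if "s \<in> S" "t \<in> T" using that assms(3) by simp
    show ?thesis if "s \<in> T" "t \<in> S" using that assms(3) by simp
  qed
qed

lemma fin_colls_subset: "s \<in> fin_colls \<Longrightarrow> t \<subseteq> s \<Longrightarrow> t \<in> fin_colls"
  using block_chain_subset finite_subset by (auto simp: fin_colls_iff)

lemma fin_colls_insert: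
  assumes "s \<in> fin_colls" "is_block t" "\<forall>v\<in>s. v \<lless> t"
  shows "insert t s \<in> fin_colls"
  using assms by (auto simp: fin_colls_iff block_chain_def)

lemma fin_colls_in_iff: "s \<in> fin_colls_in D \<longleftrightarrow> s \<in> fin_colls \<and> s \<subseteq> FU D"
  by (simp add: fin_colls_in_def)

lemma init_segI:
  assumes "s \<in> fin_colls" "t \<subseteq> s" "\<forall>v\<in>t. \<forall>w\<in>s - t. v \<lless> w"
  shows "t \<propto> s"
proof -
  obtain ts where ts: "t = set ts" "block_seq ts"
    using fin_colls_subset[OF assms(1,2)] by (auto simp: fin_colls_def)
  have "s - t \<in> fin_colls" using fin_colls_subset[OF assms(1)] by blast
  then obtain us where us: "s - t = set us" "block_seq us" by (auto simp: fin_colls_def)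
  have "block_seq (ts @ us)"
    using ts us assms(3) by (simp add: block_seq_def sorted_wrt_append)
  moreover have "s = set (ts @ us)" using ts(1) us(1) assms(2) by auto
  ultimately show ?thesis unfolding init_seg_def using ts(1) prefixI[of "ts @ us" ts us] by metis
qed

lemma above_in_inf_coll:
  assumes "E \<in> inf_colls" "s \<in> fin_colls"
  obtains t where "t \<in> E" "\<forall>v\<in>s. v \<lless> t" "N < Min t"
proof -
  \<comment> \<open>A block beyond \<open>Suc N\<close> has its minimum above \<open>N\<close>; the
    point also keeps \<open>b\<close> nonempty for \<open>s = {}\<close>.\<close>
  define b where "b = insert (Suc N) (\<Union>s)"
  have s: "finite s" "\<forall>v\<in>s. is_block v" using assms(2) by (auto simp: fin_colls_iff block_chain_def)
  then have b: "is_block b" by (auto simp: b_def is_block_def)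
  have "tail E b \<noteq> {}" using tail_in_inf_colls[OF assms(1) b] by (auto simp: inf_colls_iff)
  then obtain t where t: "t \<in> E" "b \<lless> t" by (auto simp: tail_def)
  have "Suc N < x" if "x \<in> t" for x using t(2) that by (auto simp: block_less_iff b_def)
  moreover have "Min t \<in> t" using block_lessD(2)[OF t(2)] by (simp add: is_block_def)
  ultimately have "Suc N < Min t" by blast
  moreover have "\<forall>v\<in>s. v \<lless> t" using t(2) s(2) by (auto simp: block_less_iff b_def)
  ultimately show ?thesis using that[OF t(1)] by simp
qed

lemma hered_part_subset: "F \<subseteq> fin_colls \<Longrightarrow> hered_part F \<subseteq> fin_colls"
  using empty_fin_colls by (auto simp: hered_part_def)

lemma hered_part_hereditary:
  assumes "s \<in> hered_part F" "t \<in> fin_colls" "t \<subseteq> FU s"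
  shows "t \<in> hered_part F"
proof (cases "t = {}")
  case False
  then have "s \<noteq> {}" using assms(3) by auto
  then have s: "\<forall>u\<in>fin_colls. u \<subseteq> FU s \<longrightarrow> u \<in> F" using assms(1) by (auto simp: hered_part_def)
  moreover have "FU t \<subseteq> FU s" using assms(3) by (rule FU_closed)
  ultimately show ?thesis using assms(2,3) by (auto simp: hered_part_def)
qed (simp add: hered_part_def)

lemma is_treeD:
  assumes "is_tree F"
  shows "{} \<in> F" "s \<in> F \<Longrightarrow> t \<propto> s \<Longrightarrow> t \<in> F"
proof -
  have "init_closure F = F" using assms by (simp add: is_tree_def)
  then show "{} \<in> F" "s \<in> F \<Longrightarrow> t \<propto> s \<Longrightarrow> t \<in> F" unfolding init_closure_def by blast+
qed

section \<open>The strong block derivative\<close>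

text \<open>The form of heredity that is carried along the derivatives. It ensures that a nonempty
  derivative contains the empty collection, so that only this collection has to be followed.\<close>

definition subset_closed :: "nat set set set \<Rightarrow> bool" where
  "subset_closed G \<longleftrightarrow> (\<forall>s\<in>G. \<forall>t. t \<subseteq> s \<longrightarrow> t \<in> G)"

lemma subset_closedD: "subset_closed G \<Longrightarrow> s \<in> G \<Longrightarrow> t \<subseteq> s \<Longrightarrow> t \<in> G"
  by (simp add: subset_closed_def)

lemma subset_closed_fin_colls_in: "subset_closed (fin_colls_in D)"
  unfolding subset_closed_def
proof (intro ballI allI impI)
  fix s t assume "s \<in> fin_colls_in D" "t \<subseteq> s"
  then show "t \<in> fin_colls_in D" using fin_colls_subset[of s t] by (auto simp: fin_colls_in_iff)
qed

lemma subset_closed_Int: "subset_closed G \<Longrightarrow> subset_closed H \<Longrightarrow> subset_closed (G \<inter> H)"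
  unfolding subset_closed_def by auto

lemma subset_closed_hered_part:
  assumes "F \<subseteq> fin_colls"
  shows "subset_closed (hered_part F)"
  unfolding subset_closed_def
proof (intro ballI allI impI)
  fix s t assume s: "s \<in> hered_part F" "t \<subseteq> s"
  then have "s \<in> fin_colls" using hered_part_subset[OF assms] by auto
  then have "t \<in> fin_colls" using s(2) by (rule fin_colls_subset)
  moreover have "t \<subseteq> FU s" using s(2) subset_FU[of s] by simp
  ultimately show "t \<in> hered_part F" by (rule hered_part_hereditary[OF s(1)])
qed

lemma sb_deriv1_subset: "sb_deriv1 D G \<subseteq> G"
  by (auto simp: sb_deriv1_def)

lemma sb_deriv_antimono: "a \<le> b \<Longrightarrow> sb_deriv D G b \<subseteq> sb_deriv D G a"
proof (induction b rule: less_induct)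
  case (less b)
  show ?case
  proof (cases "a = b")
    case False
    then have "a < b" using less.prems by simp
    show ?thesis
    proof (cases b rule: omega1_cases)
      case zero
      then show ?thesis using \<open>a < b\<close> by simp
    next
      case (succ c)
      then have "a \<le> c" using \<open>a < b\<close> by (simp add: less_osucc_iff)
      then show ?thesis
        using less.IH[of c] succ sb_deriv1_subset[of D "sb_deriv D G c"] by (auto simp: sb_deriv_osucc)
    next
      case limit
      then show ?thesis using \<open>a < b\<close> by (auto simp: sb_deriv_limit)
    qed
  qed simp
qed

lemma sb_deriv_subset: "sb_deriv D G a \<subseteq> G \<inter> fin_colls_in D"
  using sb_deriv_antimono[of 0 a D G] by (simp add: sb_deriv_zero)

text \<open>A block that is exceptional for a subset of \<open>s\<close> is exceptional for
  \<open>s\<close>, so exceptional sets only shrink when members are dropped.\<close>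

lemma subset_closed_sb_deriv:
  assumes "subset_closed G"
  shows "subset_closed (sb_deriv D G a)"
proof (induction a rule: less_induct)
  case (less a)
  show ?case
  proof (cases a rule: omega1_cases)
    case zero
    then show ?thesis
      using assms subset_closed_fin_colls_in by (simp add: sb_deriv_zero subset_closed_Int)
  next
    case (succ b)
    let ?H = "sb_deriv D G b"
    have H: "subset_closed ?H" using less[of b] succ by simp
    have "t \<in> sb_deriv1 D ?H" if st: "s \<in> sb_deriv1 D ?H" "t \<subseteq> s" for s t
    proof -
      have "s \<in> ?H" using st(1) sb_deriv1_subset by blast
      then have "t \<in> ?H" using st(2) by (rule subset_closedD[OF H])
      moreover have "t \<in> fin_colls_in D" using calculation sb_deriv_subset[of D G b] by auto
      moreover have "{v \<in> FU D. t \<union> {v} \<notin> ?H} \<subseteq> {v \<in> FU D. s \<union> {v} \<notin> ?H}"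
        using subset_closedD[OF H, of _ "t \<union> {_}"] st(2) by (auto simp: subset_insertI2)
      ultimately show ?thesis using st(1) unfolding sb_deriv1_def by auto
    qed
    then show ?thesis unfolding succ sb_deriv_osucc subset_closed_def by blast
  next
    case limit
    then show ?thesis using less unfolding sb_deriv_limit[OF limit] subset_closed_def by auto
  qed
qed

text \<open>Fewer blocks are available in \<open>E\<close>, hence fewer exceptional ones, and
  survival becomes easier. This moves nonempty derivatives to the subcollection on which the
  dichotomy has been decided.\<close>

lemma sb_deriv_coll_less:
  assumes "E \<sqsubset> D"
  shows "sb_deriv D G a \<inter> fin_colls_in E \<subseteq> sb_deriv E G a"
proof (induction a rule: less_induct)
  case (less a)
  show ?case
  proof (cases a rule: omega1_cases)
    case zero
    then show ?thesis by (auto simp: sb_deriv_zero)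
  next
    case (succ b)
    have IH: "sb_deriv D G b \<inter> fin_colls_in E \<subseteq> sb_deriv E G b" using less[of b] succ by simp
    show ?thesis
    proof
      fix s assume s: "s \<in> sb_deriv D G a \<inter> fin_colls_in E"
      then have s': "s \<in> sb_deriv1 D (sb_deriv D G b)" "s \<in> fin_colls_in E"
        by (simp_all add: succ sb_deriv_osucc)
      then have "s \<in> sb_deriv E G b" using IH sb_deriv1_subset by blast
      moreover have "{v \<in> FU E. s \<union> {v} \<notin> sb_deriv E G b} \<subseteq> {v \<in> FU D. s \<union> {v} \<notin> sb_deriv D G b}"
      proof
        fix v assume v: "v \<in> {v \<in> FU E. s \<union> {v} \<notin> sb_deriv E G b}"
        have "s \<union> {v} \<notin> sb_deriv D G b"
        proof
          assume v': "s \<union> {v} \<in> sb_deriv D G b"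
          then have "s \<union> {v} \<in> fin_colls" using sb_deriv_subset[of D G b] by (auto simp: fin_colls_in_iff)
          then have "s \<union> {v} \<in> fin_colls_in E" using v s'(2) by (simp add: fin_colls_in_iff)
          then show False using IH v v' by auto
        qed
        then show "v \<in> {v \<in> FU D. s \<union> {v} \<notin> sb_deriv D G b}"
          using v coll_less_FU[OF assms] by auto
      qed
      ultimately show "s \<in> sb_deriv E G a"
        using s' unfolding succ sb_deriv_osucc sb_deriv1_def by auto
    qed
  next
    case limit
    then show ?thesis using less unfolding sb_deriv_limit[OF limit] by blast
  qed
qed

text \<open>The tail of \<open>D\<close> beyond all of \<open>s\<close> is an infinite collection,
  so it cannot consist of exceptional blocks alone.\<close>

lemma sb_deriv_osucc_child:
  assumes "D \<in> inf_colls" "s \<in> sb_deriv D G (osucc a)"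
  obtains t where "t \<in> FU D" "\<forall>v\<in>s. v \<lless> t" "insert t s \<in> sb_deriv D G a"
proof -
  have s: "s \<in> sb_deriv1 D (sb_deriv D G a)" using assms(2) by (simp add: sb_deriv_osucc)
  then have "s \<in> fin_colls" by (simp add: sb_deriv1_def fin_colls_in_iff)
  then have fs: "finite s" "\<forall>v\<in>s. is_block v" by (auto simp: fin_colls_iff block_chain_def)
  define b where "b = insert 1 (\<Union>s)"
  have b: "is_block b" using fs by (auto simp: b_def is_block_def)
  have "\<not> tail D b \<subseteq> {v \<in> FU D. s \<union> {v} \<notin> sb_deriv D G a}"
    using s tail_in_inf_colls[OF assms(1) b] by (auto simp: sb_deriv1_def)
  moreover have "tail D b \<subseteq> FU D" using subset_FU[of D] by (auto simp: tail_def)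
  ultimately obtain t where t: "t \<in> FU D" "t \<in> tail D b" "insert t s \<in> sb_deriv D G a" by auto
  have "\<forall>v\<in>s. v \<lless> t" using t(2) fs(2) by (auto simp: tail_def block_less_iff b_def)
  then show ?thesis using that t by blast
qed

lemma block_schreier_insertI:
  assumes "\<forall>s. s \<in> B \<longleftrightarrow> (\<exists>t u. s = insert t u \<and> is_block t \<and> (\<forall>v\<in>u. t \<lless> v) \<and> u \<in> C t)"
    and "is_block t" "\<forall>v\<in>u. t \<lless> v" "u \<in> C t"
  shows "insert t u \<in> B"
  using assms(2-) unfolding assms(1)[THEN spec] by (intro exI[of _ t] exI[of _ u]) simp

text \<open>Stated for continuations of \<open>s\<close>, because each step moves the first block of
  \<open>u\<close> over to \<open>s\<close>. By induction \<open>insert t s\<close> survives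
  \<open>x (Min t)\<close> derivatives, hence \<open>b\<close> derivatives once \<open>Min t\<close>
  is large, for any \<open>b < \<xi>\<close>. Every infinite collection contains blocks with large
  minimum beyond \<open>s\<close>, so \<open>s\<close> survives \<open>osucc b\<close> derivatives
  for each such \<open>b\<close>.\<close>

lemma sb_deriv_lower:
  assumes L: "limit_approx L" and D: "D \<in> inf_colls" and G: "subset_closed G"
  shows "s \<in> fin_colls_in D \<Longrightarrow>
    \<forall>u\<in>block_schreier L \<xi>. u \<subseteq> FU D \<longrightarrow> (\<forall>v\<in>s. \<forall>w\<in>u. v \<lless> w) \<longrightarrow> s \<union> u \<in> G \<Longrightarrow>
    s \<in> sb_deriv D G \<xi>"
proof (induction \<xi> arbitrary: s rule: less_induct)
  case (less \<xi>)
  show ?case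
  proof (cases "\<xi> = 0")
    case True
    then show ?thesis using less.prems by (simp add: block_schreier_zero sb_deriv_zero)
  next
    case False
    obtain x where x: "\<forall>n\<ge>1. x n < \<xi>" "\<forall>b<\<xi>. \<exists>N. \<forall>n\<ge>N. b \<le> x n"
      "\<forall>s. s \<in> block_schreier L \<xi> \<longleftrightarrow> (\<exists>t u. s = insert t u \<and> is_block t \<and>
        (\<forall>v\<in>u. t \<lless> v) \<and> u \<in> block_schreier L (x (Min t)))"
      using L False by (rule block_schreier_remove_first)
    have s: "s \<in> fin_colls" "s \<subseteq> FU D" using less.prems(1) by (simp_all add: fin_colls_in_iff)
    have child: "insert t s \<in> sb_deriv D G (x (Min t))" if t: "t \<in> FU D" "\<forall>v\<in>s. v \<lless> t" for t
    proof -
      have blk: "is_block t" using t(1) inf_colls_block[OF D] by (rule FU_block)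
      have lt: "x (Min t) < \<xi>" using x(1) is_block_Min[OF blk] by simp
      have fc: "insert t s \<in> fin_colls_in D"
        using fin_colls_insert[OF s(1) blk t(2)] t(1) s(2) by (simp add: fin_colls_in_iff)
      show ?thesis
      proof (rule less.IH[OF lt fc], intro ballI impI)
        fix u assume u: "u \<in> block_schreier L (x (Min t))" "u \<subseteq> FU D" "\<forall>v\<in>insert t s. \<forall>w\<in>u. v \<lless> w"
        have "insert t u \<in> block_schreier L \<xi>"
          using block_schreier_insertI[OF x(3) blk _ u(1)] u(3) by simp
        moreover have "insert t u \<subseteq> FU D" "\<forall>v\<in>s. \<forall>w\<in>insert t u. v \<lless> w" using u(2,3) t by auto
        ultimately have "s \<union> insert t u \<in> G" using less.prems(2) by blast
        then show "insert t s \<union> u \<in> G" by simp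
      qed
    qed
    have below: "s \<in> sb_deriv D G (osucc b)" if b: "b < \<xi>" for b
    proof -
      obtain N where N: "\<forall>n\<ge>N. b \<le> x n" using x(2) b by blast
      have child': "insert t s \<in> sb_deriv D G b" if "t \<in> FU D" "\<forall>v\<in>s. v \<lless> t" "N < Min t" for t
        using child[OF that(1,2)] sb_deriv_antimono[of b "x (Min t)" D G] N that(3) by auto
      obtain t where "t \<in> D" "\<forall>v\<in>s. v \<lless> t" "N < Min t" using D s(1) by (rule above_in_inf_coll)
      then have "insert t s \<in> sb_deriv D G b" using child' subset_FU[of D] by auto
      \<comment> \<open>A derivative presupposes membership of \<open>s\<close> itself, which is
        inherited from a single surviving extension.\<close>
      then have "s \<in> sb_deriv D G b"
        by (rule subset_closedD[OF subset_closed_sb_deriv[OF G]]) auto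
      moreover have "\<not> E \<subseteq> {t \<in> FU D. s \<union> {t} \<notin> sb_deriv D G b}" if E: "E \<in> inf_colls" for E
      proof
        assume *: "E \<subseteq> {t \<in> FU D. s \<union> {t} \<notin> sb_deriv D G b}"
        obtain t where t: "t \<in> E" "\<forall>v\<in>s. v \<lless> t" "N < Min t" using E s(1) by (rule above_in_inf_coll)
        then show False using * child'[of t] by auto
      qed
      ultimately show ?thesis using less.prems(1) unfolding sb_deriv_osucc sb_deriv1_def by auto
    qed
    show ?thesis
    proof (cases \<xi> rule: omega1_cases)
      case zero
      then show ?thesis using False by simp
    next
      case (succ b)
      then show ?thesis using below[of b] by simp
    next
      case limit
      have "s \<in> sb_deriv D G b" if "b < \<xi>" for b
        using below[OF that] sb_deriv_antimono[of b "osucc b" D G] by (auto simp: less_imp_le)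
      then show ?thesis by (simp add: sb_deriv_limit[OF limit])
    qed
  qed
qed

text \<open>One surviving child suffices for a contradiction, since
  \<open>osucc (x (Min t)) \<le> \<xi>\<close> makes the induction hypothesis applicable to it. The
  additional derivative yields a child that survives all \<xi> derivatives; at a limit, a child
  surviving some smaller number \<open>b\<close> could have \<open>x (Min t)\<close> above
  \<open>b\<close>.\<close>

lemma sb_deriv_upper:
  assumes L: "limit_approx L" and D: "D \<in> inf_colls"
  shows "\<forall>u\<in>block_schreier L \<xi>. u \<subseteq> FU D \<longrightarrow> (\<forall>v\<in>s. \<forall>w\<in>u. v \<lless> w) \<longrightarrow> s \<union> u \<notin> G \<Longrightarrow>
    s \<notin> sb_deriv D G (osucc \<xi>)"
proof (induction \<xi> arbitrary: s rule: less_induct)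
  case (less \<xi>)
  show ?case
  proof (cases "\<xi> = 0")
    case True
    then have "s \<notin> G" using less.prems by (simp add: block_schreier_zero)
    then show ?thesis using sb_deriv_subset[of D G] by blast
  next
    case False
    obtain x where x: "\<forall>n\<ge>1. x n < \<xi>"
      "\<forall>s. s \<in> block_schreier L \<xi> \<longleftrightarrow> (\<exists>t u. s = insert t u \<and> is_block t \<and>
        (\<forall>v\<in>u. t \<lless> v) \<and> u \<in> block_schreier L (x (Min t)))"
      using L False by (rule block_schreier_remove_first)
    show ?thesis
    proof
      assume "s \<in> sb_deriv D G (osucc \<xi>)"
      with D obtain t where t: "t \<in> FU D" "\<forall>v\<in>s. v \<lless> t" "insert t s \<in> sb_deriv D G \<xi>"
        by (rule sb_deriv_osucc_child)
      have blk: "is_block t" using t(1) inf_colls_block[OF D] by (rule FU_block)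
      have lt: "x (Min t) < \<xi>" using x(1) is_block_Min[OF blk] by simp
      then have "insert t s \<in> sb_deriv D G (osucc (x (Min t)))"
        using t(3) sb_deriv_antimono[of "osucc (x (Min t))" \<xi> D G] by (auto simp: osucc_le_iff)
      moreover have "insert t s \<notin> sb_deriv D G (osucc (x (Min t)))"
      proof (rule less.IH[OF lt], intro ballI impI)
        fix u assume u: "u \<in> block_schreier L (x (Min t))" "u \<subseteq> FU D" "\<forall>v\<in>insert t s. \<forall>w\<in>u. v \<lless> w"
        have "insert t u \<in> block_schreier L \<xi>"
          using block_schreier_insertI[OF x(2) blk _ u(1)] u(3) by simp
        moreover have "insert t u \<subseteq> FU D" "\<forall>v\<in>s. \<forall>w\<in>insert t u. v \<lless> w" using u(2,3) t by auto
        ultimately have "s \<union> insert t u \<notin> G" using less.prems by blast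
        then show "insert t s \<union> u \<notin> G" by simp
      qed
      ultimately show False by simp
    qed
  qed
qed

text \<open>Adding blocks of \<open>FU D\<close> at the end is a well-founded operation inside
  \<open>G\<close>, because an infinite run would be a branch. Recursion on this relation bounds how
  long each \<open>s\<close> survives, and the relation depends on \<open>D\<close> alone, so the
  bound is uniform in \<open>E\<close>.\<close>

lemma sb_deriv_eventually_empty:
  assumes G: "subset_closed G" "G \<subseteq> fin_colls"
    and no_branch: "\<not> (\<exists>C\<in>inf_colls. C \<subseteq> FU D \<and> (\<forall>s. finite s \<longrightarrow> s \<subseteq> C \<longrightarrow> s \<in> G))"
  shows "\<exists>b. \<forall>E. E \<sqsubset> D \<longrightarrow> sb_deriv E G b = {}"
proof -
  define R where "R = {(s', s). s \<in> G \<and> s' \<in> G \<and> (\<exists>t\<in>FU D. (\<forall>v\<in>s. v \<lless> t) \<and> s' = insert t s)}"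
  have "wf R"
    unfolding wf_iff_no_infinite_down_chain
  proof
    assume "\<exists>f. \<forall>i. (f (Suc i), f i) \<in> R"
    then obtain f where f: "\<forall>i. (f (Suc i), f i) \<in> R" ..
    then have "\<forall>i. \<exists>t. t \<in> FU D \<and> (\<forall>v\<in>f i. v \<lless> t) \<and> f (Suc i) = insert t (f i)"
      by (simp add: R_def Bex_def)
    from choice[OF this] obtain t
      where t: "\<forall>i. t i \<in> FU D \<and> (\<forall>v\<in>f i. v \<lless> t i) \<and> f (Suc i) = insert (t i) (f i)" ..
    have "t i \<lless> t (Suc i)" for i using t by auto
    then have "range t \<in> inf_colls" by (rule range_in_inf_colls)
    moreover have "range t \<subseteq> FU D" using t by auto
    moreover have "s \<in> G" if s: "finite s" "s \<subseteq> range t" for s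
    proof -
      obtain I where I: "finite I" "s = t ` I" using finite_subset_image[OF s] by auto
      obtain n where n: "I \<subseteq> {..<n}" using I(1) finite_nat_iff_bounded by auto
      have "t ` {..<n} \<subseteq> f n" by (induction n) (use t in \<open>auto simp: lessThan_Suc\<close>)
      then have "s \<subseteq> f n" using I(2) n by auto
      moreover have "f n \<in> G" using f by (auto simp: R_def)
      ultimately show ?thesis using subset_closedD[OF G(1)] by simp
    qed
    ultimately show False using no_branch by blast
  qed
  then have "\<exists>b. \<forall>E. E \<sqsubset> D \<longrightarrow> s \<notin> sb_deriv E G b" for s
  proof (induction s rule: wf_induct_rule)
    case (less s)
    \<comment> \<open>The values at sets \<open>t\<close> that give no child are arbitrary; they are
      included in the bound \<open>c\<close> without harm, because there are only countably many
      finite sets of numbers.\<close>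
    define b where "b t = (SOME b. \<forall>E. E \<sqsubset> D \<longrightarrow> insert t s \<notin> sb_deriv E G b)" for t
    have b: "insert t s \<notin> sb_deriv E G (b t)" if "(insert t s, s) \<in> R" "E \<sqsubset> D" for t E
      using someI_ex[OF less[OF that(1)]] that(2) by (simp add: b_def)
    have "countable (b ` Collect finite)"
      by (rule countable_image) (rule countable_Collect_finite)
    then have "bdd_above (b ` Collect finite)" by (rule countable_bdd_above_omega1)
    then obtain c where c: "\<And>t. finite t \<Longrightarrow> b t \<le> c" by (auto simp: bdd_above_def)
    have "s \<notin> sb_deriv E G (osucc c)" if E: "E \<sqsubset> D" for E
    proof
      assume s: "s \<in> sb_deriv E G (osucc c)"
      obtain t where t: "t \<in> FU E" "\<forall>v\<in>s. v \<lless> t" "insert t s \<in> sb_deriv E G c"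
        using coll_lessD(1)[OF E] s by (rule sb_deriv_osucc_child)
      have "s \<in> G" "insert t s \<in> G" using s t(3) sb_deriv_subset[of E G] by auto
      then have "(insert t s, s) \<in> R" using t(1,2) coll_less_FU[OF E] by (auto simp: R_def)
      then have "insert t s \<notin> sb_deriv E G (b t)" using E by (rule b)
      moreover have "is_block t"
        using t(1) inf_colls_block[OF coll_lessD(1)[OF E]] by (rule FU_block)
      then have "sb_deriv E G c \<subseteq> sb_deriv E G (b t)"
        by (intro sb_deriv_antimono c) (simp add: is_block_def)
      ultimately show False using t(3) by auto
    qed
    then show ?case by blast
  qed
  then obtain b where b: "\<And>E. E \<sqsubset> D \<Longrightarrow> {} \<notin> sb_deriv E G b" by blast
  have "sb_deriv E G b = {}" if "E \<sqsubset> D" for E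
    using b[OF that] subset_closedD[OF subset_closed_sb_deriv[OF G(1)], of _ E b "{}"] by auto
  then show ?thesis by blast
qed

section \<open>From a tree to its hereditary part\<close>

lemma FU_finite_support:
  assumes "finite s" "s \<subseteq> FU C"
  shows "\<exists>K. K \<subseteq> C \<and> finite K \<and> s \<subseteq> FU K"
  using assms
proof (induction s rule: finite_induct)
  case (insert t s)
  then obtain K where K: "K \<subseteq> C" "finite K" "s \<subseteq> FU K" by auto
  have "t \<in> FU C" using insert.prems by simp
  then obtain J where J: "t = \<Union>J" "J \<subseteq> C" "finite J" "J \<noteq> {}" by (rule FU_E)
  have "t \<in> FU J" unfolding J(1) using J(3,4) by (intro Union_in_FU) auto
  then have "insert t s \<subseteq> FU (K \<union> J)"
    using K(3) FU_mono[of K "K \<union> J"] FU_mono[of J "K \<union> J"] by auto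
  then show ?case using K(1,2) J(2,3) by (intro exI[of _ "K \<union> J"]) auto
qed auto

text \<open>Each member of \<open>t\<close> contains a member of \<open>s\<close>, and different
  members of \<open>t\<close> are disjoint, so choosing one for each is injective.\<close>

lemma card_le_of_subset_FU:
  assumes "s \<in> fin_colls" "t \<in> fin_colls" "t \<subseteq> FU s"
  shows "card t \<le> card s"
proof -
  have "\<forall>v\<in>t. \<exists>c. c \<in> s \<and> c \<subseteq> v"
  proof
    fix v assume "v \<in> t"
    then have "v \<in> FU s" using assms(3) by auto
    then obtain C where "v = \<Union>C" "C \<subseteq> s" "C \<noteq> {}" by (rule FU_E)
    then show "\<exists>c. c \<in> s \<and> c \<subseteq> v" by auto
  qed
  from bchoice[OF this] obtain c where c: "\<forall>v\<in>t. c v \<in> s \<and> c v \<subseteq> v" ..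
  have s: "finite s" "\<forall>v\<in>s. is_block v" using assms(1) by (auto simp: fin_colls_iff block_chain_def)
  have "inj_on c t"
  proof (rule inj_onI, rule ccontr)
    fix v w assume vw: "v \<in> t" "w \<in> t" "c v = c w" "v \<noteq> w"
    then have "v \<lless> w \<or> w \<lless> v" using assms(2) by (auto simp: fin_colls_iff block_chain_def)
    then have "v \<inter> w = {}" by (auto simp: block_less_iff)
    moreover have "c v \<subseteq> v \<inter> w" using c vw by auto
    moreover have "c v \<noteq> {}" using c vw(1) s(2) by (auto simp: is_block_def)
    ultimately show False by auto
  qed
  then show ?thesis using s(1) c by (intro card_inj_on_le[of c]) auto
qed

text \<open>Prolong \<open>t\<close> by a tail of \<open>D\<close> to an infinite collection and
  take its initial segment in the Schreier family: two initial segments of the same collection are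
  comparable.\<close>

lemma block_schreier_comparable:
  assumes L: "limit_approx L" and D: "D \<in> inf_colls" and t: "t \<in> fin_colls" "t \<subseteq> FU D"
  obtains t0 where "t0 \<in> block_schreier L \<xi>" "t0 \<subseteq> FU D" "t0 \<subset> t \<and> t0 \<propto> t \<or> t \<propto> t0"
proof -
  have t': "finite t" "\<forall>v\<in>t. is_block v" "block_chain t"
    using t(1) by (auto simp: fin_colls_iff block_chain_def)
  define b where "b = insert 1 (\<Union>t)"
  have b: "is_block b" using t' by (auto simp: b_def is_block_def)
  let ?T = "tail D b"
  have T: "?T \<in> inf_colls" using tail_in_inf_colls[OF D b] .
  have less: "v \<lless> w" if "v \<in> t" "w \<in> ?T" for v w
    using that t'(2) by (auto simp: tail_def block_less_iff b_def)
  let ?E = "t \<union> ?T"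
  have "block_chain ?E"
    using t'(3) T less by (intro block_chain_Un) (auto simp: inf_colls_iff)
  then have "?E \<in> inf_colls" using T by (simp add: inf_colls_iff)
  from block_schreier_initial[OF L this, of \<xi>] obtain t0
    where t0: "t0 \<in> block_schreier L \<xi>" "t0 \<subseteq> ?E" "\<forall>v\<in>t0. \<forall>w\<in>?E - t0. v \<lless> w" by auto
  have "?T \<subseteq> FU D" using subset_FU[of D] by (auto simp: tail_def)
  then have "t0 \<subseteq> FU D" using t0(2) t(2) by auto
  moreover have "t0 \<subset> t \<and> t0 \<propto> t \<or> t \<propto> t0"
  proof (cases "t \<subseteq> t0")
    case True
    have "t0 \<in> fin_colls" using t0(1) by (simp add: block_schreier_iff)
    then have "t \<propto> t0" using True by (rule init_segI) (use t0(2) less in auto)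
    then show ?thesis ..
  next
    case False
    then obtain w where w: "w \<in> t" "w \<notin> t0" by auto
    have "v \<in> t" if "v \<in> t0" for v
    proof (rule ccontr)
      assume "v \<notin> t"
      then have "w \<lless> v" using less[OF w(1), of v] t0(2) that by auto
      moreover have "v \<lless> w" using t0(3) that w by auto
      ultimately show False using block_less_Min[of v w] block_less_Min[of w v] by simp
    qed
    then have "t0 \<subseteq> t" by auto
    moreover from this have "t0 \<propto> t" using t0(3) by (intro init_segI[OF t(1)]) auto
    ultimately show ?thesis using w by auto
  qed
  ultimately show ?thesis using that t0(1) by blast
qed

text \<open>By Ramsey it suffices to find one member of \<open>block_schreier L \<xi>\<close> in the hereditary part.
  A member \<open>s\<close> with the least number of blocks will do: no collection in \<open>FU s\<close> can properly extend
  a member of \<open>block_schreier L \<xi>\<close>, so it is an initial segment of one.\<close>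

lemma block_schreier_hered_part:
  assumes L: "limit_approx L" and F: "is_tree F" and D: "D \<in> inf_colls"
    and sub: "\<forall>s\<in>block_schreier L \<xi>. s \<subseteq> FU D \<longrightarrow> s \<in> F"
  obtains E where "E \<sqsubset> D" "\<forall>s\<in>block_schreier L \<xi>. s \<subseteq> FU E \<longrightarrow> s \<in> hered_part F"
proof -
  obtain E where E: "E \<sqsubset> D"
    "(\<forall>s\<in>block_schreier L \<xi>. s \<subseteq> FU E \<longrightarrow> s \<in> hered_part F) \<or>
     (\<forall>s\<in>block_schreier L \<xi>. s \<subseteq> FU E \<longrightarrow> s \<notin> hered_part F)"
    using block_schreier_ramsey[OF L D, of \<xi> "hered_part F"] by blast
  have "\<not> (\<forall>s\<in>block_schreier L \<xi>. s \<subseteq> FU E \<longrightarrow> s \<notin> hered_part F)"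
  proof -
    let ?P = "\<lambda>s. s \<in> block_schreier L \<xi> \<and> s \<subseteq> FU E"
    obtain s1 where "?P s1"
      using block_schreier_initial[OF L coll_lessD(1)[OF E(1)], of \<xi>] subset_FU[of E] by blast
    then obtain s where s: "?P s" "\<And>t. ?P t \<Longrightarrow> card s \<le> card t"
      using ex_has_least_nat[of ?P s1 card] by blast
    have fs: "s \<in> fin_colls" using s(1) by (simp add: block_schreier_iff)
    have sub': "t \<in> F" if "?P t" for t using that sub coll_less_FU[OF E(1)] by auto
    have "t \<in> F" if t: "t \<in> fin_colls" "t \<subseteq> FU s" for t
    proof -
      have FUE: "t \<subseteq> FU E" using t(2) FU_closed[of s E] s(1) by auto
      obtain t0 where t0: "t0 \<in> block_schreier L \<xi>" "t0 \<subseteq> FU E" "t0 \<subset> t \<and> t0 \<propto> t \<or> t \<propto> t0"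
        using L coll_lessD(1)[OF E(1)] t(1) FUE by (rule block_schreier_comparable)
      have "\<not> t0 \<subset> t"
      proof
        assume "t0 \<subset> t"
        then have "card t0 < card t" using t(1) by (intro psubset_card_mono) (auto simp: fin_colls_iff)
        also have "card t \<le> card s" using fs t by (rule card_le_of_subset_FU)
        also have "card s \<le> card t0" using t0 by (intro s(2)) simp
        finally show False by simp
      qed
      then have "t \<propto> t0" using t0(3) by blast
      moreover have "t0 \<in> F" using t0 by (intro sub') simp
      ultimately show ?thesis using is_treeD(2)[OF F] by blast
    qed
    then have "s \<in> hered_part F" using sub'[OF s(1)] by (simp add: hered_part_def)
    then show ?thesis using s(1) by auto
  qed
  then show ?thesis using E that by blast
qed

section \<open>Pointwise closed families\<close>

lemma restrict_indicator_inject: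
  assumes "restrict (indicator s :: _ \<Rightarrow> nat) I = restrict (indicator t) I" "s \<subseteq> I" "t \<subseteq> I"
  shows "s = t"
proof -
  have "i \<in> s \<longleftrightarrow> i \<in> t" if "i \<in> I" for i
    using fun_cong[OF assms(1), of i] that by (cases "i \<in> s"; cases "i \<in> t") simp_all
  then show ?thesis using assms(2,3) by auto
qed

text \<open>A limit point is the indicator of a set all of whose finite subsets lie in
  \<open>G\<close>. If that set is finite, it belongs to \<open>G\<close>; if it is infinite, it is
  a branch. Conversely, the finite subsets of a branch converge to the branch, which is no finite
  collection.\<close>

lemma pointwise_closed_iff:
  assumes G: "subset_closed G" "G \<subseteq> fin_colls"
  shows "pointwise_closed G \<longleftrightarrow> \<not> (\<exists>C\<in>inf_colls. \<forall>s. finite s \<longrightarrow> s \<subseteq> C \<longrightarrow> s \<in> G)"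
proof -
  let ?X = "product_topology (\<lambda>_. discrete_topology {0, 1::nat}) fin_subsets"
  let ?\<chi> = "\<lambda>s. restrict (indicator s :: nat set \<Rightarrow> nat) fin_subsets"
  have top: "topspace ?X = PiE fin_subsets (\<lambda>_. {0, 1})" by simp
  have \<chi>_top: "?\<chi> s \<in> topspace ?X" for s unfolding top by (auto simp: indicator_def)
  have blocks: "s \<subseteq> fin_subsets" if "\<forall>t\<in>s. is_block t" for s
    using that by (auto simp: is_block_def)
  show ?thesis
  proof
    assume "pointwise_closed G"
    then have closed: "?X closure_of (?\<chi> ` G) = ?\<chi> ` G"
      unfolding pointwise_closed_def by (rule closure_of_closedin)
    show "\<not> (\<exists>C\<in>inf_colls. \<forall>s. finite s \<longrightarrow> s \<subseteq> C \<longrightarrow> s \<in> G)"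
    proof
      assume "\<exists>C\<in>inf_colls. \<forall>s. finite s \<longrightarrow> s \<subseteq> C \<longrightarrow> s \<in> G"
      then obtain C where C: "C \<in> inf_colls" "\<And>s. finite s \<Longrightarrow> s \<subseteq> C \<Longrightarrow> s \<in> G" by blast
      have "?\<chi> C \<in> ?X closure_of (?\<chi> ` G)"
        unfolding in_closure_of
      proof (intro conjI allI impI)
        fix T assume T: "?\<chi> C \<in> T \<and> openin ?X T"
        then obtain U where U: "finite {i \<in> fin_subsets. U i \<noteq> topspace (discrete_topology {0, 1::nat})}"
          "?\<chi> C \<in> PiE fin_subsets U" "PiE fin_subsets U \<subseteq> T"
          unfolding openin_product_topology_alt by blast
        \<comment> \<open>The finitely many coordinates that the basic open set restricts;
          \<open>C\<close> and \<open>C \<inter> ?K\<close> agree on them.\<close>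
        let ?K = "{i \<in> fin_subsets. U i \<noteq> {0, 1}}"
        have "C \<inter> ?K \<in> G" using U(1) by (intro C(2)) auto
        moreover have "?\<chi> (C \<inter> ?K) \<in> PiE fin_subsets U"
        proof (rule PiE_I)
          fix i assume i: "i \<in> fin_subsets"
          show "?\<chi> (C \<inter> ?K) i \<in> U i"
          proof (cases "i \<in> ?K")
            case True
            then show ?thesis using PiE_mem[OF U(2) i] by (simp add: indicator_def)
          next
            case False
            then show ?thesis using i by (simp add: indicator_def)
          qed
        qed auto
        ultimately show "\<exists>y. y \<in> ?\<chi> ` G \<and> y \<in> T" using U(3) by blast
      qed (rule \<chi>_top)
      then obtain s where s: "s \<in> G" "?\<chi> C = ?\<chi> s" unfolding closed by blast
      have "C \<subseteq> fin_subsets" using inf_colls_block[OF C(1)] by (intro blocks) simp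
      moreover have "s \<subseteq> fin_subsets"
        using s(1) G(2) by (intro blocks) (auto simp: fin_colls_iff block_chain_def)
      ultimately have "C = s" using restrict_indicator_inject[OF s(2)] by simp
      then show False using C(1) s(1) G(2) by (auto simp: fin_colls_iff inf_colls_iff)
    qed
  next
    assume no_branch: "\<not> (\<exists>C\<in>inf_colls. \<forall>s. finite s \<longrightarrow> s \<subseteq> C \<longrightarrow> s \<in> G)"
    have "?X closure_of (?\<chi> ` G) \<subseteq> ?\<chi> ` G"
    proof
      fix x assume x: "x \<in> ?X closure_of (?\<chi> ` G)"
      then have x_top: "x \<in> PiE fin_subsets (\<lambda>_. {0, 1})" unfolding in_closure_of top by blast
      define C where "C = {i \<in> fin_subsets. x i = 1}"
      have fin: "K \<in> G" if K: "finite K" "K \<subseteq> C" for K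
      proof -
        \<comment> \<open>Prescribing the values of \<open>x\<close> on the finite set
          \<open>K\<close> gives a neighbourhood of \<open>x\<close>, and any member of
          \<open>G\<close> in it contains \<open>K\<close>.\<close>
        let ?U = "\<lambda>i. if i \<in> K then {x i} else {0, 1}"
        have "openin ?X (PiE fin_subsets ?U)"
        proof -
          have "finite {i \<in> fin_subsets. ?U i \<noteq> {0, 1}}" by (rule finite_subset[OF _ K(1)]) auto
          moreover have "?U i \<subseteq> {0, 1}" if "i \<in> fin_subsets" for i
            using PiE_mem[OF x_top that] by auto
          ultimately show ?thesis by (simp add: openin_PiE_gen)
        qed
        moreover have "x \<in> PiE fin_subsets ?U"
          using x_top by (auto simp: PiE_iff)
        ultimately obtain s where s: "s \<in> G" "?\<chi> s \<in> PiE fin_subsets ?U"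
          using x unfolding in_closure_of by blast
        have "k \<in> s" if "k \<in> K" for k
        proof -
          have k: "k \<in> fin_subsets" "x k = 1" using that K(2) by (auto simp: C_def)
          then have "indicator s k = (1::nat)" using PiE_mem[OF s(2) k(1)] that by simp
          then show ?thesis by (cases "k \<in> s") simp_all
        qed
        then have "K \<subseteq> s" by auto
        then show ?thesis using s(1) subset_closedD[OF G(1)] by blast
      qed
      have "finite C"
      proof (rule ccontr)
        assume "infinite C"
        \<comment> \<open>Pairs are enough, since being a chain is a condition on two members at a
          time.\<close>
        have "{c, d} \<in> fin_colls" if "c \<in> C" "d \<in> C" for c d
          using fin[of "{c, d}"] that G(2) by auto
        then have "block_chain C" by (fastforce simp: block_chain_def fin_colls_iff)
        then have "C \<in> inf_colls" using \<open>infinite C\<close> by (simp add: inf_colls_iff)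
        then show False using no_branch fin by blast
      qed
      then have "C \<in> G" using fin by blast
      moreover have "x = ?\<chi> C"
      proof
        fix i
        show "x i = ?\<chi> C i"
          using x_top PiE_mem[OF x_top, of i] PiE_arb[OF x_top, of i]
          by (cases "i \<in> fin_subsets") (auto simp: C_def indicator_def)
      qed
      ultimately show "x \<in> ?\<chi> ` G" by blast
    qed
    moreover have "?\<chi> ` G \<subseteq> topspace ?X" using \<chi>_top by blast
    ultimately show "pointwise_closed G"
      unfolding pointwise_closed_def using closure_of_subset_eq by blast
  qed
qed

section \<open>The index against the dichotomy\<close>

theorem theorem3p3:
  fixes L :: "omega1 \<Rightarrow> nat \<Rightarrow> omega1" and F :: "nat set set set" and D :: "nat set set"
  assumes "limit_approx L"
    and "F \<subseteq> fin_colls" and "is_tree F"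
    and "D \<in> inf_colls"
  shows "(\<not> pointwise_closed (hered_part F \<inter> fin_colls_in D) \<longrightarrow>
            (\<exists>D1. D1 \<sqsubset> D \<and> fin_colls_in D1 \<subseteq> F)) \<and>
         (pointwise_closed (hered_part F \<inter> fin_colls_in D) \<longrightarrow>
            (\<forall>D1. D1 \<sqsubset> D \<longrightarrow> sb_index_exists D1 (hered_part F)) \<and>
            bdd_above {sb_index D1 (hered_part F) | D1. D1 \<sqsubset> D} \<and>
            (let \<zeta> = Sup {sb_index D1 (hered_part F) | D1. D1 \<sqsubset> D} in
              \<forall>\<xi>::omega1.
                (\<xi> + 1 < \<zeta> \<longrightarrow>
                  (\<exists>D2. D2 \<sqsubset> D \<and> block_schreier L \<xi> \<inter> fin_colls_in D2 \<subseteq> F)) \<and>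
                (\<xi> > \<zeta> \<longrightarrow>
                  (\<forall>D1. D1 \<sqsubset> D \<longrightarrow>
                    (\<exists>D2. D2 \<sqsubset> D1 \<and>
                      block_schreier L \<xi> \<inter> fin_colls_in D2 \<subseteq> fin_colls - F \<and>
                      F \<inter> fin_colls_in D2 \<subseteq>
                        init_closure (block_schreier L \<xi>) - block_schreier L \<xi>))) \<and>
                (\<xi> + 1 = \<zeta> \<or> \<xi> = \<zeta> \<longrightarrow>
                  (\<exists>D2. D2 \<sqsubset> D \<and>
                    (block_schreier L \<xi> \<inter> fin_colls_in D2 \<subseteq> F \<or>
                     block_schreier L \<xi> \<inter> fin_colls_in D2 \<subseteq> fin_colls - F)))))"
proof -
  note L = assms(1) and F = assms(2) and tree = assms(3) and D = assms(4)
  let ?G = "hered_part F"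
  have GF: "?G \<subseteq> F" using is_treeD(1)[OF tree] by (auto simp: hered_part_def)
  have G: "subset_closed ?G" using F by (rule subset_closed_hered_part)
  have G_fin: "?G \<subseteq> fin_colls" using F by (rule hered_part_subset)
  have closed_iff: "pointwise_closed (?G \<inter> fin_colls_in D) \<longleftrightarrow>
    \<not> (\<exists>C\<in>inf_colls. \<forall>s. finite s \<longrightarrow> s \<subseteq> C \<longrightarrow> s \<in> ?G \<inter> fin_colls_in D)"
    using subset_closed_Int[OF G subset_closed_fin_colls_in] G_fin by (intro pointwise_closed_iff) auto
  have ramsey: "\<exists>E. E \<sqsubset> D' \<and> (block_schreier L \<xi> \<inter> fin_colls_in E \<subseteq> F \<or>
      block_schreier L \<xi> \<inter> fin_colls_in E \<subseteq> fin_colls - F)" if D': "D' \<in> inf_colls" for D' \<xi>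
  proof -
    obtain E where "E \<sqsubset> D'" "(\<forall>s\<in>block_schreier L \<xi>. s \<subseteq> FU E \<longrightarrow> s \<in> F) \<or>
      (\<forall>s\<in>block_schreier L \<xi>. s \<subseteq> FU E \<longrightarrow> s \<notin> F)"
      using block_schreier_ramsey[OF L D', of \<xi> F] by blast
    then show ?thesis by (intro exI[of _ E]) (auto simp: fin_colls_in_iff)
  qed
  have case1: "\<exists>D1. D1 \<sqsubset> D \<and> fin_colls_in D1 \<subseteq> F" if not_closed: "\<not> pointwise_closed (?G \<inter> fin_colls_in D)"
  proof -
    obtain C where C: "C \<in> inf_colls" "\<And>s. finite s \<Longrightarrow> s \<subseteq> C \<Longrightarrow> s \<in> ?G \<inter> fin_colls_in D"
      using not_closed unfolding closed_iff by blast
    \<comment> \<open>The singletons of the branch already belong to the family over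
      \<open>D\<close>, so the branch itself is a subcollection of \<open>D\<close>.\<close>
    have "c \<in> FU D" if "c \<in> C" for c using C(2)[of "{c}"] that by (auto simp: fin_colls_in_iff)
    then have "C \<sqsubset> D" using C(1) D by (auto simp: coll_less_def)
    moreover have "fin_colls_in C \<subseteq> F"
    proof
      fix s assume "s \<in> fin_colls_in C"
      then have s: "s \<in> fin_colls" "finite s" "s \<subseteq> FU C" by (auto simp: fin_colls_in_iff fin_colls_iff)
      from FU_finite_support[OF s(2,3)] obtain K where K: "K \<subseteq> C" "finite K" "s \<subseteq> FU K"
        by (elim exE conjE)
      \<comment> \<open>Finitely many members of the branch generate all of \<open>s\<close>, and
        heredity passes from them to unions.\<close>
      have "K \<in> ?G" using C(2)[OF K(2,1)] by simp
      then have "s \<in> ?G" using s(1) K(3) by (rule hered_part_hereditary)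
      then show "s \<in> F" using GF by blast
    qed
    ultimately show ?thesis by blast
  qed
  show ?thesis
  proof (intro conjI impI case1)
    assume closed: "pointwise_closed (?G \<inter> fin_colls_in D)"
    have "\<not> (\<exists>C\<in>inf_colls. C \<subseteq> FU D \<and> (\<forall>s. finite s \<longrightarrow> s \<subseteq> C \<longrightarrow> s \<in> ?G))"
    proof
      assume "\<exists>C\<in>inf_colls. C \<subseteq> FU D \<and> (\<forall>s. finite s \<longrightarrow> s \<subseteq> C \<longrightarrow> s \<in> ?G)"
      then obtain C where C: "C \<in> inf_colls" "C \<subseteq> FU D" "\<And>s. finite s \<Longrightarrow> s \<subseteq> C \<Longrightarrow> s \<in> ?G" by blast
      have "s \<in> ?G \<inter> fin_colls_in D" if "finite s" "s \<subseteq> C" for s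
        using C(3)[OF that] C(2) that(2) G_fin by (auto simp: fin_colls_in_iff)
      then show False using closed C(1) unfolding closed_iff by blast
    qed
    then obtain b where b: "\<And>E. E \<sqsubset> D \<Longrightarrow> sb_deriv E ?G b = {}"
      using sb_deriv_eventually_empty[OF G G_fin] by blast
    show exists: "\<forall>D1. D1 \<sqsubset> D \<longrightarrow> sb_index_exists D1 ?G"
      using b unfolding sb_index_exists_def by blast
    let ?S = "{sb_index D1 ?G | D1. D1 \<sqsubset> D}"
    have "sb_index E ?G \<le> b" if "E \<sqsubset> D" for E
      unfolding sb_index_def using b[OF that] by (rule Least_le)
    then show bdd: "bdd_above ?S" by (auto simp: bdd_above_def)
    have ne: "?S \<noteq> {}" using coll_less_refl[OF D] by blast
    show "let \<zeta> = Sup ?S in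
              \<forall>\<xi>::omega1.
                (\<xi> + 1 < \<zeta> \<longrightarrow>
                  (\<exists>D2. D2 \<sqsubset> D \<and> block_schreier L \<xi> \<inter> fin_colls_in D2 \<subseteq> F)) \<and>
                (\<xi> > \<zeta> \<longrightarrow>
                  (\<forall>D1. D1 \<sqsubset> D \<longrightarrow>
                    (\<exists>D2. D2 \<sqsubset> D1 \<and>
                      block_schreier L \<xi> \<inter> fin_colls_in D2 \<subseteq> fin_colls - F \<and>
                      F \<inter> fin_colls_in D2 \<subseteq>
                        init_closure (block_schreier L \<xi>) - block_schreier L \<xi>))) \<and>
                (\<xi> + 1 = \<zeta> \<or> \<xi> = \<zeta> \<longrightarrow>
                  (\<exists>D2. D2 \<sqsubset> D \<and>
                    (block_schreier L \<xi> \<inter> fin_colls_in D2 \<subseteq> F \<or>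
                     block_schreier L \<xi> \<inter> fin_colls_in D2 \<subseteq> fin_colls - F)))"
      unfolding Let_def
    proof (intro allI conjI impI)
      fix \<xi>
      assume "\<xi> + 1 < Sup ?S"
      then obtain D1 where D1: "D1 \<sqsubset> D" "osucc \<xi> < sb_index D1 ?G"
        using less_cSup_iff[OF ne bdd] by (auto simp: add_one_omega1)
      \<comment> \<open>This is the stage refuted by \<open>sb_deriv_upper\<close> if the family is
        avoided, which accounts for the \<open>+ 1\<close> in the assumption.\<close>
      then have "sb_deriv D1 ?G (osucc \<xi>) \<noteq> {}" unfolding sb_index_def by (intro not_less_Least)
      then have nonempty: "{} \<in> sb_deriv D1 ?G (osucc \<xi>)"
        using subset_closedD[OF subset_closed_sb_deriv[OF G], of _ D1 "osucc \<xi>" "{}"] by auto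
      obtain E where E: "E \<sqsubset> D1" "block_schreier L \<xi> \<inter> fin_colls_in E \<subseteq> F \<or>
        block_schreier L \<xi> \<inter> fin_colls_in E \<subseteq> fin_colls - F"
        using ramsey[OF coll_lessD(1)[OF D1(1)]] by blast
      have "\<not> block_schreier L \<xi> \<inter> fin_colls_in E \<subseteq> fin_colls - F"
      proof
        assume *: "block_schreier L \<xi> \<inter> fin_colls_in E \<subseteq> fin_colls - F"
        have "{} \<notin> sb_deriv E ?G (osucc \<xi>)"
          using * GF by (intro sb_deriv_upper[OF L coll_lessD(1)[OF E(1)]])
            (auto simp: fin_colls_in_iff block_schreier_iff)
        moreover have "{} \<in> fin_colls_in E" by (simp add: fin_colls_in_iff empty_fin_colls)
        ultimately show False using sb_deriv_coll_less[OF E(1), of ?G "osucc \<xi>"] nonempty by auto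
      qed
      then show "\<exists>D2. D2 \<sqsubset> D \<and> block_schreier L \<xi> \<inter> fin_colls_in D2 \<subseteq> F"
        using E coll_less_trans[OF E(1) D1(1)] by blast
    next
      fix \<xi> D1
      assume \<xi>: "Sup ?S < \<xi>" and D1: "D1 \<sqsubset> D"
      obtain E where E: "E \<sqsubset> D1" "block_schreier L \<xi> \<inter> fin_colls_in E \<subseteq> F \<or>
        block_schreier L \<xi> \<inter> fin_colls_in E \<subseteq> fin_colls - F"
        using ramsey[OF coll_lessD(1)[OF D1]] by blast
      have "\<not> block_schreier L \<xi> \<inter> fin_colls_in E \<subseteq> F"
      proof
        assume "block_schreier L \<xi> \<inter> fin_colls_in E \<subseteq> F"
        then have "\<forall>s\<in>block_schreier L \<xi>. s \<subseteq> FU E \<longrightarrow> s \<in> F"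
          by (auto simp: fin_colls_in_iff block_schreier_iff)
        \<comment> \<open>The derivative only sees the hereditary part, so containment in
          \<open>F\<close> has to be improved before \<open>sb_deriv_lower\<close> can be
          used.\<close>
        then obtain E' where E': "E' \<sqsubset> E" "\<forall>s\<in>block_schreier L \<xi>. s \<subseteq> FU E' \<longrightarrow> s \<in> ?G"
          using block_schreier_hered_part[OF L tree coll_lessD(1)[OF E(1)]] by blast
        have nonempty: "{} \<in> sb_deriv E' ?G \<xi>"
          using E'(2) by (intro sb_deriv_lower[OF L coll_lessD(1)[OF E'(1)] G])
            (auto simp: fin_colls_in_iff empty_fin_colls)
        have "E' \<sqsubset> D" using coll_less_trans[OF E'(1) coll_less_trans[OF E(1) D1]] .
        then have "sb_index E' ?G \<le> Sup ?S" using bdd by (intro cSup_upper) auto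
        then have "sb_index E' ?G \<le> \<xi>" using \<xi> by simp
        then have "sb_deriv E' ?G \<xi> \<subseteq> sb_deriv E' ?G (sb_index E' ?G)" by (rule sb_deriv_antimono)
        moreover have "sb_deriv E' ?G (sb_index E' ?G) = {}"
          unfolding sb_index_def using b[OF \<open>E' \<sqsubset> D\<close>] by (rule LeastI)
        ultimately show False using nonempty by simp
      qed
      then have out: "block_schreier L \<xi> \<inter> fin_colls_in E \<subseteq> fin_colls - F" using E(2) by blast
      have "s \<in> init_closure (block_schreier L \<xi>) - block_schreier L \<xi>"
        if s: "s \<in> F \<inter> fin_colls_in E" for s
      proof -
        have s': "s \<in> fin_colls" "s \<subseteq> FU E" using s by (simp_all add: fin_colls_in_iff)
        obtain t0 where t0: "t0 \<in> block_schreier L \<xi>" "t0 \<subseteq> FU E" "t0 \<subset> s \<and> t0 \<propto> s \<or> s \<propto> t0"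
          using L coll_lessD(1)[OF E(1)] s' by (rule block_schreier_comparable)
        \<comment> \<open>A tree contains the initial segments of its members, so \<open>t0\<close>
          cannot be one of \<open>s\<close>; only the other alternative remains.\<close>
        have "t0 \<notin> F" using out t0(1,2) by (auto simp: fin_colls_in_iff block_schreier_iff)
        then have "s \<propto> t0" using t0(3) is_treeD(2)[OF tree, of s t0] s by blast
        then have "s \<in> init_closure (block_schreier L \<xi>)" using t0(1) by (auto simp: init_closure_def)
        then show ?thesis using out s by auto
      qed
      then show "\<exists>D2. D2 \<sqsubset> D1 \<and> block_schreier L \<xi> \<inter> fin_colls_in D2 \<subseteq> fin_colls - F \<and>
          F \<inter> fin_colls_in D2 \<subseteq> init_closure (block_schreier L \<xi>) - block_schreier L \<xi>"
        using E(1) out by blast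
    next
      fix \<xi>
      show "\<exists>D2. D2 \<sqsubset> D \<and> (block_schreier L \<xi> \<inter> fin_colls_in D2 \<subseteq> F \<or>
          block_schreier L \<xi> \<inter> fin_colls_in D2 \<subseteq> fin_colls - F)"
        using ramsey[OF D] .
    qed
  qed
qed

end
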